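(* Let $u^*$ and $v$ be admissible controls, $\bar u=v-u^*$, and $u^\varepsilon=u^*+\varepsilon\bar u$ for $\varepsilon\in\mathbb{R}$. Let $x^\varepsilon(\cdot)$ and $x^*(\cdot)$ be the solutions of $$dx(t)=b(t,x(t),u(t))\,dt+\sum_{j=1}^m\sigma^j(t,x(t),u(t))\,d^\circ B_j^H(t),\qquad x(0)=x_0,$$ with $u=u^\varepsilon$ and $u=u^*$ respectively. Then, almost surely, $$\lim_{\varepsilon\to0}\sup_{0\le t\le T}|x^\varepsilon(t)-x^*(t)|=0,\qquad \lim_{\varepsilon\to0}\sup_{0\le t\le T}\Big|\frac{x^\varepsilon(t)-x^*(t)}{\varepsilon}-y(t)\Big|=0,$$ where $y$ is the solution of $$y(t)=\int_0^t[b_x^*(s)y(s)+b_u^*(s)\bar u(s)]\,ds+\int_0^t\sum_{j=1}^m[\sigma_x^{j,*}(s)y(s)+\sigma_u^{j,*}(s)\bar u(s)]\,d^\circ B_j^H(s).$$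
   Context: Fix $T\in(0,\infty)$, $H\in(1/2,1)$ and an $m$-dimensional fractional Brownian motion $B^H=(B_1^H,\dots,B_m^H)$ of Hurst parameter $H$ on $[0,T]$ (independent components), generating the filtration $(\mathcal{F}_t)$; $(\mathcal{G}_t)$ is a right-continuous filtration with $\mathcal{G}_t\subset\mathcal{F}_t$. $d^\circ B_j^H$ is the pathwise (Riemann–Stieltjes/Stratonovich) integral. Admissible controls: $\mathcal{G}$-adapted $u:[0,T]\times\Omega\to\mathbb{R}^d$ such that $u\in C^\mu[0,T]$ for some $\mu>1-H$; there exist constants $C>0$, $c>0$, $\beta<H$ with $\|u\|_{\mu,0,T}\le Ce^{c\sum_{j}\|B_j^H\|_{\beta,0,T}}$; and $\int_0^T\int_0^T\mathbb{E}(|D_s^Hu(t)|^2)ds\,dt<\infty$. Here $\|x\|_{\beta,0,T}=\sup_{0\le\theta<r\le T}|x_r-x_\theta|/|r-\theta|^\beta$. $D^H=(D^{H,1},\dots,D^{H,m})$ is the Malliavin derivative with respect to $B^H$: writing $B_l^H(t)=\int_0^tZ_H(t,s)dW_l(s)$ with $W$ the underlying standard Brownian motion and $Z_H$ the usual Volterra kernel, and letting $\xi_1,\xi_2,\dots$ be a smooth orthonormal basis of $L^2([0,T])$, put $\eta_j(t)=c_Ht^{1/2-H}\frac{d}{dt}\int_t^T(u-t)^{1/2-H}u^{H-1/2}\xi_j(u)du$ with $c_H$ the constant such that $\int_0^T\xi_j\,dW_l=\int_0^T\eta_j\,dB^H_l=:\tilde\eta_{j,l}$; then $D_s^{H,l}g(\tilde\eta_{j_1,l_1},\dots,\tilde\eta_{j_n,l_n})=\sum_i\frac{\partial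 g}{\partial x_i}(\tilde\eta_{j_1,l_1},\dots,\tilde\eta_{j_n,l_n})\eta_{j_i}(s)I_{\{l_i=l\}}$ for polynomials $g$, extended by closure under $\|G\|_p+\sum_l[\mathbb{E}(\int_0^T|D_t^{H,l}G|^2dt)^{p/2}]^{1/p}$. Assumptions. $b:[0,T]\times\mathbb{R}^n\times\mathbb{R}^d\to\mathbb{R}^n$ and $\sigma=(\sigma^1,\dots,\sigma^m):[0,T]\times\mathbb{R}^n\times\mathbb{R}^d\to\mathbb{R}^{n\times m}$ are continuous; $b$ is continuously differentiable in $x,u$ and, for some constant $L$, $|b_x|+|b_u|\le L$ and $|b_x(t,x,u)-b_x(t,y,v)|+|b_u(t,x,u)-b_u(t,y,v)|\le L(|x-y|+|u-v|)$. $\sigma$ is twice continuously differentiable in $x,u$ and there are $1-H<\gamma<1$ and $L$ with: (i) $|\sigma_x|+|\sigma_u|\le L$ and $|\sigma_{xx}|+|\sigma_{uu}|+|\sigma_{xu}|\le L$; (ii) $\sigma,\sigma_x,\sigma_u,\sigma_{xx},\sigma_{xu},\sigma_{uu}$ are $\gamma$-Hölder in $t$ uniformly in $(x,u)$ (the sum of the absolute increments between times $t$ and $s$ is $\le L|t-s|^\gamma$); (iii) $|\sigma_{uu}(t,x,u)-\sigma_{uu}(t,y,v)|+|\sigma_{xu}(t,x,u)-\sigma_{xu}(t,y,v)|\le L(|x-y|+|u-v|)$. Under these assumptions the controlled equation has a unique solution for every admissible control. A superscript $*$ on a derivative denotes evaluation at $(t,x^*(t),u^*(t))$: $b_x^*(t)=b_x(t,x^*(t),u^*(t))$,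 etc. $x_0\in\mathbb{R}^n$ is fixed. *)

theory Defs
  imports "HOL-Probability.Probability"
begin

definition ennreal_powr :: "ennreal \<Rightarrow> real \<Rightarrow> ennreal" where
  "ennreal_powr x r = (if x = \<top> then \<top> else ennreal (enn2real x powr r))"


subsection \<open>Hoelder paths and the Riemann--Stieltjes integral\<close>

definition holder_on :: "real \<Rightarrow> real \<Rightarrow> (real \<Rightarrow> 'a::real_normed_vector) \<Rightarrow> bool" where
  "holder_on \<beta> T x \<longleftrightarrow> (\<exists>C. \<forall>s\<in>{0..T}. \<forall>t\<in>{0..T}. norm (x t - x s) \<le> C * \<bar>t - s\<bar> powr \<beta>)"

text \<open>The supremum is taken in the reals, so it is meaningful only when \<^const>\<open>holder_on\<close> holds
  with the same exponent.\<close>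

definition holder_seminorm :: "real \<Rightarrow> real \<Rightarrow> (real \<Rightarrow> 'a::real_normed_vector) \<Rightarrow> real" where
  "holder_seminorm \<beta> T x =
     (SUP (\<theta>, r)\<in>{(\<theta>, r). 0 \<le> \<theta> \<and> \<theta> < r \<and> r \<le> T}. norm (x r - x \<theta>) / \<bar>r - \<theta>\<bar> powr \<beta>)"

text \<open>Limit of the sums of \<open>f(\<tau>\<^sub>i) (g(t\<^sub>i\<^sub>+\<^sub>1) - g(t\<^sub>i))\<close> as the mesh tends to zero: the gauge is a
  constant radius, so being fine for it is the same as having small mesh. Degenerate intervals of
  a tagged division contribute zero.\<close>

definition has_RS_integral ::
    "(real \<Rightarrow> 'a::real_normed_vector) \<Rightarrow> (real \<Rightarrow> real) \<Rightarrow> 'a \<Rightarrow> real \<Rightarrow> real \<Rightarrow> bool" where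
  "has_RS_integral f g I a b \<longleftrightarrow>
     (\<forall>e>0. \<exists>\<delta>>0. \<forall>p. p tagged_division_of {a..b} \<and> (\<lambda>x. ball x \<delta>) fine p \<longrightarrow>
        norm ((\<Sum>(\<tau>, K)\<in>p. (g (Sup K) - g (Inf K)) *\<^sub>R f \<tau>) - I) < e)"

definition RS_integrable ::
    "(real \<Rightarrow> 'a::real_normed_vector) \<Rightarrow> (real \<Rightarrow> real) \<Rightarrow> real \<Rightarrow> real \<Rightarrow> bool" where
  "RS_integrable f g a b \<longleftrightarrow> (\<exists>I. has_RS_integral f g I a b)"

definition RS_integral ::
    "(real \<Rightarrow> 'a::real_normed_vector) \<Rightarrow> (real \<Rightarrow> real) \<Rightarrow> real \<Rightarrow> real \<Rightarrow> 'a" where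
  "RS_integral f g a b = (SOME I. has_RS_integral f g I a b)"


subsection \<open>Fractional Brownian motion\<close>

definition gaussian_rv :: "'w measure \<Rightarrow> ('w \<Rightarrow> real) \<Rightarrow> bool" where
  "gaussian_rv M X \<longleftrightarrow> X \<in> borel_measurable M \<and>
     ((\<exists>\<mu>. AE \<omega> in M. X \<omega> = \<mu>) \<or>
      (\<exists>\<mu> \<sigma>. 0 < \<sigma> \<and> distributed M lborel X (normal_density \<mu> \<sigma>)))"

text \<open>For \<open>H = 1/2\<close> the covariance is \<open>min s t\<close>, so this covers standard Brownian motion.\<close>

definition fractional_brownian_motion ::
    "'w measure \<Rightarrow> real \<Rightarrow> real \<Rightarrow> (real \<Rightarrow> 'w \<Rightarrow> real^'m) \<Rightarrow> bool" where
  "fractional_brownian_motion M H T B \<longleftrightarrow>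
     (\<forall>t\<in>{0..T}. B t \<in> borel_measurable M) \<and>
     (AE \<omega> in M. B 0 \<omega> = 0 \<and> continuous_on {0..T} (\<lambda>t. B t \<omega>)) \<and>
     prob_space.indep_vars M (\<lambda>_. Pi\<^sub>M {0..T} (\<lambda>_. borel))
       (\<lambda>l \<omega>. \<lambda>t\<in>{0..T}. B t \<omega> $ l) UNIV \<and>
     (\<forall>l. (\<forall>S a. finite S \<and> S \<subseteq> {0..T} \<longrightarrow> gaussian_rv M (\<lambda>\<omega>. \<Sum>t\<in>S. a t * B t \<omega> $ l)) \<and>
          (\<forall>t\<in>{0..T}. prob_space.expectation M (\<lambda>\<omega>. B t \<omega> $ l) = 0) \<and>
          (\<forall>s\<in>{0..T}. \<forall>t\<in>{0..T}. prob_space.expectation M (\<lambda>\<omega>. B s \<omega> $ l * B t \<omega> $ l) =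
             (s powr (2 * H) + t powr (2 * H) - \<bar>t - s\<bar> powr (2 * H)) / 2))"

text \<open>The \<open>\<sigma>\<close>-algebra generated by \<open>B s\<close>, \<open>0 \<le> s \<le> t\<close>, not augmented by null sets.\<close>

definition natural_sigma ::
    "'w measure \<Rightarrow> (real \<Rightarrow> 'w \<Rightarrow> 'a::topological_space) \<Rightarrow> real \<Rightarrow> 'w measure" where
  "natural_sigma M B t =
     sigma (space M) {B s -` A \<inter> space M | s A. 0 \<le> s \<and> s \<le> t \<and> A \<in> sets borel}"

definition right_continuous_subfiltration ::
    "real \<Rightarrow> (real \<Rightarrow> 'w measure) \<Rightarrow> (real \<Rightarrow> 'w measure) \<Rightarrow> bool" where
  "right_continuous_subfiltration T F G \<longleftrightarrow>
     (\<forall>t\<in>{0..T}. space (G t) = space (F t) \<and> sets (G t) \<subseteq> sets (F t)) \<and>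
     (\<forall>s\<in>{0..T}. \<forall>t\<in>{0..T}. s \<le> t \<longrightarrow> sets (G s) \<subseteq> sets (G t)) \<and>
     (\<forall>t\<in>{0..<T}. sets (G t) = (\<Inter>s\<in>{t<..T}. sets (G s)))"


subsection \<open>Wiener integrals of deterministic functions\<close>

text \<open>\<open>N\<close> is the square of the norm in which step functions approximate the integrand;
  the integrals of the step functions converge in \<open>L\<^sup>2(M)\<close>.\<close>

definition has_wiener_integral ::
    "'w measure \<Rightarrow> real \<Rightarrow> ((real \<Rightarrow> real) \<Rightarrow> ennreal) \<Rightarrow> (real \<Rightarrow> 'w \<Rightarrow> real) \<Rightarrow>
     (real \<Rightarrow> real) \<Rightarrow> ('w \<Rightarrow> real) \<Rightarrow> bool" where
  "has_wiener_integral M T N X f I \<longleftrightarrow> I \<in> borel_measurable M \<and>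
     (\<exists>(n :: nat \<Rightarrow> nat) (a :: nat \<Rightarrow> nat \<Rightarrow> real) (c :: nat \<Rightarrow> nat \<Rightarrow> real) (d :: nat \<Rightarrow> nat \<Rightarrow> real).
        (\<forall>k i. 0 \<le> c k i \<and> c k i \<le> d k i \<and> d k i \<le> T) \<and>
        (\<lambda>k. N (\<lambda>s. f s - (\<Sum>i<n k. a k i * indicator {c k i<..d k i} s))) \<longlonglongrightarrow> 0 \<and>
        (\<lambda>k. \<integral>\<^sup>+ \<omega>. ennreal (((\<Sum>i<n k. a k i * (X (d k i) \<omega> - X (c k i) \<omega>)) - I \<omega>)\<^sup>2) \<partial>M)
          \<longlonglongrightarrow> 0)"

definition bm_sqnorm :: "real \<Rightarrow> (real \<Rightarrow> real) \<Rightarrow> ennreal" where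
  "bm_sqnorm T \<phi> = (\<integral>\<^sup>+ s\<in>{0..T}. ennreal ((\<phi> s)\<^sup>2) \<partial>lborel)"

text \<open>For \<open>H > 1/2\<close>, the variance of the Wiener integral of \<open>\<phi>\<close> against fractional Brownian motion
  is this double integral without the absolute values around \<open>\<phi>\<close>.\<close>

definition fbm_sqnorm :: "real \<Rightarrow> real \<Rightarrow> (real \<Rightarrow> real) \<Rightarrow> ennreal" where
  "fbm_sqnorm H T \<phi> = (\<integral>\<^sup>+ s\<in>{0..T}. (\<integral>\<^sup>+ t\<in>{0..T}.
     ennreal (H * (2 * H - 1) * \<bar>\<phi> s\<bar> * \<bar>\<phi> t\<bar> * \<bar>s - t\<bar> powr (2 * H - 2)) \<partial>lborel) \<partial>lborel)"

text \<open>The usual kernel for \<open>H > 1/2\<close>; it vanishes for \<open>s \<ge> t\<close>.\<close>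

definition volterra_kernel :: "real \<Rightarrow> real \<Rightarrow> real \<Rightarrow> real" where
  "volterra_kernel H t s =
     sqrt (H * (2 * H - 1) / Beta (2 - 2 * H) (H - 1 / 2)) * s powr (1 / 2 - H) *
     (LBINT u:{s..t}. (u - s) powr (H - 3 / 2) * u powr (H - 1 / 2))"

definition underlying_brownian_motion ::
    "'w measure \<Rightarrow> real \<Rightarrow> real \<Rightarrow> (real \<Rightarrow> 'w \<Rightarrow> real^'m) \<Rightarrow> (real \<Rightarrow> 'w \<Rightarrow> real^'m) \<Rightarrow> bool" where
  "underlying_brownian_motion M H T B W \<longleftrightarrow> fractional_brownian_motion M (1 / 2) T W \<and>
     (\<forall>l. \<forall>t\<in>{0..T}. has_wiener_integral M T (bm_sqnorm T) (\<lambda>s \<omega>. W s \<omega> $ l)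
        (volterra_kernel H t) (\<lambda>\<omega>. B t \<omega> $ l))"


subsection \<open>The Malliavin derivative with respect to fractional Brownian motion\<close>

definition smooth_on_interval :: "real \<Rightarrow> (real \<Rightarrow> real) \<Rightarrow> bool" where
  "smooth_on_interval T f \<longleftrightarrow> (\<exists>d :: nat \<Rightarrow> real \<Rightarrow> real. (\<forall>t\<in>{0..T}. d 0 t = f t) \<and>
     (\<forall>k. \<forall>t\<in>{0..T}. (d k has_real_derivative d (Suc k) t) (at t within {0..T})))"

definition smooth_orthonormal_basis :: "real \<Rightarrow> (nat \<Rightarrow> real \<Rightarrow> real) \<Rightarrow> bool" where
  "smooth_orthonormal_basis T \<xi> \<longleftrightarrow>
     (\<forall>j. smooth_on_interval T (\<xi> j)) \<and>
     (\<forall>i j. (LBINT s:{0..T}. \<xi> i s * \<xi> j s) = (if i = j then 1 else 0)) \<and>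
     (\<forall>f. f \<in> borel_measurable borel \<and> set_integrable lborel {0..T} (\<lambda>s. (f s)\<^sup>2) \<longrightarrow>
        (\<lambda>N. LBINT s:{0..T}. (f s - (\<Sum>j<N. (LBINT r:{0..T}. f r * \<xi> j r) * \<xi> j s))\<^sup>2)
          \<longlonglongrightarrow> 0)"

definition eta_transform :: "real \<Rightarrow> real \<Rightarrow> real \<Rightarrow> (real \<Rightarrow> real) \<Rightarrow> real \<Rightarrow> real" where
  "eta_transform H T c \<xi> t = c * t powr (1 / 2 - H) *
     deriv (\<lambda>r. LBINT u:{r..T}. (u - r) powr (1 / 2 - H) * u powr (H - 1 / 2) * \<xi> u) t"

text \<open>Since \<open>\<xi>\<close> is an orthonormal basis, the second condition holds for exactly one constant \<open>c\<close>.
  The random variable \<open>\<eta> j l\<close> is a version of both integrals.\<close>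

definition basis_integrals ::
    "'w measure \<Rightarrow> real \<Rightarrow> real \<Rightarrow> real \<Rightarrow> (real \<Rightarrow> 'w \<Rightarrow> real^'m) \<Rightarrow> (real \<Rightarrow> 'w \<Rightarrow> real^'m) \<Rightarrow>
     (nat \<Rightarrow> real \<Rightarrow> real) \<Rightarrow> (nat \<Rightarrow> 'm \<Rightarrow> 'w \<Rightarrow> real) \<Rightarrow> bool" where
  "basis_integrals M H T c B W \<xi> \<eta> \<longleftrightarrow> (\<forall>j l.
     has_wiener_integral M T (bm_sqnorm T) (\<lambda>t \<omega>. W t \<omega> $ l) (\<xi> j) (\<eta> j l) \<and>
     has_wiener_integral M T (fbm_sqnorm H T) (\<lambda>t \<omega>. B t \<omega> $ l) (eta_transform H T c (\<xi> j)) (\<eta> j l))"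

text \<open>Polynomials in the variables \<open>x 0, \<dots>, x (n - 1)\<close>.\<close>

inductive real_polyfun :: "nat \<Rightarrow> ((nat \<Rightarrow> real) \<Rightarrow> real) \<Rightarrow> bool" for n :: nat where
  coord: "i < n \<Longrightarrow> real_polyfun n (\<lambda>x. x i)"
| const: "real_polyfun n (\<lambda>x. c)"
| add: "real_polyfun n f \<Longrightarrow> real_polyfun n g \<Longrightarrow> real_polyfun n (\<lambda>x. f x + g x)"
| mult: "real_polyfun n f \<Longrightarrow> real_polyfun n g \<Longrightarrow> real_polyfun n (\<lambda>x. f x * g x)"

text \<open>In the relations below the derivative \<open>DG s \<omega>\<close> is the vector with components
  \<open>D\<^sub>s\<^sup>H\<^sup>,\<^sup>l G\<close>.
  The functions \<open>e j\<close> are the transforms \<open>\<eta>\<^sub>j\<close>, and \<open>\<eta> j l\<close> is the integral of \<open>e j\<close> against the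
  \<open>l\<close>-th component.\<close>

definition polynomial_functional ::
    "(nat \<Rightarrow> real \<Rightarrow> real) \<Rightarrow> (nat \<Rightarrow> 'm \<Rightarrow> 'w \<Rightarrow> real) \<Rightarrow> ('w \<Rightarrow> real) \<Rightarrow>
     (real \<Rightarrow> 'w \<Rightarrow> real^'m) \<Rightarrow> bool" where
  "polynomial_functional e \<eta> G DG \<longleftrightarrow> (\<exists>n g j l. real_polyfun n g \<and>
     G = (\<lambda>\<omega>. g (\<lambda>i. \<eta> (j i) (l i) \<omega>)) \<and>
     DG = (\<lambda>s \<omega>. \<chi> k. \<Sum>i<n.
       deriv (\<lambda>r. g ((\<lambda>i. \<eta> (j i) (l i) \<omega>)(i := r))) (\<eta> (j i) (l i) \<omega>) *
       e (j i) s * (if l i = k then 1 else 0)))"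

definition malliavin_norm ::
    "'w measure \<Rightarrow> real \<Rightarrow> real \<Rightarrow> ('w \<Rightarrow> real) \<Rightarrow> (real \<Rightarrow> 'w \<Rightarrow> real^'m) \<Rightarrow> ennreal" where
  "malliavin_norm M T p G DG =
     ennreal_powr (\<integral>\<^sup>+ \<omega>. ennreal (\<bar>G \<omega>\<bar> powr p) \<partial>M) (1 / p) +
     (\<Sum>l\<in>UNIV. ennreal_powr (\<integral>\<^sup>+ \<omega>. ennreal_powr
        (\<integral>\<^sup>+ t\<in>{0..T}. ennreal ((DG t \<omega> $ l)\<^sup>2) \<partial>lborel) (p / 2) \<partial>M) (1 / p))"

definition has_malliavin_derivative ::
    "'w measure \<Rightarrow> real \<Rightarrow> real \<Rightarrow> (nat \<Rightarrow> real \<Rightarrow> real) \<Rightarrow> (nat \<Rightarrow> 'm \<Rightarrow> 'w \<Rightarrow> real) \<Rightarrow>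
     ('w \<Rightarrow> real) \<Rightarrow> (real \<Rightarrow> 'w \<Rightarrow> real^'m) \<Rightarrow> bool" where
  "has_malliavin_derivative M T p e \<eta> G DG \<longleftrightarrow> (\<exists>Gk DGk.
     (\<forall>k :: nat. polynomial_functional e \<eta> (Gk k) (DGk k)) \<and>
     (\<lambda>k. malliavin_norm M T p (\<lambda>\<omega>. Gk k \<omega> - G \<omega>) (\<lambda>s \<omega>. DGk k s \<omega> - DG s \<omega>)) \<longlonglongrightarrow> 0)"


subsection \<open>Admissible controls\<close>

text \<open>The matrix \<open>Du s t \<omega>\<close> has rows \<open>D\<^sub>s\<^sup>H u\<^sub>i(t)\<close>.\<close>

definition admissible_control ::
    "'w measure \<Rightarrow> real \<Rightarrow> real \<Rightarrow> (real \<Rightarrow> 'w \<Rightarrow> real^'m) \<Rightarrow> (real \<Rightarrow> 'w measure) \<Rightarrow>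
     (nat \<Rightarrow> real \<Rightarrow> real) \<Rightarrow> (nat \<Rightarrow> 'm \<Rightarrow> 'w \<Rightarrow> real) \<Rightarrow> (real \<Rightarrow> 'w \<Rightarrow> real^'d) \<Rightarrow> bool" where
  "admissible_control M H T B G e \<eta> u \<longleftrightarrow>
     (\<forall>t\<in>{0..T}. u t \<in> borel_measurable (G t)) \<and>
     (\<exists>\<mu>>1 - H. (AE \<omega> in M. holder_on \<mu> T (\<lambda>t. u t \<omega>)) \<and>
        (\<exists>C>0. \<exists>c>0. \<exists>\<beta><H. AE \<omega> in M. holder_seminorm \<mu> T (\<lambda>t. u t \<omega>) \<le>
           C * exp (c * (\<Sum>j\<in>UNIV. holder_seminorm \<beta> T (\<lambda>t. B t \<omega> $ j))))) \<and>
     (\<exists>p\<ge>1. \<exists>Du :: real \<Rightarrow> real \<Rightarrow> 'w \<Rightarrow> real^'m^'d.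
        (\<lambda>(s, t, \<omega>). Du s t \<omega>) \<in> borel_measurable (lborel \<Otimes>\<^sub>M lborel \<Otimes>\<^sub>M M) \<and>
        (AE t in lborel. t \<in> {0..T} \<longrightarrow>
           (\<forall>i. has_malliavin_derivative M T p e \<eta> (\<lambda>\<omega>. u t \<omega> $ i) (\<lambda>s \<omega>. Du s t \<omega> $ i))) \<and>
        (\<integral>\<^sup>+ t\<in>{0..T}. (\<integral>\<^sup>+ s\<in>{0..T}. (\<integral>\<^sup>+ \<omega>. ennreal ((norm (Du s t \<omega>))\<^sup>2) \<partial>M)
           \<partial>lborel) \<partial>lborel) < \<top>)"


subsection \<open>Coefficients and the controlled equation\<close>

text \<open>\<open>f\<close> is continuously differentiable in both variables, with partial derivatives \<open>fx\<close>, \<open>fu\<close>.\<close>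

definition C1_partials ::
    "('x::real_normed_vector \<Rightarrow> 'u::real_normed_vector \<Rightarrow> 'a::real_normed_vector) \<Rightarrow>
     ('x \<Rightarrow> 'u \<Rightarrow> 'x \<Rightarrow>\<^sub>L 'a) \<Rightarrow> ('x \<Rightarrow> 'u \<Rightarrow> 'u \<Rightarrow>\<^sub>L 'a) \<Rightarrow> bool" where
  "C1_partials f fx fu \<longleftrightarrow>
     (\<forall>x u. ((\<lambda>(x, u). f x u) has_derivative
        (\<lambda>(h, k). blinfun_apply (fx x u) h + blinfun_apply (fu x u) k)) (at (x, u))) \<and>
     continuous_on UNIV (\<lambda>(x, u). fx x u) \<and> continuous_on UNIV (\<lambda>(x, u). fu x u)"

definition drift_assumptions ::
    "real \<Rightarrow> (real \<Rightarrow> real^'n \<Rightarrow> real^'d \<Rightarrow> real^'n) \<Rightarrow>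
     (real \<Rightarrow> real^'n \<Rightarrow> real^'d \<Rightarrow> (real^'n) \<Rightarrow>\<^sub>L (real^'n)) \<Rightarrow>
     (real \<Rightarrow> real^'n \<Rightarrow> real^'d \<Rightarrow> (real^'d) \<Rightarrow>\<^sub>L (real^'n)) \<Rightarrow> bool" where
  "drift_assumptions T b bx bu \<longleftrightarrow>
     continuous_on ({0..T} \<times> UNIV \<times> UNIV) (\<lambda>(t, x, u). b t x u) \<and>
     (\<forall>t\<in>{0..T}. C1_partials (b t) (bx t) (bu t)) \<and>
     (\<exists>L. \<forall>t\<in>{0..T}. \<forall>x u.
        norm (bx t x u) + norm (bu t x u) \<le> L \<and>
        (\<forall>y v. norm (bx t x u - bx t y v) + norm (bu t x u - bu t y v)
           \<le> L * (norm (x - y) + norm (u - v))))"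

text \<open>\<open>\<sigma>xu\<close> is the derivative of \<open>\<sigma>x\<close> in \<open>u\<close>; the fourth second-order partial derivative
  \<open>\<sigma>ux\<close> is \<open>\<sigma>xu\<close> with its arguments exchanged.\<close>

definition diffusion_assumptions ::
    "real \<Rightarrow> real \<Rightarrow> (real \<Rightarrow> real^'n \<Rightarrow> real^'d \<Rightarrow> real^'m^'n) \<Rightarrow>
     (real \<Rightarrow> real^'n \<Rightarrow> real^'d \<Rightarrow> (real^'n) \<Rightarrow>\<^sub>L (real^'m^'n)) \<Rightarrow>
     (real \<Rightarrow> real^'n \<Rightarrow> real^'d \<Rightarrow> (real^'d) \<Rightarrow>\<^sub>L (real^'m^'n)) \<Rightarrow>
     (real \<Rightarrow> real^'n \<Rightarrow> real^'d \<Rightarrow> (real^'n) \<Rightarrow>\<^sub>L ((real^'n) \<Rightarrow>\<^sub>L (real^'m^'n))) \<Rightarrow>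
     (real \<Rightarrow> real^'n \<Rightarrow> real^'d \<Rightarrow> (real^'d) \<Rightarrow>\<^sub>L ((real^'n) \<Rightarrow>\<^sub>L (real^'m^'n))) \<Rightarrow>
     (real \<Rightarrow> real^'n \<Rightarrow> real^'d \<Rightarrow> (real^'d) \<Rightarrow>\<^sub>L ((real^'d) \<Rightarrow>\<^sub>L (real^'m^'n))) \<Rightarrow> bool" where
  "diffusion_assumptions T H \<sigma> \<sigma>x \<sigma>u \<sigma>xx \<sigma>xu \<sigma>uu \<longleftrightarrow>
     continuous_on ({0..T} \<times> UNIV \<times> UNIV) (\<lambda>(t, x, u). \<sigma> t x u) \<and>
     (\<forall>t\<in>{0..T}. C1_partials (\<sigma> t) (\<sigma>x t) (\<sigma>u t) \<and>
        C1_partials (\<sigma>x t) (\<sigma>xx t) (\<sigma>xu t) \<and>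
        (\<exists>\<sigma>ux. C1_partials (\<sigma>u t) \<sigma>ux (\<sigma>uu t))) \<and>
     (\<exists>\<gamma> L. 1 - H < \<gamma> \<and> \<gamma> < 1 \<and>
        (\<forall>t\<in>{0..T}. \<forall>x u.
           norm (\<sigma>x t x u) + norm (\<sigma>u t x u) \<le> L \<and>
           norm (\<sigma>xx t x u) + norm (\<sigma>uu t x u) + norm (\<sigma>xu t x u) \<le> L) \<and>
        (\<forall>t\<in>{0..T}. \<forall>s\<in>{0..T}. \<forall>x u.
           norm (\<sigma> t x u - \<sigma> s x u) + norm (\<sigma>x t x u - \<sigma>x s x u) +
           norm (\<sigma>u t x u - \<sigma>u s x u) + norm (\<sigma>xx t x u - \<sigma>xx s x u) +
           norm (\<sigma>xu t x u - \<sigma>xu s x u) + norm (\<sigma>uu t x u - \<sigma>uu s x u)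
             \<le> L * \<bar>t - s\<bar> powr \<gamma>) \<and>
        (\<forall>t\<in>{0..T}. \<forall>x u y v.
           norm (\<sigma>uu t x u - \<sigma>uu t y v) + norm (\<sigma>xu t x u - \<sigma>xu t y v)
             \<le> L * (norm (x - y) + norm (u - v))))"

text \<open>\<open>x\<close> solves \<open>x(t) = x\<^sub>0 + \<integral>\<^sub>0\<^sup>t f(s) ds + \<Sum>\<^sub>j \<integral>\<^sub>0\<^sup>t g\<^sup>j(s) dB\<^sub>j(s)\<close> on \<open>[0,T]\<close> along the path
  \<open>B\<close>, where \<open>g\<^sup>j\<close> is the \<open>j\<close>-th column of \<open>g\<close>. Solutions are sought among paths that are Hoelder of
  some order above \<open>1 - H\<close>, where the integrals are Young integrals and uniqueness holds.\<close>

definition solves_path_equation ::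
    "real \<Rightarrow> real \<Rightarrow> (real \<Rightarrow> real^'m) \<Rightarrow> real^'n \<Rightarrow> (real \<Rightarrow> real^'n) \<Rightarrow>
     (real \<Rightarrow> real^'m^'n) \<Rightarrow> (real \<Rightarrow> real^'n) \<Rightarrow> bool" where
  "solves_path_equation H T B x0 f g x \<longleftrightarrow>
     (\<exists>\<beta>>1 - H. holder_on \<beta> T x) \<and>
     (\<forall>t\<in>{0..T}. f integrable_on {0..t} \<and>
        (\<forall>j. RS_integrable (\<lambda>s. column j (g s)) (\<lambda>s. B s $ j) 0 t) \<and>
        x t = x0 + integral {0..t} f +
          (\<Sum>j\<in>UNIV. RS_integral (\<lambda>s. column j (g s)) (\<lambda>s. B s $ j) 0 t))"

definition solves_controlled_equation ::
    "real \<Rightarrow> real \<Rightarrow> (real \<Rightarrow> real^'m) \<Rightarrow> (real \<Rightarrow> real^'n \<Rightarrow> real^'d \<Rightarrow> real^'n) \<Rightarrow>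
     (real \<Rightarrow> real^'n \<Rightarrow> real^'d \<Rightarrow> real^'m^'n) \<Rightarrow> real^'n \<Rightarrow> (real \<Rightarrow> real^'d) \<Rightarrow>
     (real \<Rightarrow> real^'n) \<Rightarrow> bool" where
  "solves_controlled_equation H T B b \<sigma> x0 u x \<longleftrightarrow>
     solves_path_equation H T B x0 (\<lambda>s. b s (x s) (u s)) (\<lambda>s. \<sigma> s (x s) (u s)) x"

end

theory Submission
  imports Defs
begin

text \<open>
  The statement is about one path at a time. Almost every path of \<open>B\<close> is Hoelder of every order
  below \<open>H\<close>, and the controls are Hoelder of some order above \<open>1 - H\<close>, so along such a path all
  stochastic integrals are Young integrals and obey Young's estimate (\<open>young_estimate\<close>).

  The pathwise argument rests on a single Gronwall lemma (\<open>young_gronwall\<close>): if \<open>z\<close> solves an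
  equation driven by the path, and the integrands grow at most linearly in \<open>z\<close>, with an
  inhomogeneity of size \<open>A\<close>, both in the supremum norm and in their \<open>\<alpha>\<close>-Hoelder increments, then
  the supremum and the \<open>\<alpha>\<close>-Hoelder norm of \<open>z\<close> are at most \<open>C (A + |z(0)|)\<close>, where \<open>C\<close> depends
  on the path, the exponents and the growth constant, but not on the equation. It is applied three
  times.

  \<^item> To the solutions \<open>x\<^sup>\<epsilon>\<close> themselves, with constant \<open>A\<close>. As the coefficients are globally
    Lipschitz, this bounds their Hoelder norms uniformly in \<open>\<bar>\<epsilon>\<bar> \<le> 1\<close>.
  \<^item> To the difference \<open>x\<^sup>\<epsilon> - x\<^sup>*\<close>, with \<open>A\<close> proportional to \<open>\<bar>\<epsilon>\<bar>\<close>. The Hoelder increments of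
    \<open>\<sigma>(t,x\<^sup>\<epsilon>,u\<^sup>\<epsilon>) - \<sigma>(t,x\<^sup>*,u\<^sup>*)\<close> are mixed second differences of \<open>\<sigma>\<close>, which a mean value
    argument controls through the Lipschitz constants of \<open>\<sigma>\<^sub>x\<close> and \<open>\<sigma>\<^sub>u\<close>. The result is that
    \<open>x\<^sup>\<epsilon> - x\<^sup>*\<close> is \<open>O(\<epsilon>)\<close> in Hoelder norm; this contains the first limit.
  \<^item> To \<open>z = (x\<^sup>\<epsilon> - x\<^sup>*)/\<epsilon> - y\<close>, where \<open>A\<close> is the size of the remainder in the first order expansion
    of the coefficients. By Taylor's formula the remainder is \<open>O(\<epsilon>)\<close> in the supremum norm, while
    its Hoelder norm of a slightly larger order \<open>\<alpha>'\<close> is merely bounded, by the previous step.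
    Interpolating between the two, its \<open>\<alpha>\<close>-Hoelder norm is \<open>O(\<bar>\<epsilon>\<bar>\<^sup>p)\<close> with \<open>p = 1 - \<alpha>/\<alpha>'\<close>, and so
    is \<open>z\<close>; this is the second limit.

  The Hoelder property of the paths of \<open>B\<close> is the Kolmogorov continuity argument applied to the
  even moments of the Gaussian increments. It is stated for a process that already has continuous
  paths, so that only increments over dyadic points have to be summed.
\<close>

section \<open>Young integration\<close>

lemma norm_diff_triangle_via:
  "norm (a - c) \<le> norm (a - b) + norm (b - (c :: 'a::real_normed_vector))"
  by (metis diff_add_cancel add_diff_eq norm_triangle_ineq)

text \<open>The sums in the definition of \<^const>\<open>has_RS_integral\<close>, named so that they can be
  split.\<close>

definition RS_sum :: "(real \<Rightarrow> 'a::real_normed_vector) \<Rightarrow> (real \<Rightarrow> real) \<Rightarrow> (real \<times> real set) set \<Rightarrow> 'a" where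
  "RS_sum f g p = (\<Sum>(\<tau>, K)\<in>p. (g (Sup K) - g (Inf K)) *\<^sub>R f \<tau>)"

lemma has_RS_integral_iff:
  "has_RS_integral f g I a b \<longleftrightarrow>
     (\<forall>e>0. \<exists>\<delta>>0. \<forall>p. p tagged_division_of {a..b} \<and> (\<lambda>x. ball x \<delta>) fine p \<longrightarrow>
        norm (RS_sum f g p - I) < e)"
  by (simp add: has_RS_integral_def RS_sum_def)

lemma ball_fine_mono:
  assumes "(\<lambda>x::real. ball x d) fine p" "d \<le> d'"
  shows "(\<lambda>x. ball x d') fine p"
proof -
  have "ball x d \<subseteq> ball x d'" for x :: real using assms(2) by (rule subset_ball)
  then show ?thesis using assms(1) unfolding fine_def by blast
qed

lemma tagged_division_append:
  fixes a m b :: real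
  assumes "p tagged_division_of {a..m}" "q tagged_division_of {m..b}" "a \<le> m" "m \<le> b"
  shows "(p \<union> q) tagged_division_of {a..b}"
proof -
  have "interior {a..m} \<inter> interior {m..b} = {}" by auto
  moreover have "{a..m} \<union> {m..b} = {a..b}" using assms by auto
  ultimately show ?thesis using tagged_division_Un[OF assms(1,2)] by simp
qed

text \<open>The two divisions may share intervals, but these consist of the common end point alone, so they
  contribute zero.\<close>

lemma RS_sum_append:
  assumes p: "p tagged_division_of {a..m}" and q: "q tagged_division_of {m..b}"
  shows "RS_sum f g (p \<union> q) = RS_sum f g p + RS_sum f g q"
proof -
  have "(case x of (\<tau>, K) \<Rightarrow> (g (Sup K) - g (Inf K)) *\<^sub>R f \<tau>) = 0" if "x \<in> p \<inter> q" for x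
  proof -
    obtain \<tau> K where x: "x = (\<tau>, K)" by fastforce
    have "(\<tau>, K) \<in> p" "(\<tau>, K) \<in> q" using that x by auto
    then have "K \<subseteq> {a..m}" "K \<subseteq> {m..b}" "\<tau> \<in> K"
      using tagged_division_ofD(2,3)[OF p, of \<tau> K] tagged_division_ofD(3)[OF q, of \<tau> K] by auto
    then have "K \<subseteq> {m}" "K \<noteq> {}" by (auto simp: subset_eq intro: antisym)
    then have "K = {m}" by blast
    then show ?thesis by (simp add: x)
  qed
  then show ?thesis
    unfolding RS_sum_def using p q
    by (intro sum.union_inter_neutral) (auto simp: tagged_division_of_finite)
qed

text \<open>A fine division of \<open>{b..c}\<close> is completed by a fine division of \<open>{a..b}\<close>
  to one of \<open>{a..c}\<close>. Existence of the integral over \<open>{b..c}\<close> thus follows from the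
  two given ones, without a Cauchy argument.\<close>

lemma has_RS_integral_subinterval:
  assumes I: "has_RS_integral f g I a c" and J: "has_RS_integral f g J a b"
    and le: "a \<le> b" "b \<le> c"
  shows "has_RS_integral f g (I - J) b c"
  unfolding has_RS_integral_iff
proof (intro allI impI)
  fix e :: real assume "e > 0"
  then have e: "e / 2 > 0" by simp
  obtain d1 where d1: "d1 > 0" "\<And>p. p tagged_division_of {a..c} \<Longrightarrow> (\<lambda>x. ball x d1) fine p \<Longrightarrow>
      norm (RS_sum f g p - I) < e / 2"
    using I e unfolding has_RS_integral_iff by meson
  obtain d2 where d2: "d2 > 0" "\<And>p. p tagged_division_of {a..b} \<Longrightarrow> (\<lambda>x. ball x d2) fine p \<Longrightarrow>
      norm (RS_sum f g p - J) < e / 2"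
    using J e unfolding has_RS_integral_iff by meson
  let ?d = "min d1 d2"
  have sub: "(\<lambda>x. ball x d1) fine p" "(\<lambda>x. ball x d2) fine p"
    if "(\<lambda>x. ball x ?d) fine p" for p :: "(real \<times> real set) set"
    by (rule ball_fine_mono[OF that]; simp)+
  have "gauge (\<lambda>x::real. ball x ?d)" using d1 d2 by auto
  then obtain p where p: "p tagged_division_of {a..b}" "(\<lambda>x. ball x ?d) fine p"
    using fine_division_exists_real by blast
  show "\<exists>\<delta>>0. \<forall>q. q tagged_division_of {b..c} \<and> (\<lambda>x. ball x \<delta>) fine q \<longrightarrow>
      norm (RS_sum f g q - (I - J)) < e"
  proof (intro exI[of _ ?d] conjI allI impI; (elim conjE)?)
    show "?d > 0" using d1 d2 by simp
    fix q assume q: "q tagged_division_of {b..c}" "(\<lambda>x. ball x ?d) fine q"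
    have "norm (RS_sum f g (p \<union> q) - I) < e / 2"
      by (intro d1(2) tagged_division_append[OF p(1) q(1) le] sub(1) fine_Un p q)
    moreover have "norm (RS_sum f g p - J) < e / 2"
      by (intro d2(2) sub(2) p)
    moreover have "RS_sum f g q - (I - J) = (RS_sum f g (p \<union> q) - I) - (RS_sum f g p - J)"
      by (simp add: RS_sum_append[OF p(1) q(1)])
    then have "norm (RS_sum f g q - (I - J)) \<le>
        norm (RS_sum f g (p \<union> q) - I) + norm (RS_sum f g p - J)"
      by (metis norm_triangle_ineq4)
    ultimately show "norm (RS_sum f g q - (I - J)) < e"
      by linarith
  qed
qed

lemma has_RS_integral_diff:
  assumes "has_RS_integral f1 g I1 a b" "has_RS_integral f2 g I2 a b"
  shows "has_RS_integral (\<lambda>x. f1 x - f2 x) g (I1 - I2) a b"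
  unfolding has_RS_integral_iff
proof (intro allI impI)
  fix e :: real assume "e > 0"
  then have e: "e / 2 > 0" by simp
  obtain d1 where d1: "d1 > 0" "\<And>p. p tagged_division_of {a..b} \<Longrightarrow> (\<lambda>x. ball x d1) fine p \<Longrightarrow>
      norm (RS_sum f1 g p - I1) < e / 2"
    using assms(1) e unfolding has_RS_integral_iff by meson
  obtain d2 where d2: "d2 > 0" "\<And>p. p tagged_division_of {a..b} \<Longrightarrow> (\<lambda>x. ball x d2) fine p \<Longrightarrow>
      norm (RS_sum f2 g p - I2) < e / 2"
    using assms(2) e unfolding has_RS_integral_iff by meson
  let ?d = "min d1 d2"
  have sub: "(\<lambda>x. ball x d1) fine p" "(\<lambda>x. ball x d2) fine p"
    if "(\<lambda>x. ball x ?d) fine p" for p :: "(real \<times> real set) set"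
    by (rule ball_fine_mono[OF that]; simp)+
  show "\<exists>\<delta>>0. \<forall>q. q tagged_division_of {a..b} \<and> (\<lambda>x. ball x \<delta>) fine q \<longrightarrow>
      norm (RS_sum (\<lambda>x. f1 x - f2 x) g q - (I1 - I2)) < e"
  proof (intro exI[of _ ?d] conjI allI impI; (elim conjE)?)
    show "?d > 0" using d1 d2 by simp
    fix q assume q: "q tagged_division_of {a..b}" "(\<lambda>x. ball x ?d) fine q"
    have "RS_sum (\<lambda>x. f1 x - f2 x) g q = RS_sum f1 g q - RS_sum f2 g q"
      unfolding RS_sum_def by (simp add: case_prod_beta scaleR_diff_right sum_subtractf)
    then have "RS_sum (\<lambda>x. f1 x - f2 x) g q - (I1 - I2) = (RS_sum f1 g q - I1) - (RS_sum f2 g q - I2)"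
      by simp
    then have "norm (RS_sum (\<lambda>x. f1 x - f2 x) g q - (I1 - I2)) \<le>
        norm (RS_sum f1 g q - I1) + norm (RS_sum f2 g q - I2)"
      by (metis norm_triangle_ineq4)
    moreover have "norm (RS_sum f1 g q - I1) < e / 2" "norm (RS_sum f2 g q - I2) < e / 2"
      by (intro d1(2) d2(2) sub q)+
    ultimately show "norm (RS_sum (\<lambda>x. f1 x - f2 x) g q - (I1 - I2)) < e"
      by linarith
  qed
qed

lemma has_RS_integral_scaleR:
  assumes "has_RS_integral f g I a b"
  shows "has_RS_integral (\<lambda>x. c *\<^sub>R f x) g (c *\<^sub>R I) a b"
  unfolding has_RS_integral_iff
proof (intro allI impI)
  fix e :: real assume "e > 0"
  then have "e / (\<bar>c\<bar> + 1) > 0" by simp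
  then obtain d where d: "d > 0" "\<And>p. p tagged_division_of {a..b} \<Longrightarrow> (\<lambda>x. ball x d) fine p \<Longrightarrow>
      norm (RS_sum f g p - I) < e / (\<bar>c\<bar> + 1)"
    using assms unfolding has_RS_integral_iff by meson
  show "\<exists>\<delta>>0. \<forall>q. q tagged_division_of {a..b} \<and> (\<lambda>x. ball x \<delta>) fine q \<longrightarrow>
      norm (RS_sum (\<lambda>x. c *\<^sub>R f x) g q - c *\<^sub>R I) < e"
  proof (intro exI[of _ d] conjI allI impI d(1); elim conjE)
    fix q assume q: "q tagged_division_of {a..b}" "(\<lambda>x. ball x d) fine q"
    have eq: "RS_sum (\<lambda>x. c *\<^sub>R f x) g q = c *\<^sub>R RS_sum f g q"
      unfolding RS_sum_def by (simp add: case_prod_beta scaleR_sum_right mult.commute)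
    have "norm (RS_sum (\<lambda>x. c *\<^sub>R f x) g q - c *\<^sub>R I) = \<bar>c\<bar> * norm (RS_sum f g q - I)"
      unfolding eq by (simp flip: scaleR_diff_right)
    also have "\<dots> \<le> (\<bar>c\<bar> + 1) * norm (RS_sum f g q - I)"
      by (intro mult_right_mono) auto
    also have "\<dots> < e"
      using d(2)[OF q] by (simp add: field_simps add_nonneg_pos)
    finally show "norm (RS_sum (\<lambda>x. c *\<^sub>R f x) g q - c *\<^sub>R I) < e" .
  qed
qed

text \<open>The left point sum over the partition of \<open>{a..b}\<close> into \<open>2 ^ n\<close> equal
  intervals. Its recursion halves the interval at the top, so that Young's estimate can be proved by induction
  over all intervals at once.\<close>

fun bisection_sum :: "(real \<Rightarrow> 'a::real_normed_vector) \<Rightarrow> (real \<Rightarrow> real) \<Rightarrow> nat \<Rightarrow> real \<Rightarrow> real \<Rightarrow> 'a" where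
  "bisection_sum f g 0 a b = (g b - g a) *\<^sub>R f a"
| "bisection_sum f g (Suc n) a b =
     bisection_sum f g n a ((a + b) / 2) + bisection_sum f g n ((a + b) / 2) b"

lemma bisection_sum_is_RS_sum:
  assumes "a \<le> b" "b - a < \<delta> * 2 ^ n"
  shows "\<exists>p. p tagged_division_of {a..b} \<and> (\<lambda>x. ball x \<delta>) fine p \<and>
    RS_sum f g p = bisection_sum f g n a b"
  using assms
proof (induction n arbitrary: a b)
  case 0
  then have "{(a, {a..b})} tagged_division_of {a..b}"
    by (intro tagged_division_of_self_real) auto
  moreover have "(\<lambda>x. ball x \<delta>) fine {(a, {a..b})}"
    using 0 by (auto simp: fine_def dist_real_def)
  moreover have "RS_sum f g {(a, {a..b})} = bisection_sum f g 0 a b"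
    using 0 by (simp add: RS_sum_def)
  ultimately show ?case by blast
next
  case (Suc n)
  let ?m = "(a + b) / 2"
  have m: "a \<le> ?m" "?m \<le> b" "?m - a < \<delta> * 2 ^ n" "b - ?m < \<delta> * 2 ^ n"
    using Suc.prems by (auto simp: field_simps)
  obtain p where p: "p tagged_division_of {a..?m}" "(\<lambda>x. ball x \<delta>) fine p"
    "RS_sum f g p = bisection_sum f g n a ?m"
    using Suc.IH[OF m(1,3)] by blast
  obtain q where q: "q tagged_division_of {?m..b}" "(\<lambda>x. ball x \<delta>) fine q"
    "RS_sum f g q = bisection_sum f g n ?m b"
    using Suc.IH[OF m(2,4)] by blast
  show ?case
    using tagged_division_append[OF p(1) q(1) m(1,2)] fine_Un[OF p(2) q(2)]
    by (intro exI[of _ "p \<union> q"]) (simp add: RS_sum_append[OF p(1) q(1)] p(3) q(3))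
qed

text \<open>The constant \<open>K\<close> is the solution of \<open>(2 K + 1) / 2 powr \<theta> = K\<close>,
  the fixed point equation that appears when an interval is halved.\<close>

lemma young_constant_step:
  fixes \<theta> :: real
  assumes "\<theta> > 1"
  defines "K \<equiv> 1 / (2 powr \<theta> - 2)"
  shows "K > 0" and "(2 * K + 1) * (h / 2) powr \<theta> = K * h powr \<theta>"
proof -
  have "2 powr \<theta> > (2::real) powr 1" using assms by (intro powr_less_mono) auto
  then have *: "2 powr \<theta> - 2 > (0::real)" by simp
  then show "K > 0" by (simp add: K_def)
  have "2 * K + 1 = K * 2 powr \<theta>" using * by (simp add: K_def field_simps)
  then show "(2 * K + 1) * (h / 2) powr \<theta> = K * h powr \<theta>"
    by (simp add: powr_divide)
qed

text \<open>Refining once splits the error into the errors of both halves and the term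
  \<open>(g b - g m) (f m - f a)\<close>. With \<open>\<theta> = \<alpha> + \<beta>\<close> and length
  \<open>h\<close> the bound becomes \<open>(2 K + 1) F \<Gamma> (h/2)\<^sup>\<theta>\<close>, which is again
  \<open>K F \<Gamma> h\<^sup>\<theta>\<close>.\<close>

lemma bisection_sum_bound:
  fixes f :: "real \<Rightarrow> 'a::real_normed_vector"
  assumes "a \<le> b" and \<theta>: "\<alpha> + \<beta> > 1" and nn: "F \<ge> 0" "\<Gamma> \<ge> 0"
    and f: "\<And>s t. a \<le> s \<Longrightarrow> s \<le> t \<Longrightarrow> t \<le> b \<Longrightarrow> norm (f t - f s) \<le> F * (t - s) powr \<alpha>"
    and g: "\<And>s t. a \<le> s \<Longrightarrow> s \<le> t \<Longrightarrow> t \<le> b \<Longrightarrow> \<bar>g t - g s\<bar> \<le> \<Gamma> * (t - s) powr \<beta>"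
  shows "norm (bisection_sum f g n a b - (g b - g a) *\<^sub>R f a)
    \<le> F * \<Gamma> * (1 / (2 powr (\<alpha> + \<beta>) - 2)) * (b - a) powr (\<alpha> + \<beta>)"
  using assms(1) f g
proof (induction n arbitrary: a b)
  case 0
  have "0 \<le> F * \<Gamma> * (1 / (2 powr (\<alpha> + \<beta>) - 2)) * (b - a) powr (\<alpha> + \<beta>)"
    by (intro mult_nonneg_nonneg nn powr_ge_zero less_imp_le[OF young_constant_step(1)[OF \<theta>]])
  then show ?case by simp
next
  case (Suc n)
  let ?K = "1 / (2 powr (\<alpha> + \<beta>) - 2)"
  define m where "m = (a + b) / 2"
  define h where "h = b - a"
  have m: "a \<le> m" "m \<le> b" "m - a = h / 2" "b - m = h / 2"
    using Suc.prems(1) by (auto simp: m_def h_def field_simps)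
  have 1: "norm (bisection_sum f g n a m - (g m - g a) *\<^sub>R f a) \<le> F * \<Gamma> * ?K * (h / 2) powr (\<alpha> + \<beta>)"
    unfolding m(3)[symmetric] using m(1,2) Suc.prems(2,3) by (intro Suc.IH) auto
  have 2: "norm (bisection_sum f g n m b - (g b - g m) *\<^sub>R f m) \<le> F * \<Gamma> * ?K * (h / 2) powr (\<alpha> + \<beta>)"
    unfolding m(4)[symmetric] using m(1,2) Suc.prems(2,3) by (intro Suc.IH) auto
  have "norm (f m - f a) \<le> F * (h / 2) powr \<alpha>"
    unfolding m(3)[symmetric] using m(1,2) by (intro Suc.prems(2)) auto
  moreover have "\<bar>g b - g m\<bar> \<le> \<Gamma> * (h / 2) powr \<beta>"
    unfolding m(4)[symmetric] using m(1,2) by (intro Suc.prems(3)) auto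
  ultimately have "\<bar>g b - g m\<bar> * norm (f m - f a) \<le> (\<Gamma> * (h / 2) powr \<beta>) * (F * (h / 2) powr \<alpha>)"
    using nn by (intro mult_mono mult_nonneg_nonneg) auto
  also have "\<dots> = F * \<Gamma> * (h / 2) powr (\<alpha> + \<beta>)"
    by (simp add: powr_add mult_ac)
  finally have 3: "norm ((g b - g m) *\<^sub>R (f m - f a)) \<le> F * \<Gamma> * (h / 2) powr (\<alpha> + \<beta>)"
    by simp
  have "bisection_sum f g (Suc n) a b - (g b - g a) *\<^sub>R f a =
      (bisection_sum f g n a m - (g m - g a) *\<^sub>R f a) +
      (bisection_sum f g n m b - (g b - g m) *\<^sub>R f m) + (g b - g m) *\<^sub>R (f m - f a)"
    by (simp add: m_def algebra_simps)
  then have "norm (bisection_sum f g (Suc n) a b - (g b - g a) *\<^sub>R f a)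
      \<le> norm (bisection_sum f g n a m - (g m - g a) *\<^sub>R f a) +
        norm (bisection_sum f g n m b - (g b - g m) *\<^sub>R f m) + norm ((g b - g m) *\<^sub>R (f m - f a))"
    by (metis norm_triangle_mono norm_triangle_ineq order_refl)
  also have "\<dots> \<le> F * \<Gamma> * ?K * (h / 2) powr (\<alpha> + \<beta>) + F * \<Gamma> * ?K * (h / 2) powr (\<alpha> + \<beta>) +
      F * \<Gamma> * (h / 2) powr (\<alpha> + \<beta>)"
    by (intro add_mono 1 2 3)
  also have "\<dots> = F * \<Gamma> * ((2 * ?K + 1) * (h / 2) powr (\<alpha> + \<beta>))"
    by (simp only: distrib_left distrib_right mult_1 mult_2 mult.assoc)
  also have "\<dots> = F * \<Gamma> * ?K * h powr (\<alpha> + \<beta>)"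
    unfolding young_constant_step(2)[OF \<theta>, of h] by (simp only: mult.assoc)
  finally show ?case unfolding h_def .
qed

text \<open>The integral is assumed to exist, so it is the limit of the bisection sums, which satisfy Young's
  bound with a constant independent of \<open>n\<close>.\<close>

lemma young_estimate:
  fixes f :: "real \<Rightarrow> 'a::real_normed_vector"
  assumes I: "has_RS_integral f g I a b"
    and "a \<le> b" and \<theta>: "\<alpha> + \<beta> > 1" and nn: "F \<ge> 0" "\<Gamma> \<ge> 0"
    and f: "\<And>s t. a \<le> s \<Longrightarrow> s \<le> t \<Longrightarrow> t \<le> b \<Longrightarrow> norm (f t - f s) \<le> F * (t - s) powr \<alpha>"
    and g: "\<And>s t. a \<le> s \<Longrightarrow> s \<le> t \<Longrightarrow> t \<le> b \<Longrightarrow> \<bar>g t - g s\<bar> \<le> \<Gamma> * (t - s) powr \<beta>"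
  shows "norm (I - (g b - g a) *\<^sub>R f a)
    \<le> F * \<Gamma> * (1 / (2 powr (\<alpha> + \<beta>) - 2)) * (b - a) powr (\<alpha> + \<beta>)"
proof (rule field_le_epsilon)
  fix e :: real assume "e > 0"
  then obtain d where d: "d > 0" "\<And>p. p tagged_division_of {a..b} \<Longrightarrow> (\<lambda>x. ball x d) fine p \<Longrightarrow>
      norm (RS_sum f g p - I) < e"
    using I unfolding has_RS_integral_iff by meson
  obtain n where "(b - a) / d < 2 ^ n"
    using real_arch_pow[of 2 "(b - a) / d"] by auto
  then have "b - a < d * 2 ^ n" using d(1) by (simp add: field_simps)
  then obtain p where p: "p tagged_division_of {a..b}" "(\<lambda>x. ball x d) fine p"
    "RS_sum f g p = bisection_sum f g n a b"
    using bisection_sum_is_RS_sum[OF \<open>a \<le> b\<close>] by blast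
  have "norm (I - (g b - g a) *\<^sub>R f a) \<le>
      norm (bisection_sum f g n a b - (g b - g a) *\<^sub>R f a) + norm (bisection_sum f g n a b - I)"
    using norm_diff_triangle_via[of I "(g b - g a) *\<^sub>R f a" "bisection_sum f g n a b"]
    by (simp add: norm_minus_commute)
  moreover have "norm (bisection_sum f g n a b - I) < e"
    using d(2)[OF p(1,2)] p(3) by simp
  moreover note bisection_sum_bound[OF assms(2-5) f g, where n = n]
  ultimately show "norm (I - (g b - g a) *\<^sub>R f a)
      \<le> F * \<Gamma> * (1 / (2 powr (\<alpha> + \<beta>) - 2)) * (b - a) powr (\<alpha> + \<beta>) + e"
    by linarith
qed

lemma has_RS_integral_degenerate:
  assumes "has_RS_integral f g I a a"
  shows "I = 0"
proof -
  have "norm (I - (g a - g a) *\<^sub>R f a) \<le> 0 * 0 * (1 / (2 powr (1 + 1) - 2)) * (a - a) powr (1 + 1)"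
  proof (rule young_estimate[OF assms])
    show "norm (f t - f s) \<le> 0 * (t - s) powr 1" "\<bar>g t - g s\<bar> \<le> 0 * (t - s) powr 1"
      if "a \<le> s" "s \<le> t" "t \<le> a" for s t
    proof -
      have "s = t" using that by linarith
      then show "norm (f t - f s) \<le> 0 * (t - s) powr 1" "\<bar>g t - g s\<bar> \<le> 0 * (t - s) powr 1"
        by simp_all
    qed
  qed simp_all
  then show ?thesis by simp
qed

section \<open>Hoelder paths\<close>

text \<open>Unlike \<^const>\<open>holder_on\<close>, this keeps the constant, so that bounds uniform over
  families of paths can be stated.\<close>

definition holder_bound :: "real \<Rightarrow> real \<Rightarrow> real \<Rightarrow> (real \<Rightarrow> 'a::real_normed_vector) \<Rightarrow> bool" where
  "holder_bound T \<alpha> C x \<longleftrightarrow> (\<forall>s\<in>{0..T}. \<forall>t\<in>{0..T}. norm (x t - x s) \<le> C * \<bar>t - s\<bar> powr \<alpha>)"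

lemma holder_on_iff_bound: "holder_on \<alpha> T x \<longleftrightarrow> (\<exists>C\<ge>0. holder_bound T \<alpha> C x)"
proof
  assume "holder_on \<alpha> T x"
  then obtain C where C: "\<forall>s\<in>{0..T}. \<forall>t\<in>{0..T}. norm (x t - x s) \<le> C * \<bar>t - s\<bar> powr \<alpha>"
    unfolding holder_on_def by blast
  have "C * \<bar>t - s\<bar> powr \<alpha> \<le> \<bar>C\<bar> * \<bar>t - s\<bar> powr \<alpha>" for s t
    by (intro mult_right_mono) auto
  then have "holder_bound T \<alpha> \<bar>C\<bar> x"
    using C unfolding holder_bound_def by (meson order_trans)
  then show "\<exists>C\<ge>0. holder_bound T \<alpha> C x" by (meson abs_ge_zero)
qed (auto simp: holder_on_def holder_bound_def)

lemma holder_boundD: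
  assumes "holder_bound T \<alpha> C x" "0 \<le> s" "s \<le> t" "t \<le> T"
  shows "norm (x t - x s) \<le> C * (t - s) powr \<alpha>"
  using bspec[OF bspec[OF assms(1)[unfolded holder_bound_def], of s], of t] assms(2-4) by auto

lemma holder_boundI:
  assumes "\<And>s t. 0 \<le> s \<Longrightarrow> s \<le> t \<Longrightarrow> t \<le> T \<Longrightarrow> norm (x t - x s) \<le> C * (t - s) powr \<alpha>"
  shows "holder_bound T \<alpha> C x"
  unfolding holder_bound_def
proof (intro ballI)
  fix s t assume "s \<in> {0..T}" "t \<in> {0..T}"
  then show "norm (x t - x s) \<le> C * \<bar>t - s\<bar> powr \<alpha>"
    using assms[of s t] assms[of t s] by (cases "s \<le> t") (auto simp: norm_minus_commute)
qed

lemma powr_le_on_interval: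
  fixes a b e T :: real
  assumes "0 \<le> e" "e \<le> T" "a \<le> b"
  shows "e powr b \<le> T powr (b - a) * e powr a"
proof -
  have "e powr b = e powr (b - a) * e powr a" by (simp flip: powr_add)
  also have "\<dots> \<le> T powr (b - a) * e powr a"
    using assms by (intro mult_right_mono powr_mono2) auto
  finally show ?thesis .
qed

lemma holder_bound_mono:
  assumes "holder_bound T b C x" "a \<le> b" "C \<ge> 0"
  shows "holder_bound T a (C * T powr (b - a)) x"
proof (rule holder_boundI)
  fix s t assume st: "0 \<le> s" "s \<le> t" "t \<le> T"
  have "norm (x t - x s) \<le> C * (t - s) powr b" by (rule holder_boundD[OF assms(1) st])
  also have "\<dots> \<le> C * (T powr (b - a) * (t - s) powr a)"
    using assms st by (intro mult_left_mono powr_le_on_interval) auto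
  finally show "norm (x t - x s) \<le> C * T powr (b - a) * (t - s) powr a" by (simp add: mult_ac)
qed

lemma holder_on_mono: "holder_on b T x \<Longrightarrow> a \<le> b \<Longrightarrow> holder_on a T x"
  unfolding holder_on_iff_bound by (meson holder_bound_mono mult_nonneg_nonneg powr_ge_zero)

lemma holder_bound_sup:
  assumes "holder_bound T a C x" "C \<ge> 0" "a \<ge> 0" "0 \<le> t" "t \<le> T"
  shows "norm (x t) \<le> norm (x 0) + C * T powr a"
proof -
  have "norm (x t - x 0) \<le> C * (t - 0) powr a" by (rule holder_boundD[OF assms(1)]) (use assms in auto)
  also have "\<dots> \<le> C * T powr a" using assms by (intro mult_left_mono powr_mono2) auto
  finally show ?thesis using norm_triangle_sub[of "x t" "x 0"] by linarith
qed

lemma holder_on_uniform: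
  fixes w :: "'j::finite \<Rightarrow> real \<Rightarrow> 'a::real_normed_vector"
  assumes "\<And>j. holder_on \<beta> T (w j)"
  shows "\<exists>\<Gamma>\<ge>0. \<forall>j. holder_bound T \<beta> \<Gamma> (w j)"
proof -
  obtain C where C: "\<And>j. C j \<ge> 0" "\<And>j. holder_bound T \<beta> (C j) (w j)"
    using assms unfolding holder_on_iff_bound by metis
  have "holder_bound T \<beta> (\<Sum>j\<in>UNIV. C j) (w j)" for j
  proof (rule holder_boundI)
    fix s t assume st: "0 \<le> s" "s \<le> t" "t \<le> T"
    have "C j \<le> (\<Sum>j\<in>UNIV. C j)" using C(1) by (intro member_le_sum) auto
    then have "C j * (t - s) powr \<beta> \<le> (\<Sum>j\<in>UNIV. C j) * (t - s) powr \<beta>" by (intro mult_right_mono) auto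
    then show "norm (w j t - w j s) \<le> (\<Sum>j\<in>UNIV. C j) * (t - s) powr \<beta>"
      using holder_boundD[OF C(2) st, of j] by linarith
  qed
  then show ?thesis using C(1) by (meson sum_nonneg)
qed

text \<open>An increment is at most \<open>2 S\<close> and at most \<open>N \<bar>t - s\<bar>\<^sup>b\<close>,
  hence at most the geometric mean of the two with weights \<open>1 - a/b\<close> and
  \<open>a/b\<close>.\<close>

lemma holder_interpolation:
  assumes x: "holder_bound T b N x" and S: "\<And>t. 0 \<le> t \<Longrightarrow> t \<le> T \<Longrightarrow> norm (x t) \<le> S"
    and ab: "0 < a" "a < b" and "N \<ge> 0"
  shows "holder_bound T a ((2 * S) powr (1 - a / b) * N powr (a / b)) x"
proof (rule holder_boundI)
  fix s t assume st: "0 \<le> s" "s \<le> t" "t \<le> T"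
  define d where "d = norm (x t - x s)"
  have d: "0 \<le> d" "d \<le> 2 * S" "d \<le> N * (t - s) powr b"
    using norm_triangle_ineq4[of "x t" "x s"] S[of s] S[of t] st holder_boundD[OF x st] by (auto simp: d_def)
  have r: "0 < a / b" "0 < 1 - a / b" using ab by (auto simp: field_simps)
  have "d = d powr (1 - a / b) * d powr (a / b)" using d(1) by (simp flip: powr_add)
  also have "\<dots> \<le> (2 * S) powr (1 - a / b) * (N * (t - s) powr b) powr (a / b)"
    using d r by (intro mult_mono powr_mono2) auto
  also have "(N * (t - s) powr b) powr (a / b) = N powr (a / b) * (t - s) powr a"
    using \<open>N \<ge> 0\<close> ab by (simp add: powr_mult powr_powr)
  finally show "norm (x t - x s) \<le> (2 * S) powr (1 - a / b) * N powr (a / b) * (t - s) powr a"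
    by (simp add: d_def mult_ac)
qed

lemma holder_bound_diff:
  assumes "holder_bound T a C x" "holder_bound T a D y"
  shows "holder_bound T a (C + D) (\<lambda>t. x t - y t)"
proof (rule holder_boundI)
  fix s t assume st: "0 \<le> s" "s \<le> t" "t \<le> T"
  have "(x t - y t) - (x s - y s) = (x t - x s) - (y t - y s)" by simp
  then have "norm ((x t - y t) - (x s - y s)) \<le> norm (x t - x s) + norm (y t - y s)"
    by (simp only: norm_triangle_ineq4)
  then show "norm ((x t - y t) - (x s - y s)) \<le> (C + D) * (t - s) powr a"
    using holder_boundD[OF assms(1) st] holder_boundD[OF assms(2) st] by (simp add: distrib_right)
qed

lemma holder_on_diff:
  assumes "holder_on a T x" "holder_on a T y"
  shows "holder_on a T (\<lambda>t. x t - y t)"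
proof -
  obtain C D where "0 \<le> C" "holder_bound T a C x" "0 \<le> D" "holder_bound T a D y"
    using assms unfolding holder_on_iff_bound by blast
  then have "holder_bound T a (C + D) (\<lambda>t. x t - y t)" by (intro holder_bound_diff)
  then show ?thesis unfolding holder_on_def holder_bound_def by blast
qed

lemma holder_bound_scaleR:
  assumes "holder_bound T a C x"
  shows "holder_bound T a (\<bar>c\<bar> * C) (\<lambda>t. c *\<^sub>R x t)"
proof (rule holder_boundI)
  fix s t assume st: "0 \<le> s" "s \<le> t" "t \<le> T"
  have "norm (c *\<^sub>R x t - c *\<^sub>R x s) = \<bar>c\<bar> * norm (x t - x s)" by (simp flip: scaleR_diff_right)
  also have "\<dots> \<le> \<bar>c\<bar> * (C * (t - s) powr a)" by (intro mult_left_mono holder_boundD[OF assms st]) simp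
  finally show "norm (c *\<^sub>R x t - c *\<^sub>R x s) \<le> \<bar>c\<bar> * C * (t - s) powr a" by (simp add: mult.assoc)
qed

lemma holder_bound_weaken:
  assumes "holder_bound T a C x" "C \<le> D"
  shows "holder_bound T a D x"
proof (rule holder_boundI)
  fix s t assume "0 \<le> s" "s \<le> t" "t \<le> T"
  then show "norm (x t - x s) \<le> D * (t - s) powr a"
    using holder_boundD[OF assms(1)] mult_right_mono[OF assms(2), of "(t - s) powr a"]
    by (meson order_trans powr_ge_zero)
qed

section \<open>Equations driven by Hoelder paths\<close>

text \<open>The integral equation
  \<open>z(t) = z\<^sub>0 + \<integral>\<^sub>0\<^sup>t f ds + \<Sum>\<^sub>j \<integral>\<^sub>0\<^sup>t g\<^sub>j dw\<^sub>j\<close>.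
  The values of the integrals are quantified existentially instead of being chosen, so that equations can be
  subtracted and scaled without uniqueness of the integral.\<close>

definition young_equation ::
    "real \<Rightarrow> ('j::finite \<Rightarrow> real \<Rightarrow> real) \<Rightarrow> 'a::euclidean_space \<Rightarrow> (real \<Rightarrow> 'a) \<Rightarrow>
     ('j \<Rightarrow> real \<Rightarrow> 'a) \<Rightarrow> (real \<Rightarrow> 'a) \<Rightarrow> bool" where
  "young_equation T w z0 f g z \<longleftrightarrow>
     (\<forall>t\<in>{0..T}. \<exists>J I. (f has_integral J) {0..t} \<and> (\<forall>j. has_RS_integral (g j) (w j) (I j) 0 t) \<and>
        z t = z0 + J + (\<Sum>j\<in>UNIV. I j))"

lemma young_equation_diff:
  assumes "young_equation T w a f1 g1 x" "young_equation T w b f2 g2 y"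
  shows "young_equation T w (a - b) (\<lambda>t. f1 t - f2 t) (\<lambda>j t. g1 j t - g2 j t) (\<lambda>t. x t - y t)"
  unfolding young_equation_def
proof
  fix t assume t: "t \<in> {0..T}"
  obtain J1 I1 where 1: "(f1 has_integral J1) {0..t}" "\<And>j. has_RS_integral (g1 j) (w j) (I1 j) 0 t"
    "x t = a + J1 + (\<Sum>j\<in>UNIV. I1 j)"
    using assms(1) t unfolding young_equation_def by metis
  obtain J2 I2 where 2: "(f2 has_integral J2) {0..t}" "\<And>j. has_RS_integral (g2 j) (w j) (I2 j) 0 t"
    "y t = b + J2 + (\<Sum>j\<in>UNIV. I2 j)"
    using assms(2) t unfolding young_equation_def by metis
  show "\<exists>J I. ((\<lambda>t. f1 t - f2 t) has_integral J) {0..t} \<and>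
      (\<forall>j. has_RS_integral (\<lambda>t. g1 j t - g2 j t) (w j) (I j) 0 t) \<and>
      x t - y t = a - b + J + (\<Sum>j\<in>UNIV. I j)"
    using 1 2
    by (intro exI[of _ "J1 - J2"] exI[of _ "\<lambda>j. I1 j - I2 j"])
      (auto intro: has_integral_diff has_RS_integral_diff simp: sum_subtractf)
qed

lemma young_equation_scaleR:
  assumes "young_equation T w a f g x"
  shows "young_equation T w (c *\<^sub>R a) (\<lambda>t. c *\<^sub>R f t) (\<lambda>j t. c *\<^sub>R g j t) (\<lambda>t. c *\<^sub>R x t)"
  unfolding young_equation_def
proof
  fix t assume t: "t \<in> {0..T}"
  obtain J I where 1: "(f has_integral J) {0..t}" "\<And>j. has_RS_integral (g j) (w j) (I j) 0 t"
    "x t = a + J + (\<Sum>j\<in>UNIV. I j)"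
    using assms(1) t unfolding young_equation_def by metis
  show "\<exists>J I. ((\<lambda>t. c *\<^sub>R f t) has_integral J) {0..t} \<and>
      (\<forall>j. has_RS_integral (\<lambda>t. c *\<^sub>R g j t) (w j) (I j) 0 t) \<and>
      c *\<^sub>R x t = c *\<^sub>R a + J + (\<Sum>j\<in>UNIV. I j)"
    using 1
    by (intro exI[of _ "c *\<^sub>R J"] exI[of _ "\<lambda>j. c *\<^sub>R I j"])
      (auto intro: has_integral_cmul has_RS_integral_scaleR simp: scaleR_sum_right algebra_simps)
qed

lemma young_equation_initial:
  assumes "young_equation T w z0 f g z" "0 \<le> T"
  shows "z 0 = z0"
proof -
  obtain J I where 1: "(f has_integral J) {0..0}" "\<And>j. has_RS_integral (g j) (w j) (I j) 0 0"
    "z 0 = z0 + J + (\<Sum>j\<in>UNIV. I j)"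
    using assms unfolding young_equation_def by (metis atLeastAtMost_iff order_refl)
  have "(f has_integral J) {0}" using 1(1) by simp
  then have "J = 0" by (rule has_integral_unique[OF _ has_integral_refl(2)])
  moreover have "I j = 0" for j
    by (rule has_RS_integral_degenerate[OF 1(2)])
  ultimately show ?thesis using 1(3) by simp
qed

text \<open>The \<open>j\<close>-th integral over \<open>{s..t}\<close> is compared with
  \<open>g\<^sub>j(s) (w\<^sub>j(t) - w\<^sub>j(s))\<close>, which gives the term in \<open>P\<close>. The
  error is Young's and gives the term in \<open>F\<close>.\<close>

lemma young_equation_increment:
  fixes z :: "real \<Rightarrow> 'a::euclidean_space" and w :: "'j::finite \<Rightarrow> real \<Rightarrow> real" and \<Gamma> :: real
  assumes eq: "young_equation T w z0 f g z"
    and st: "0 \<le> s" "s \<le> t" "t \<le> T" and \<theta>: "\<alpha> + \<beta> > 1" and nn: "F \<ge> 0" "\<Gamma> \<ge> 0" "P \<ge> 0"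
    and fP: "\<And>r. s \<le> r \<Longrightarrow> r \<le> t \<Longrightarrow> norm (f r) \<le> P"
    and gP: "\<And>j. norm (g j s) \<le> P"
    and gF: "\<And>j p q. s \<le> p \<Longrightarrow> p \<le> q \<Longrightarrow> q \<le> t \<Longrightarrow> norm (g j q - g j p) \<le> F * (q - p) powr \<alpha>"
    and w: "\<And>j p q. s \<le> p \<Longrightarrow> p \<le> q \<Longrightarrow> q \<le> t \<Longrightarrow> \<bar>w j q - w j p\<bar> \<le> \<Gamma> * (q - p) powr \<beta>"
  shows "norm (z t - z s) \<le> P * (t - s) + CARD('j) * (\<Gamma> * P * (t - s) powr \<beta> +
    F * \<Gamma> * (1 / (2 powr (\<alpha> + \<beta>) - 2)) * (t - s) powr (\<alpha> + \<beta>))"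
proof -
  have "t \<in> {0..T}" "s \<in> {0..T}" using st by auto
  then obtain Jt It Js Is where
    t: "(f has_integral Jt) {0..t}" "\<And>j. has_RS_integral (g j) (w j) (It j) 0 t"
      "z t = z0 + Jt + (\<Sum>j\<in>UNIV. It j)" and
    s: "(f has_integral Js) {0..s}" "\<And>j. has_RS_integral (g j) (w j) (Is j) 0 s"
      "z s = z0 + Js + (\<Sum>j\<in>UNIV. Is j)"
    using eq unfolding young_equation_def by metis
  have int: "f integrable_on {s..t}"
    using integrable_subinterval_real[of f 0 t s t] t(1) st by (auto simp: integrable_on_def)
  then have "(f has_integral Js + integral {s..t} f) {0..t}"
    by (intro has_integral_combine[OF st(1,2) s(1)] integrable_integral)
  then have "Jt = Js + integral {s..t} f" by (rule has_integral_unique[OF t(1)])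
  moreover have "norm (integral {s..t} f) \<le> P * measure lborel (cbox s t)"
    by (rule has_integral_bound[OF nn(3)]) (use int fP in \<open>auto simp: integrable_integral\<close>)
  ultimately have J: "norm (Jt - Js) \<le> P * (t - s)" using st by simp
  let ?K = "1 / (2 powr (\<alpha> + \<beta>) - 2) :: real"
  let ?Q = "\<Gamma> * P * (t - s) powr \<beta> + F * \<Gamma> * ?K * (t - s) powr (\<alpha> + \<beta>)"
  have I: "norm (It j - Is j) \<le> ?Q" for j
  proof -
    have "has_RS_integral (g j) (w j) (It j - Is j) s t"
      by (rule has_RS_integral_subinterval[OF t(2) s(2) st(1,2)])
    then have "norm (It j - Is j - (w j t - w j s) *\<^sub>R g j s) \<le> F * \<Gamma> * ?K * (t - s) powr (\<alpha> + \<beta>)"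
      by (rule young_estimate) (use st \<theta> nn gF w in auto)
    moreover have "\<bar>w j t - w j s\<bar> * norm (g j s) \<le> (\<Gamma> * (t - s) powr \<beta>) * P"
      using w[of s t j] gP[of j] st nn by (intro mult_mono) auto
    ultimately show ?thesis
      using norm_triangle_sub[of "It j - Is j" "(w j t - w j s) *\<^sub>R g j s"] by (simp add: mult_ac)
  qed
  have "z t - z s = (Jt - Js) + (\<Sum>j\<in>UNIV. It j - Is j)"
    by (simp add: t s sum_subtractf)
  also have "norm \<dots> \<le> norm (Jt - Js) + (\<Sum>j\<in>UNIV. norm (It j - Is j))"
    by (intro norm_triangle_le add_left_mono norm_sum)
  also have "\<dots> \<le> P * (t - s) + (\<Sum>j\<in>(UNIV::'j set). ?Q)"
    by (intro add_mono J sum_mono I)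
  finally show ?thesis by simp
qed

text \<open>The integrands depend on the unknown path \<open>z\<close> at most linearly, with inhomogeneity
  \<open>A\<close>. In the last condition, the factor of \<open>\<bar>t - s\<bar>\<^sup>\<alpha>\<close> may
  contain \<open>z(s)\<close>, since the integrands multiply \<open>z\<close> by Hoelder coefficients.\<close>

definition linear_growth ::
    "real \<Rightarrow> real \<Rightarrow> real \<Rightarrow> real \<Rightarrow> (real \<Rightarrow> 'a::real_normed_vector) \<Rightarrow> ('j \<Rightarrow> real \<Rightarrow> 'a) \<Rightarrow> (real \<Rightarrow> 'a) \<Rightarrow> bool"
  where "linear_growth T \<alpha> A L f g z \<longleftrightarrow>
    (\<forall>t. 0 \<le> t \<longrightarrow> t \<le> T \<longrightarrow> norm (f t) \<le> A + L * norm (z t) \<and> (\<forall>j. norm (g j t) \<le> A + L * norm (z t))) \<and>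
    (\<forall>s t j. 0 \<le> s \<longrightarrow> s \<le> t \<longrightarrow> t \<le> T \<longrightarrow>
       norm (g j t - g j s) \<le> L * norm (z t - z s) + (A + L * norm (z s)) * (t - s) powr \<alpha>)"

lemma linear_growthI:
  assumes "\<And>t. 0 \<le> t \<Longrightarrow> t \<le> T \<Longrightarrow> norm (f t) \<le> A + L * norm (z t)"
    and "\<And>t j. 0 \<le> t \<Longrightarrow> t \<le> T \<Longrightarrow> norm (g j t) \<le> A + L * norm (z t)"
    and "\<And>s t j. 0 \<le> s \<Longrightarrow> s \<le> t \<Longrightarrow> t \<le> T \<Longrightarrow>
      norm (g j t - g j s) \<le> L * norm (z t - z s) + (A + L * norm (z s)) * (t - s) powr \<alpha>"
  shows "linear_growth T \<alpha> A L f g z"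
  using assms by (simp add: linear_growth_def)

lemma linear_growthD:
  assumes "linear_growth T \<alpha> A L f g z" "0 \<le> t" "t \<le> T"
  shows "norm (f t) \<le> A + L * norm (z t)" "norm (g j t) \<le> A + L * norm (z t)"
  using assms by (simp_all add: linear_growth_def)

lemma linear_growth_increment:
  assumes lin: "linear_growth T \<alpha> A L f g z" and st: "0 \<le> s" "s \<le> t" "t \<le> T"
  shows "norm (g j t - g j s) \<le> L * norm (z t - z s) + (A + L * norm (z s)) * (t - s) powr \<alpha>"
  using assms by (simp add: linear_growth_def)

text \<open>If every admissible constant \<open>N\<close> can be improved to \<open>c + N/2\<close>, then the
  fixed point \<open>2 c\<close> is admissible. This absorbs the unknown Hoelder constant of a solution into
  the left hand side of its own estimate, provided that some constant is admissible at the start.\<close>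

lemma halving_iteration:
  fixes c d :: real
  assumes start: "\<exists>N\<ge>0. P N" and mono: "\<And>N N'. P N \<Longrightarrow> N \<le> N' \<Longrightarrow> P N'"
    and step: "\<And>N. N \<ge> 0 \<Longrightarrow> P N \<Longrightarrow> P (c + N / 2)" and "c \<ge> 0"
    and closed: "\<And>N. P N \<Longrightarrow> x \<le> N * d"
  shows "x \<le> 2 * c * d"
proof -
  obtain N0 where N0: "N0 \<ge> 0" "P N0" using start by blast
  \<comment> \<open>Starting from \<open>2 c + N0\<close> instead of \<open>N0\<close> gives the iterates a
      closed form.\<close>
  have P: "P (2 * c + N0 / 2 ^ k)" for k
  proof (induction k)
    case 0
    show ?case using mono[OF N0(2), of "2 * c + N0"] \<open>c \<ge> 0\<close> by simp
  next
    case (Suc k)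
    have "P (c + (2 * c + N0 / 2 ^ k) / 2)"
      using Suc N0 \<open>c \<ge> 0\<close> by (intro step) auto
    then show ?case by (simp add: add_divide_distrib mult_ac)
  qed
  have "(\<lambda>k. N0 / 2 ^ k) \<longlonglongrightarrow> 0"
    by (rule LIMSEQ_divide_realpow_zero) simp
  then have "(\<lambda>k. (2 * c + N0 / 2 ^ k) * d) \<longlonglongrightarrow> (2 * c + 0) * d"
    by (intro tendsto_intros)
  then show ?thesis
    by (intro LIMSEQ_le_const[of "\<lambda>k. (2 * c + N0 / 2 ^ k) * d"]) (simp_all add: closed[OF P])
qed

text \<open>On intervals shorter than \<open>h\<close>, a Hoelder constant \<open>N\<close> of
  \<open>z\<close> bounds the integrands, and through \<open>young_equation_increment\<close> it yields the
  new constant \<open>D Q + D h\<^sup>\<beta> N\<close> with \<open>Q = A + |z(s)|\<close>. The choice of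
  \<open>h\<close> makes the factor of \<open>N\<close> at most \<open>1/2\<close>. Since the growth is
  linear, \<open>h\<close> does not depend on \<open>z\<close>.\<close>

lemma young_local_estimate:
  fixes z :: "real \<Rightarrow> 'a::euclidean_space" and w :: "'j::finite \<Rightarrow> real \<Rightarrow> real" and \<Gamma> :: real
  assumes eq: "young_equation T w z0 f g z"
    and lin: "linear_growth T \<alpha> A L f g z"
    and z: "holder_on \<alpha> T z"
    and w: "\<And>j. holder_bound T \<beta> \<Gamma> (w j)"
    and exps: "0 < \<alpha>" "\<alpha> \<le> \<beta>" "\<beta> \<le> 1" "\<alpha> + \<beta> > 1"
    and nn: "A \<ge> 0" "L \<ge> 0" "\<Gamma> \<ge> 0"
    and D: "D = (1 + L) * (1 + CARD('j) * \<Gamma> * (1 + 2 * (1 / (2 powr (\<alpha> + \<beta>) - 2))))"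
    and h: "0 < h" "h \<le> 1" "D * h powr \<beta> \<le> 1 / 2"
    and st: "0 \<le> s" "s \<le> t" "t \<le> T" "t - s \<le> h"
  shows "norm (z t - z s) \<le> 2 * D * (A + norm (z s)) * (t - s) powr \<alpha>"
proof -
  define K where "K = 1 / (2 powr (\<alpha> + \<beta>) - 2)"
  define m where "m = real CARD('j)"
  define Q where "Q = A + norm (z s)"
  define P where "P N \<longleftrightarrow> (\<forall>p q. s \<le> p \<and> p \<le> q \<and> q \<le> t \<longrightarrow> norm (z q - z p) \<le> N * (q - p) powr \<alpha>)" for N
  have K: "K > 0" using young_constant_step(1)[OF exps(4)] by (simp add: K_def)
  have Q: "Q \<ge> 0" using nn by (simp add: Q_def)
  have Dnn: "D \<ge> 0" using nn K unfolding D K_def[symmetric] by simp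
  have "norm (z t - z s) \<le> 2 * (D * Q) * (t - s) powr \<alpha>"
  proof (rule halving_iteration[where P = P and c = "D * Q"])
    obtain C where "C \<ge> 0" "holder_bound T \<alpha> C z" using z unfolding holder_on_iff_bound by blast
    then show "\<exists>N\<ge>0. P N"
      unfolding P_def using st by (intro exI[of _ C]) (auto intro: holder_boundD)
    show "P N'" if "P N" "N \<le> N'" for N N'
      using that unfolding P_def by (meson mult_right_mono order_trans powr_ge_zero)
    show "0 \<le> D * Q" using Dnn Q by simp
    show "norm (z t - z s) \<le> N * (t - s) powr \<alpha>" if "P N" for N
      using that st unfolding P_def by auto
    fix N assume N: "N \<ge> 0" "P N"
    have zr: "norm (z r) \<le> norm (z s) + N * h powr \<alpha>" if "s \<le> r" "r \<le> t" for r
    proof -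
      have "norm (z r - z s) \<le> N * (r - s) powr \<alpha>" using N(2) that by (auto simp: P_def)
      also have "\<dots> \<le> N * h powr \<alpha>"
        using that st exps N by (intro mult_left_mono powr_mono2) auto
      finally show ?thesis using norm_triangle_sub[of "z r" "z s"] by linarith
    qed
    have h\<alpha>: "h powr \<alpha> \<le> 1" using h exps by (simp add: powr_le1)
    define M where "M = (1 + L) * (Q + N * h powr \<alpha>)"
    define F where "F = (1 + L) * (Q + 2 * N)"
    have MF: "M \<ge> 0" "F \<ge> 0" using nn Q N by (simp_all add: M_def F_def)
    have growth: "A + L * norm (z r) \<le> M" if "s \<le> r" "r \<le> t" for r
    proof -
      have "A + L * norm (z r) \<le> A + L * (norm (z s) + N * h powr \<alpha>)"
        using zr[OF that] nn by (intro add_mono mult_left_mono) auto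
      also have "\<dots> \<le> M"
        using nn N by (simp add: M_def Q_def algebra_simps)
      finally show ?thesis .
    qed
    have gF: "norm (g j q - g j p) \<le> F * (q - p) powr \<alpha>" if "s \<le> p" "p \<le> q" "q \<le> t" for j p q
    proof -
      have "norm (g j q - g j p) \<le> L * norm (z q - z p) + (A + L * norm (z p)) * (q - p) powr \<alpha>"
        using that st by (intro linear_growth_increment[OF lin]) auto
      also have "\<dots> \<le> L * (N * (q - p) powr \<alpha>) + M * (q - p) powr \<alpha>"
        using N(2) that growth[of p] nn
        by (intro add_mono mult_left_mono mult_right_mono) (simp_all add: P_def)
      also have "\<dots> = (L * N + M) * (q - p) powr \<alpha>" by (simp add: algebra_simps)
      also have "\<dots> \<le> F * (q - p) powr \<alpha>"
      proof (intro mult_right_mono)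
        have "N * h powr \<alpha> \<le> N" using h\<alpha> N by (simp add: mult_left_le)
        then have "(1 + L) * (N * h powr \<alpha>) \<le> (1 + L) * N" using nn by (intro mult_left_mono) auto
        moreover have "L * N \<le> (1 + L) * N" using N by (intro mult_right_mono) auto
        ultimately show "L * N + M \<le> F" by (simp add: M_def F_def algebra_simps)
      qed simp
      finally show ?thesis .
    qed
    show "P (D * Q + N / 2)"
      unfolding P_def
    proof (intro allI impI, elim conjE)
      fix p q assume pq: "s \<le> p" "p \<le> q" "q \<le> t"
      define e where "e = q - p"
      have e: "0 \<le> e" "e \<le> h" using pq st by (auto simp: e_def)
      have "norm (z q - z p) \<le> M * (q - p) + m * (\<Gamma> * M * (q - p) powr \<beta> + F * \<Gamma> * K * (q - p) powr (\<alpha> + \<beta>))"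
        unfolding m_def K_def
      proof (rule young_equation_increment[OF eq _ pq(2) _ exps(4)])
        show "0 \<le> p" "q \<le> T" "0 \<le> F" "0 \<le> \<Gamma>" "0 \<le> M" using pq st nn MF by auto
        show "norm (f r) \<le> M" if "p \<le> r" "r \<le> q" for r
          using linear_growthD(1)[OF lin, of r] growth[of r] that pq st by linarith
        show "norm (g j p) \<le> M" for j
          using linear_growthD(2)[OF lin, of p j] growth[of p] pq st by linarith
        show "norm (g j q' - g j p') \<le> F * (q' - p') powr \<alpha>" if "p \<le> p'" "p' \<le> q'" "q' \<le> q" for j p' q'
          using that pq by (intro gF) auto
        show "\<bar>w j q' - w j p'\<bar> \<le> \<Gamma> * (q' - p') powr \<beta>" if "p \<le> p'" "p' \<le> q'" "q' \<le> q" for j p' q'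
          using holder_boundD[OF w[of j], of p' q'] that pq st by auto
      qed
      also have "\<dots> = M * e + m * (\<Gamma> * M * e powr \<beta> + F * \<Gamma> * K * e powr (\<alpha> + \<beta>))"
        by (simp add: e_def)
      also have "\<dots> \<le> M * (e powr \<alpha> * h powr (\<beta> - \<alpha>)) +
          m * (\<Gamma> * M * (e powr \<alpha> * h powr (\<beta> - \<alpha>)) + F * \<Gamma> * K * (e powr \<alpha> * h powr \<beta>))"
      proof -
        have e2: "e powr \<beta> \<le> e powr \<alpha> * h powr (\<beta> - \<alpha>)"
        proof -
          have "e powr \<beta> = e powr \<alpha> * e powr (\<beta> - \<alpha>)" by (simp flip: powr_add)
          also have "\<dots> \<le> e powr \<alpha> * h powr (\<beta> - \<alpha>)"
            using e exps by (intro mult_left_mono powr_mono2) auto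
          finally show ?thesis .
        qed
        have e1: "e \<le> e powr \<alpha> * h powr (\<beta> - \<alpha>)"
        proof -
          have "e \<le> e powr \<beta>"
          proof (cases "e = 0")
            case False
            then have "e powr 1 \<le> e powr \<beta>" using e h exps by (intro powr_mono') auto
            then show ?thesis using e by simp
          qed simp
          then show ?thesis using e2 by linarith
        qed
        have e3: "e powr (\<alpha> + \<beta>) \<le> e powr \<alpha> * h powr \<beta>"
          unfolding powr_add using e exps by (intro mult_left_mono powr_mono2) auto
        show ?thesis
          using MF nn K by (intro add_mono mult_left_mono e1 e2 e3) (auto simp: m_def)
      qed
      also have "\<dots> = ((1 + m * \<Gamma>) * (M * h powr (\<beta> - \<alpha>)) + m * \<Gamma> * K * (F * h powr \<beta>)) * e powr \<alpha>"
        by (simp add: algebra_simps)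
      also have "\<dots> \<le> (D * Q + N / 2) * e powr \<alpha>"
      proof (intro mult_right_mono)
        have le1: "h powr (\<beta> - \<alpha>) \<le> 1" "h powr \<beta> \<le> 1" using h exps by (auto intro!: powr_le1)
        have split: "h powr \<alpha> * h powr (\<beta> - \<alpha>) = h powr \<beta>" by (simp flip: powr_add)
        have "M * h powr (\<beta> - \<alpha>) = (1 + L) * (Q * h powr (\<beta> - \<alpha>) + N * h powr \<beta>)"
          by (simp add: M_def algebra_simps flip: split)
        also have "\<dots> \<le> (1 + L) * (Q + N * h powr \<beta>)"
          using nn Q N le1 mult_left_le[of "h powr (\<beta> - \<alpha>)" Q] by (intro mult_left_mono add_mono) auto
        finally have a: "M * h powr (\<beta> - \<alpha>) \<le> (1 + L) * (Q + N * h powr \<beta>)" .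
        have "F * h powr \<beta> = (1 + L) * (Q * h powr \<beta> + 2 * N * h powr \<beta>)"
          by (simp add: F_def algebra_simps)
        also have "\<dots> \<le> (1 + L) * (2 * Q + 2 * N * h powr \<beta>)"
        proof -
          have "Q * h powr \<beta> \<le> Q" using Q le1 by (intro mult_left_le) auto
          then show ?thesis using nn Q by (intro mult_left_mono) auto
        qed
        finally have b: "F * h powr \<beta> \<le> (1 + L) * (2 * Q + 2 * N * h powr \<beta>)" .
        have "(1 + m * \<Gamma>) * (M * h powr (\<beta> - \<alpha>)) + m * \<Gamma> * K * (F * h powr \<beta>)
            \<le> (1 + m * \<Gamma>) * ((1 + L) * (Q + N * h powr \<beta>)) +
              m * \<Gamma> * K * ((1 + L) * (2 * Q + 2 * N * h powr \<beta>))"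
          using nn K by (intro add_mono mult_left_mono a b) (auto simp: m_def)
        also have "\<dots> = D * Q + N * (D * h powr \<beta>)"
          unfolding D K_def[symmetric] m_def[symmetric] by (simp add: algebra_simps)
        also have "\<dots> \<le> D * Q + N * (1 / 2)"
          using N h by (intro add_left_mono mult_left_mono) auto
        finally show "(1 + m * \<Gamma>) * (M * h powr (\<beta> - \<alpha>)) + m * \<Gamma> * K * (F * h powr \<beta>) \<le> D * Q + N / 2"
          by simp
      qed simp
      finally show "norm (z q - z p) \<le> (D * Q + N / 2) * (q - p) powr \<alpha>" by (simp add: e_def)
    qed
  qed
  then show ?thesis by (simp add: Q_def mult_ac)
qed

text \<open>A solution that is Hoelder of some order \<open>\<kappa>\<close>, possibly below
  \<open>\<alpha>\<close>, has integrands of order \<open>min \<kappa> \<alpha>\<close>. As long as Young's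
  condition holds, the integrals are as regular as the driving path, whose order is at least
  \<open>\<alpha>\<close>.\<close>

lemma young_bootstrap:
  fixes z :: "real \<Rightarrow> 'a::euclidean_space" and w :: "'j::finite \<Rightarrow> real \<Rightarrow> real"
  assumes eq: "young_equation T w z0 f g z"
    and lin: "linear_growth T \<alpha> A L f g z"
    and z: "holder_on \<kappa> T z" "0 < \<kappa>"
    and w: "\<And>j. holder_on \<beta> T (w j)"
    and exps: "0 < \<alpha>" "\<alpha> \<le> \<beta>" "\<alpha> \<le> 1" "min \<kappa> \<alpha> + \<beta> > 1"
    and nn: "A \<ge> 0" "L \<ge> 0"
  shows "holder_on \<alpha> T z"
proof -
  define k where "k = min \<kappa> \<alpha>"
  define K where "K = 1 / (2 powr (k + \<beta>) - 2)"
  have K: "K > 0" using young_constant_step(1)[of "k + \<beta>"] exps by (simp add: K_def k_def)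
  obtain C where C: "C \<ge> 0" "holder_bound T \<kappa> C z" using z unfolding holder_on_iff_bound by blast
  obtain \<Gamma> where \<Gamma>: "\<Gamma> \<ge> 0" "\<And>j. holder_bound T \<beta> \<Gamma> (w j)" using holder_on_uniform[of \<beta> T w, OF w] by blast
  define M where "M = A + L * (norm (z 0) + C * T powr \<kappa>)"
  define F where "F = L * C * T powr (\<kappa> - k) + M * T powr (\<alpha> - k)"
  have M: "M \<ge> 0" using nn C by (simp add: M_def)
  have F: "F \<ge> 0" using nn C M by (simp add: F_def)
  have growth: "A + L * norm (z t) \<le> M" if "0 \<le> t" "t \<le> T" for t
    unfolding M_def using holder_bound_sup[OF C(2,1) _ that] z nn by (intro add_left_mono mult_left_mono) auto
  have gF: "norm (g j t - g j s) \<le> F * (t - s) powr k" if st: "0 \<le> s" "s \<le> t" "t \<le> T" for j s t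
  proof -
    have "norm (g j t - g j s) \<le> L * norm (z t - z s) + (A + L * norm (z s)) * (t - s) powr \<alpha>"
      using st by (intro linear_growth_increment[OF lin]) auto
    also have "\<dots> \<le> L * (C * (T powr (\<kappa> - k) * (t - s) powr k)) + M * (T powr (\<alpha> - k) * (t - s) powr k)"
    proof (intro add_mono mult_left_mono mult_mono)
      have "norm (z t - z s) \<le> C * (t - s) powr \<kappa>" by (rule holder_boundD[OF C(2) st])
      also have "\<dots> \<le> C * (T powr (\<kappa> - k) * (t - s) powr k)"
        using C st by (intro mult_left_mono powr_le_on_interval) (auto simp: k_def)
      finally show "norm (z t - z s) \<le> C * (T powr (\<kappa> - k) * (t - s) powr k)" .
    qed (use nn M growth st in \<open>auto simp: k_def intro!: powr_le_on_interval\<close>)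
    finally show ?thesis by (simp add: F_def algebra_simps)
  qed
  have "holder_bound T \<alpha> (M * T powr (1 - \<alpha>) + CARD('j) * (\<Gamma> * M * T powr (\<beta> - \<alpha>) +
      F * \<Gamma> * K * T powr (k + \<beta> - \<alpha>))) z"
  proof (rule holder_boundI)
    fix s t assume st: "0 \<le> s" "s \<le> t" "t \<le> T"
    have "norm (z t - z s) \<le> M * (t - s) + CARD('j) * (\<Gamma> * M * (t - s) powr \<beta> +
        F * \<Gamma> * (1 / (2 powr (k + \<beta>) - 2)) * (t - s) powr (k + \<beta>))"
    proof (rule young_equation_increment[OF eq st _ F \<Gamma>(1) M])
      show "1 < k + \<beta>" using exps by (simp add: k_def)
      show "norm (f r) \<le> M" if "s \<le> r" "r \<le> t" for r
        using linear_growthD(1)[OF lin, of r] growth[of r] that st by linarith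
      show "norm (g j s) \<le> M" for j
        using linear_growthD(2)[OF lin, of s j] growth[of s] st by linarith
      show "norm (g j q - g j p) \<le> F * (q - p) powr k" if "s \<le> p" "p \<le> q" "q \<le> t" for j p q
        using that st by (intro gF) auto
      show "\<bar>w j q - w j p\<bar> \<le> \<Gamma> * (q - p) powr \<beta>" if "s \<le> p" "p \<le> q" "q \<le> t" for j p q
        using holder_boundD[OF \<Gamma>(2)[of j], of p q] that st by auto
    qed
    also have "\<dots> \<le> M * (T powr (1 - \<alpha>) * (t - s) powr \<alpha>) +
        CARD('j) * (\<Gamma> * M * (T powr (\<beta> - \<alpha>) * (t - s) powr \<alpha>) +
          F * \<Gamma> * (1 / (2 powr (k + \<beta>) - 2)) * (T powr (k + \<beta> - \<alpha>) * (t - s) powr \<alpha>))"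
    proof (intro add_mono mult_left_mono powr_le_on_interval)
      show "t - s \<le> T powr (1 - \<alpha>) * (t - s) powr \<alpha>"
        using powr_le_on_interval[of "t - s" T \<alpha> 1] st exps by simp
      show "\<alpha> \<le> k + \<beta>" using exps by (simp add: k_def)
      show "0 \<le> F * \<Gamma> * (1 / (2 powr (k + \<beta>) - 2))"
        using F \<Gamma> K unfolding K_def[symmetric] by simp
    qed (use st exps M \<Gamma> in auto)
    finally show "norm (z t - z s) \<le> (M * T powr (1 - \<alpha>) + CARD('j) * (\<Gamma> * M * T powr (\<beta> - \<alpha>) +
      F * \<Gamma> * K * T powr (k + \<beta> - \<alpha>))) * (t - s) powr \<alpha>"
      unfolding K_def[symmetric] by (simp add: algebra_simps)
  qed
  then show ?thesis unfolding holder_on_def holder_bound_def by blast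
qed

text \<open>The local estimate at starting point \<open>s\<close> gives
  \<open>A + |z(t)| \<le> (1 + 2 D) (A + |z(s)|)\<close> for \<open>t - s \<le> h\<close>. About
  \<open>T/h\<close> such steps cover the interval. The Hoelder constant follows from the local one on short
  intervals and from the supremum on long ones. The constant is chosen before the equation, so that it is
  uniform over all systems with the same growth constant \<open>L\<close>.\<close>

lemma young_gronwall:
  fixes w :: "'j::finite \<Rightarrow> real \<Rightarrow> real"
  assumes T: "0 < T"
    and w: "\<And>j. holder_on \<beta> T (w j)"
    and exps: "0 < \<alpha>" "\<alpha> \<le> \<beta>" "\<beta> \<le> 1" "\<alpha> + \<beta> > 1"
    and L: "L \<ge> 0"
  shows "\<exists>C\<ge>0. \<forall>A\<ge>0. \<forall>z0 f g. \<forall>z :: real \<Rightarrow> 'a::euclidean_space.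
    young_equation T w z0 f g z \<longrightarrow> linear_growth T \<alpha> A L f g z \<longrightarrow> holder_on \<alpha> T z \<longrightarrow>
    (\<forall>t\<in>{0..T}. norm (z t) \<le> C * (A + norm z0)) \<and> holder_bound T \<alpha> (C * (A + norm z0)) z"
proof -
  obtain \<Gamma> where \<Gamma>: "\<Gamma> \<ge> 0" "\<And>j. holder_bound T \<beta> \<Gamma> (w j)" using holder_on_uniform[of \<beta> T w, OF w] by blast
  define K where "K = 1 / (2 powr (\<alpha> + \<beta>) - 2)"
  have K: "K > 0" using young_constant_step(1)[OF exps(4)] by (simp add: K_def)
  define D where "D = (1 + L) * (1 + CARD('j) * \<Gamma> * (1 + 2 * K))"
  have D: "D \<ge> 0" using L \<Gamma> K by (simp add: D_def)
  \<comment> \<open>Any \<open>h \<le> 1\<close> with \<open>D h\<^sup>\<beta> \<le> 1/2\<close> would do;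
      \<open>D + 1\<close> keeps the denominator positive.\<close>
  define h where "h = min 1 ((1 / (2 * (D + 1))) powr (1 / \<beta>))"
  have h: "0 < h" "h \<le> 1" using D by (auto simp: h_def)
  have "h powr \<beta> \<le> ((1 / (2 * (D + 1))) powr (1 / \<beta>)) powr \<beta>"
    using exps h by (intro powr_mono2) (auto simp: h_def)
  also have "\<dots> = 1 / (2 * (D + 1))" using exps D by (simp add: powr_powr)
  finally have "D * h powr \<beta> \<le> D * (1 / (2 * (D + 1)))" using D by (rule mult_left_mono)
  also have "\<dots> \<le> 1 / 2" using D by (simp add: field_simps)
  finally have hD: "D * h powr \<beta> \<le> 1 / 2" .
  obtain n :: nat where n: "T < n * h" using h reals_Archimedean3 by blast
  define C0 where "C0 = (1 + 2 * D) ^ n"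
  have C0: "C0 \<ge> 0" using D by (simp add: C0_def)
  define C where "C = C0 + 2 * D * C0 + 2 * C0 * h powr (- \<alpha>)"
  have C: "C \<ge> 0" "C0 \<le> C" "2 * D * C0 \<le> C" "2 * C0 * h powr (- \<alpha>) \<le> C"
    using C0 D by (auto simp: C_def)
  show ?thesis
  proof (intro exI[of _ C] conjI C(1) allI impI)
    fix A z0 f g and z :: "real \<Rightarrow> 'a"
    assume A: "0 \<le> A" and eq: "young_equation T w z0 f g z"
      and lin: "linear_growth T \<alpha> A L f g z" and z: "holder_on \<alpha> T z"
    define R where "R = A + norm z0"
    have R: "R \<ge> 0" using A by (simp add: R_def)
    have z_init: "z 0 = z0" using young_equation_initial[OF eq] T by simp
    have loc: "norm (z t - z s) \<le> 2 * D * (A + norm (z s)) * (t - s) powr \<alpha>"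
      if "0 \<le> s" "s \<le> t" "t \<le> T" "t - s \<le> h" for s t
      using young_local_estimate[OF eq lin z \<Gamma>(2) exps A L \<Gamma>(1) _ h hD that]
      unfolding D_def K_def by simp
    have step: "A + norm (z t) \<le> (1 + 2 * D) ^ k * R" if "0 \<le> t" "t \<le> T" "t \<le> k * h" for k t
      using that
    proof (induction k arbitrary: t)
      case 0
      then show ?case using z_init by (simp add: R_def)
    next
      case (Suc k)
      \<comment> \<open>One step back from \<open>t\<close>, stopped at the initial time.\<close>
      define s where "s = max 0 (t - h)"
      have s: "0 \<le> s" "s \<le> t" "t - s \<le> h" "s \<le> k * h" "s \<le> T"
        using Suc.prems h by (auto simp: s_def algebra_simps)
      have "norm (z t - z s) \<le> 2 * D * (A + norm (z s)) * (t - s) powr \<alpha>"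
        using s Suc.prems by (intro loc) auto
      also have "\<dots> \<le> 2 * D * (A + norm (z s)) * 1"
        using s h exps D A by (intro mult_left_mono powr_le1) auto
      finally have "A + norm (z t) \<le> (1 + 2 * D) * (A + norm (z s))"
        using norm_triangle_sub[of "z t" "z s"] by (simp add: algebra_simps)
      also have "\<dots> \<le> (1 + 2 * D) * ((1 + 2 * D) ^ k * R)"
        using D s by (intro mult_left_mono Suc.IH) auto
      finally show ?case by simp
    qed
    have bound: "A + norm (z t) \<le> C0 * R" if "0 \<le> t" "t \<le> T" for t
      using step[of t n] that n by (simp add: C0_def)
    show "\<forall>t\<in>{0..T}. norm (z t) \<le> C * (A + norm z0)"
    proof
      fix t assume "t \<in> {0..T}"
      then have "norm (z t) \<le> C0 * R" using bound[of t] A by auto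
      also have "\<dots> \<le> C * R" using C R by (intro mult_right_mono) auto
      finally show "norm (z t) \<le> C * (A + norm z0)" by (simp add: R_def)
    qed
    show "holder_bound T \<alpha> (C * (A + norm z0)) z"
    proof (rule holder_boundI)
      fix s t assume st: "0 \<le> s" "s \<le> t" "t \<le> T"
      show "norm (z t - z s) \<le> C * (A + norm z0) * (t - s) powr \<alpha>"
      proof (cases "t - s \<le> h")
        case True
        have "norm (z t - z s) \<le> 2 * D * (A + norm (z s)) * (t - s) powr \<alpha>"
          using loc st True by blast
        also have "\<dots> \<le> 2 * D * (C0 * R) * (t - s) powr \<alpha>"
          using bound[of s] st D by (intro mult_right_mono mult_left_mono) auto
        also have "\<dots> \<le> C * R * (t - s) powr \<alpha>"
          using mult_right_mono[OF C(3) R] by (intro mult_right_mono) (auto simp: mult_ac)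
        finally show ?thesis by (simp add: R_def)
      next
        case False
        have "h powr (- \<alpha>) * h powr \<alpha> = 1" using h by (simp flip: powr_add)
        moreover have "h powr \<alpha> \<le> (t - s) powr \<alpha>" using False h exps by (intro powr_mono2) auto
        ultimately have one: "1 \<le> h powr (- \<alpha>) * (t - s) powr \<alpha>"
          by (metis mult_left_mono powr_ge_zero)
        have "norm (z t - z s) \<le> norm (z t) + norm (z s)" by (rule norm_triangle_ineq4)
        also have "\<dots> \<le> 2 * C0 * R * 1" using bound[of s] bound[of t] st A by auto
        also have "\<dots> \<le> 2 * C0 * R * (h powr (- \<alpha>) * (t - s) powr \<alpha>)"
          using one C0 R by (intro mult_left_mono) auto
        also have "\<dots> = (2 * C0 * h powr (- \<alpha>)) * (R * (t - s) powr \<alpha>)" by (simp add: mult_ac)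
        also have "\<dots> \<le> C * (R * (t - s) powr \<alpha>)"
          using C(4) R by (intro mult_right_mono) auto
        finally show ?thesis by (simp add: R_def mult_ac)
      qed
    qed
  qed
qed

section \<open>Hoelder continuity of fractional Brownian motion\<close>

text \<open>Approximate \<open>t\<close> by the dyadic points below it. Consecutive approximations are equal
  or neighbours on the finer grid, so their increments form a geometric series with ratio
  \<open>q = 2\<^sup>-\<^sup>\<beta>\<close>, whose sum is passed to the limit by continuity. Two points at
  distance between \<open>T/2\<^sup>n\<^sup>+\<^sup>1\<close> and \<open>T/2\<^sup>n\<close> have equal or
  neighbouring approximations at level \<open>n\<close>.\<close>

lemma dyadic_increments_imp_holder:
  fixes f :: "real \<Rightarrow> 'a::real_normed_vector"
  assumes cont: "continuous_on {0..T} f" and T: "0 < T" and \<beta>: "0 < \<beta>" and C: "0 \<le> C"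
    and dyadic: "\<And>n i. i < 2 ^ n \<Longrightarrow>
      norm (f (T * real (Suc i) / 2 ^ n) - f (T * real i / 2 ^ n)) \<le> C * (2 powr (- \<beta>)) ^ n"
  shows "holder_on \<beta> T f"
proof -
  define q where "q = 2 powr (- \<beta>)"
  have q: "0 < q" "q < 1" using \<beta> by (auto simp: q_def powr_less_one)
  define S where "S = q / (1 - q)"
  have S: "S \<ge> 0" using q by (simp add: S_def)
  define idx where "idx n t = nat \<lfloor>2 ^ n * (t / T)\<rfloor>" for n :: nat and t
  define pt where "pt n t = T * real (idx n t) / 2 ^ n" for n t
  have idx_real: "real (idx n t) = of_int \<lfloor>2 ^ n * (t / T)\<rfloor>" if "0 \<le> t" for n t
    using that T by (simp add: idx_def)
  have idx_le: "idx n t \<le> 2 ^ n" if "0 \<le> t" "t \<le> T" for n t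
  proof -
    have "2 ^ n * (t / T) \<le> 2 ^ n" using that T by (simp add: field_simps)
    then have "\<lfloor>2 ^ n * (t / T)\<rfloor> \<le> \<lfloor>2 ^ n :: real\<rfloor>" by (rule floor_mono)
    then have "\<lfloor>2 ^ n * (t / T)\<rfloor> \<le> 2 ^ n" by simp
    then show ?thesis by (simp add: idx_def nat_le_iff)
  qed
  have pt: "pt n t \<le> t" "t - T / 2 ^ n \<le> pt n t" "0 \<le> pt n t" if "0 \<le> t" for n t
  proof -
    have "real (idx n t) \<le> 2 ^ n * (t / T)" "2 ^ n * (t / T) \<le> real (idx n t) + 1"
      unfolding idx_real[OF that] by linarith+
    then have "T * real (idx n t) / 2 ^ n \<le> T * (2 ^ n * (t / T)) / 2 ^ n"
      "T * (2 ^ n * (t / T)) / 2 ^ n \<le> T * (real (idx n t) + 1) / 2 ^ n"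
      using T by (intro divide_right_mono mult_left_mono; simp)+
    moreover have "T * (2 ^ n * (t / T)) / 2 ^ n = t" using T by simp
    ultimately show "pt n t \<le> t" "t - T / 2 ^ n \<le> pt n t"
      by (simp_all add: pt_def distrib_left add_divide_distrib)
    show "0 \<le> pt n t" using T by (simp add: pt_def)
  qed
  have step: "norm (f (pt (Suc n) t) - f (pt n t)) \<le> C * q ^ Suc n" if t: "0 \<le> t" "t \<le> T" for n t
  proof -
    have "idx (Suc n) t = 2 * idx n t \<or> idx (Suc n) t = Suc (2 * idx n t)"
    proof -
      have "\<lfloor>2 * (2 ^ n * (t / T))\<rfloor> = 2 * \<lfloor>2 ^ n * (t / T)\<rfloor> \<or> \<lfloor>2 * (2 ^ n * (t / T))\<rfloor> = 2 * \<lfloor>2 ^ n * (t / T)\<rfloor> + 1"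
        by linarith
      moreover have "0 \<le> \<lfloor>2 ^ n * (t / T)\<rfloor>" using t T by simp
      ultimately show ?thesis by (auto simp: idx_def mult.assoc nat_mult_distrib nat_add_distrib)
    qed
    moreover have base: "pt n t = T * real (2 * idx n t) / 2 ^ Suc n" by (simp add: pt_def)
    ultimately consider "pt (Suc n) t = pt n t" | "idx (Suc n) t = Suc (2 * idx n t)"
      by (auto simp: pt_def)
    then show ?thesis
    proof cases
      case 1
      then show ?thesis using C q by simp
    next
      case 2
      have "2 * idx n t < 2 ^ Suc n" using idx_le[OF t, of "Suc n"] 2 by simp
      from dyadic[OF this] show ?thesis
        unfolding base pt_def[of "Suc n"] 2 q_def by simp
    qed
  qed
  have chain: "norm (f (pt (n + k) t) - f (pt n t)) \<le> C * q ^ n * (S * (1 - q ^ k))"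
    if t: "0 \<le> t" "t \<le> T" for n k t
  proof (induction k)
    case (Suc k)
    have Sq: "S * (1 - q) = q" using q by (simp add: S_def)
    have "norm (f (pt (n + Suc k) t) - f (pt n t)) \<le>
        norm (f (pt (n + Suc k) t) - f (pt (n + k) t)) + norm (f (pt (n + k) t) - f (pt n t))"
      by (metis diff_add_cancel add_diff_eq norm_triangle_ineq)
    also have "\<dots> \<le> C * q ^ Suc (n + k) + C * q ^ n * (S * (1 - q ^ k))"
      using step[OF t, of "n + k"] Suc by simp
    also have "\<dots> = C * q ^ n * (S * (1 - q ^ k) + q ^ k * q)"
      by (simp add: algebra_simps power_add)
    also have "\<dots> = C * q ^ n * (S * (1 - q ^ k) + q ^ k * (S * (1 - q)))"
      unfolding Sq ..
    also have "\<dots> = C * q ^ n * (S * (1 - q ^ Suc k))" by (simp add: algebra_simps)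
    finally show ?case .
  qed simp
  have approx: "norm (f t - f (pt n t)) \<le> C * q ^ n * S" if t: "0 \<le> t" "t \<le> T" for n t
  proof -
    have "(\<lambda>k. pt k t) \<longlonglongrightarrow> t"
    proof (rule tendsto_sandwich)
      show "\<forall>\<^sub>F k in sequentially. t - T / 2 ^ k \<le> pt k t" "\<forall>\<^sub>F k in sequentially. pt k t \<le> t"
        using pt[OF t(1)] by simp_all
      have "(\<lambda>k. T / 2 ^ k) \<longlonglongrightarrow> 0" by (rule LIMSEQ_divide_realpow_zero) simp
      then have "(\<lambda>k. t - T / 2 ^ k) \<longlonglongrightarrow> t - 0" by (intro tendsto_diff tendsto_const)
      then show "(\<lambda>k. t - T / 2 ^ k) \<longlonglongrightarrow> t" by simp
    qed simp
    then have "(\<lambda>k. f (pt k t)) \<longlonglongrightarrow> f t"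
      using t pt[OF t(1)] order_trans[OF pt(1)[OF t(1)] t(2)]
      by (intro continuous_on_tendsto_compose[OF cont]) simp_all
    then have "(\<lambda>k. f (pt (k + n) t)) \<longlonglongrightarrow> f t" by (rule LIMSEQ_ignore_initial_segment)
    then have lim: "(\<lambda>k. norm (f (pt (k + n) t) - f (pt n t))) \<longlonglongrightarrow> norm (f t - f (pt n t))"
      by (intro tendsto_intros)
    have "norm (f (pt (k + n) t) - f (pt n t)) \<le> C * q ^ n * S" for k
    proof -
      have "S * (1 - q ^ k) \<le> S * 1" using S q by (intro mult_left_mono) auto
      then have "C * q ^ n * (S * (1 - q ^ k)) \<le> C * q ^ n * S"
        using C q by (intro mult_left_mono) auto
      then show ?thesis using chain[OF t, of n k] by (simp add: add.commute)
    qed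
    then show ?thesis by (intro LIMSEQ_le_const2[OF lim]) auto
  qed
  have "norm (f t - f s) \<le> C * (2 * S + 1) * (2 / T) powr \<beta> * (t - s) powr \<beta>"
    if st: "0 \<le> s" "s < t" "t \<le> T" for s t
  proof -
    have "\<exists>n. T / 2 ^ Suc n < t - s \<and> t - s \<le> T / 2 ^ n"
    proof -
      have "(\<lambda>k. T / 2 ^ k) \<longlonglongrightarrow> 0" by (rule LIMSEQ_divide_realpow_zero) simp
      then have "\<exists>k. T / 2 ^ k < t - s"
        using st order_tendstoD(2)[of "\<lambda>k. T / 2 ^ k" 0 sequentially "t - s"]
        by (auto simp: eventually_sequentially)
      then obtain k where k: "T / 2 ^ k < t - s" "\<And>i. i < k \<Longrightarrow> \<not> T / 2 ^ i < t - s"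
        using exists_least_iff[of "\<lambda>k. T / 2 ^ k < t - s"] by blast
      obtain n where n: "k = Suc n" using k(1) st by (cases k) auto
      show ?thesis using k(1) k(2)[of n] unfolding n by (intro exI[of _ n]) auto
    qed
    then obtain n where n: "T / 2 ^ Suc n < t - s" "t - s \<le> T / 2 ^ n" by blast
    have "2 ^ n * (t / T) \<le> 2 ^ n * (s / T) + 1" using n(2) T by (simp add: field_simps)
    moreover have "2 ^ n * (s / T) \<le> 2 ^ n * (t / T)" using st T by (simp add: field_simps)
    ultimately have "\<lfloor>2 ^ n * (t / T)\<rfloor> = \<lfloor>2 ^ n * (s / T)\<rfloor> \<or> \<lfloor>2 ^ n * (t / T)\<rfloor> = \<lfloor>2 ^ n * (s / T)\<rfloor> + 1"
      by linarith
    moreover have "0 \<le> \<lfloor>2 ^ n * (s / T)\<rfloor>" using st T by simp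
    ultimately consider "idx n t = idx n s" | "idx n t = Suc (idx n s)"
      by (auto simp: idx_def nat_add_distrib)
    then have mid: "norm (f (pt n t) - f (pt n s)) \<le> C * q ^ n"
    proof cases
      case 1
      then show ?thesis using C q by (simp add: pt_def)
    next
      case 2
      have "idx n s < 2 ^ n" using idx_le[of t n] 2 st by simp
      from dyadic[OF this] show ?thesis unfolding pt_def 2 q_def .
    qed
    have "f t - f s = (f t - f (pt n t)) + (f (pt n t) - f (pt n s)) - (f s - f (pt n s))" by simp
    then have "norm (f t - f s) \<le> norm (f t - f (pt n t)) + norm (f (pt n t) - f (pt n s)) + norm (f s - f (pt n s))"
      by (metis norm_triangle_ineq4 norm_triangle_le norm_triangle_mono norm_triangle_ineq add_right_mono order_trans)
    also have "\<dots> \<le> C * q ^ n * S + C * q ^ n + C * q ^ n * S"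
      using approx[of t n] approx[of s n] mid st by (intro add_mono) auto
    also have "\<dots> = C * (2 * S + 1) * q ^ n" by (simp add: algebra_simps)
    also have "\<dots> \<le> C * (2 * S + 1) * ((2 / T) powr \<beta> * (t - s) powr \<beta>)"
    proof (intro mult_left_mono)
      have "q ^ n = (1 / 2 ^ n) powr \<beta>"
        by (simp add: q_def powr_realpow[symmetric] powr_powr powr_minus_divide powr_divide mult.commute flip: powr_realpow)
      also have "\<dots> \<le> (2 / T * (t - s)) powr \<beta>"
        using n(1) T \<beta> by (intro powr_mono2) (auto simp: field_simps)
      also have "\<dots> = (2 / T) powr \<beta> * (t - s) powr \<beta>" by (rule powr_mult)
      finally show "q ^ n \<le> (2 / T) powr \<beta> * (t - s) powr \<beta>" .
    qed (use C S in auto)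
    finally show ?thesis by (simp add: mult_ac)
  qed
  then have inc: "norm (f t - f s) \<le> C * (2 * S + 1) * (2 / T) powr \<beta> * (t - s) powr \<beta>"
    if "0 \<le> s" "s \<le> t" "t \<le> T" for s t
    using that by (cases "s = t") simp_all
  have "holder_bound T \<beta> (C * (2 * S + 1) * (2 / T) powr \<beta>) f"
    by (rule holder_boundI) (rule inc)
  then show ?thesis unfolding holder_on_def holder_bound_def by blast
qed

text \<open>Kolmogorov's argument: the sum \<open>Y\<close> of the \<open>p\<close>-th powers of all dyadic
  increments, the level \<open>n\<close> ones scaled by \<open>2\<^sup>n\<^sup>\<beta>\<close>, has finite
  expectation, because level \<open>n\<close> contributes at most a multiple of
  \<open>2\<^sup>n (2\<^sup>\<beta>\<^sup>p / 2\<^sup>1\<^sup>+\<^sup>r)\<^sup>n\<close>. So \<open>Y\<close>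
  is almost surely finite and bounds every single scaled increment.\<close>

lemma kolmogorov_holder:
  fixes X :: "real \<Rightarrow> 'w \<Rightarrow> real"
  assumes T: "0 < T" and \<beta>: "0 < \<beta>" and p: "even p" "0 < p" "\<beta> * real p < r" and c: "0 \<le> c"
    and meas: "\<And>t. t \<in> {0..T} \<Longrightarrow> X t \<in> borel_measurable M"
    and cont: "AE \<omega> in M. continuous_on {0..T} (\<lambda>t. X t \<omega>)"
    and moment: "\<And>s t. s \<in> {0..T} \<Longrightarrow> t \<in> {0..T} \<Longrightarrow>
      (\<integral>\<^sup>+ \<omega>. ennreal ((X t \<omega> - X s \<omega>) ^ p) \<partial>M) \<le> ennreal (c * \<bar>t - s\<bar> powr (1 + r))"
  shows "AE \<omega> in M. holder_on \<beta> T (\<lambda>t. X t \<omega>)"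
proof -
  define q where "q = 2 powr (- \<beta>)"
  have q: "0 < q" by (simp add: q_def)
  define Z where "Z n i \<omega> = (X (T * real (Suc i) / 2 ^ n) \<omega> - X (T * real i / 2 ^ n) \<omega>) / q ^ n" for n i \<omega>
  define Y where "Y \<omega> = (\<Sum>n. \<Sum>i<2 ^ n. ennreal (Z n i \<omega> ^ p))" for \<omega>
  have pts: "T * real i / 2 ^ n \<in> {0..T}" if "i \<le> 2 ^ n" for i n
  proof -
    have "real i \<le> real (2 ^ n)" using that by (rule of_nat_mono)
    then have "T * real i \<le> T * 2 ^ n" using T by (intro mult_left_mono) auto
    then show ?thesis using T by (simp add: divide_le_eq)
  qed
  have measX: "X (T * real i / 2 ^ n) \<in> borel_measurable M" if "i \<le> 2 ^ n" for i n
    using meas pts[OF that] by blast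
  have measZ: "Z n i \<in> borel_measurable M" if "i < 2 ^ n" for n i
    unfolding Z_def using that measX[of i n] measX[of "Suc i" n] by simp
  have measZp: "(\<lambda>\<omega>. ennreal (Z n i \<omega> ^ p)) \<in> borel_measurable M" if "i < 2 ^ n" for n i
    using measZ[OF that] by measurable
  have measS: "(\<lambda>\<omega>. \<Sum>i<2 ^ n. ennreal (Z n i \<omega> ^ p)) \<in> borel_measurable M" for n
    by (intro borel_measurable_sum measZp) simp
  have measY: "Y \<in> borel_measurable M"
    unfolding Y_def using measS by measurable
  \<comment> \<open>The ratio of the geometric series that bounds the expectation of \<open>Y\<close> level by
      level.\<close>
  define \<rho> where "\<rho> = 2 powr (\<beta> * real p - r)"
  have \<rho>: "0 < \<rho>" "\<rho> < 1" using p by (auto simp: \<rho>_def powr_less_one)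
  have momZ: "(\<integral>\<^sup>+ \<omega>. ennreal (Z n i \<omega> ^ p) \<partial>M) \<le> ennreal (c * T powr (1 + r) * (\<rho> / 2) ^ n)"
    if "i < 2 ^ n" for n i
  proof -
    have le: "i \<le> 2 ^ n" "Suc i \<le> 2 ^ n" using that by auto
    have d: "\<bar>T * real (Suc i) / 2 ^ n - T * real i / 2 ^ n\<bar> = T / 2 ^ n"
      using T by (simp add: field_simps)
    have "(\<integral>\<^sup>+ \<omega>. ennreal (Z n i \<omega> ^ p) \<partial>M) =
        (\<integral>\<^sup>+ \<omega>. ennreal (1 / (q ^ n) ^ p) * ennreal ((X (T * real (Suc i) / 2 ^ n) \<omega> - X (T * real i / 2 ^ n) \<omega>) ^ p) \<partial>M)"
      using q by (intro nn_integral_cong) (simp add: Z_def power_divide flip: ennreal_mult')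
    also have "\<dots> = ennreal (1 / (q ^ n) ^ p) *
        (\<integral>\<^sup>+ \<omega>. ennreal ((X (T * real (Suc i) / 2 ^ n) \<omega> - X (T * real i / 2 ^ n) \<omega>) ^ p) \<partial>M)"
      by (intro nn_integral_cmult) (use measX[OF le(1)] measX[OF le(2)] in measurable)
    also have "\<dots> \<le> ennreal (1 / (q ^ n) ^ p) * ennreal (c * (T / 2 ^ n) powr (1 + r))"
      using moment[OF pts[OF le(1)] pts[OF le(2)]] unfolding d by (intro mult_left_mono) auto
    also have "\<dots> = ennreal (1 / (q ^ n) ^ p * (c * (T / 2 ^ n) powr (1 + r)))"
      using q c by (intro ennreal_mult[symmetric]) auto
    also have "1 / (q ^ n) ^ p * (c * (T / 2 ^ n) powr (1 + r)) = c * T powr (1 + r) * (\<rho> / 2) ^ n"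
    proof -
      have "(q ^ n) ^ p = 2 powr (- (\<beta> * real p * real n))"
        by (simp add: q_def powr_powr mult_ac flip: powr_realpow power_mult)
      then have "1 / (q ^ n) ^ p = 2 powr (\<beta> * real p * real n)"
        by (simp add: powr_minus_divide)
      moreover have "(T / 2 ^ n) powr (1 + r) = T powr (1 + r) * 2 powr (- (1 + r) * real n)"
      proof -
        have "(2 ^ n) powr (1 + r) = 2 powr (real n * (1 + r))" by (simp add: powr_powr flip: powr_realpow)
        moreover have "- (1 + r) * real n = - (real n * (1 + r))" by (simp add: algebra_simps)
        ultimately show ?thesis using T by (simp only: powr_divide powr_minus_divide) simp
      qed
      moreover have "(\<rho> / 2) ^ n = 2 powr (\<beta> * real p * real n) * 2 powr (- (1 + r) * real n)"
      proof -
        have "\<rho> / 2 = 2 powr (\<beta> * real p - r - 1)" by (simp add: \<rho>_def powr_diff)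
        then have "(\<rho> / 2) ^ n = 2 powr ((\<beta> * real p - r - 1) * real n)"
          by (simp add: powr_powr flip: powr_realpow)
        then show ?thesis by (simp add: algebra_simps flip: powr_add)
      qed
      ultimately show ?thesis by simp
    qed
    finally show ?thesis .
  qed
  have momS: "(\<integral>\<^sup>+ \<omega>. (\<Sum>i<2 ^ n. ennreal (Z n i \<omega> ^ p)) \<partial>M) \<le> ennreal (c * T powr (1 + r) * \<rho> ^ n)" for n
  proof -
    have "(\<integral>\<^sup>+ \<omega>. (\<Sum>i<2 ^ n. ennreal (Z n i \<omega> ^ p)) \<partial>M) = (\<Sum>i<2 ^ n. \<integral>\<^sup>+ \<omega>. ennreal (Z n i \<omega> ^ p) \<partial>M)"
      by (intro nn_integral_sum measZp) simp
    also have "\<dots> \<le> (\<Sum>i<(2::nat) ^ n. ennreal (c * T powr (1 + r) * (\<rho> / 2) ^ n))"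
      by (intro sum_mono momZ) simp
    also have "\<dots> = ennreal (2 ^ n) * ennreal (c * T powr (1 + r) * (\<rho> / 2) ^ n)"
      by (simp add: ennreal_of_nat_eq_real_of_nat)
    also have "\<dots> = ennreal (2 ^ n * (c * T powr (1 + r) * (\<rho> / 2) ^ n))"
      using c \<rho> by (intro ennreal_mult[symmetric]) auto
    also have "2 ^ n * (c * T powr (1 + r) * (\<rho> / 2) ^ n) = c * T powr (1 + r) * \<rho> ^ n"
      by (simp add: power_divide)
    finally show ?thesis .
  qed
  have "(\<integral>\<^sup>+ \<omega>. Y \<omega> \<partial>M) = (\<Sum>n. \<integral>\<^sup>+ \<omega>. (\<Sum>i<2 ^ n. ennreal (Z n i \<omega> ^ p)) \<partial>M)"
    unfolding Y_def by (intro nn_integral_suminf measS)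
  also have "\<dots> \<le> (\<Sum>n. ennreal (c * T powr (1 + r) * \<rho> ^ n))"
    by (intro suminf_le momS) auto
  also have "\<dots> < \<infinity>"
  proof -
    have "summable (\<lambda>n. c * T powr (1 + r) * \<rho> ^ n)"
      using \<rho> by (intro summable_mult summable_geometric) simp
    then have "(\<Sum>n. ennreal (c * T powr (1 + r) * \<rho> ^ n)) = ennreal (\<Sum>n. c * T powr (1 + r) * \<rho> ^ n)"
      using c \<rho> by (intro suminf_ennreal2) auto
    then show ?thesis by simp
  qed
  finally have "AE \<omega> in M. Y \<omega> \<noteq> \<infinity>"
    using nn_integral_PInf_AE[OF measY] by auto
  then show ?thesis
    using cont
  proof eventually_elim
    case (elim \<omega>)
    define C where "C = 1 + enn2real (Y \<omega>)"
    show ?case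
    proof (rule dyadic_increments_imp_holder[OF elim(2) T \<beta>])
      show "0 \<le> C" by (simp add: C_def)
      fix n i :: nat assume i: "i < 2 ^ n"
      have "ennreal (Z n i \<omega> ^ p) \<le> (\<Sum>i<2 ^ n. ennreal (Z n i \<omega> ^ p))"
        using i by (intro member_le_sum) auto
      also have "\<dots> \<le> Y \<omega>"
        unfolding Y_def using sum_le_suminf[of "\<lambda>n. \<Sum>i<2 ^ n. ennreal (Z n i \<omega> ^ p)" "{n}"] by simp
      also have "\<dots> = ennreal (enn2real (Y \<omega>))" using elim(1) by (simp add: ennreal_enn2real_if)
      finally have Zp: "\<bar>Z n i \<omega>\<bar> ^ p \<le> enn2real (Y \<omega>)"
        using p by (simp add: power_even_abs)
      have "\<bar>Z n i \<omega>\<bar> \<le> C"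
      proof (cases "\<bar>Z n i \<omega>\<bar> \<le> 1")
        case True
        then show ?thesis by (simp add: C_def add_increasing2)
      next
        case False
        then have "\<bar>Z n i \<omega>\<bar> ^ 1 \<le> \<bar>Z n i \<omega>\<bar> ^ p" using p by (intro power_increasing) auto
        then show ?thesis using Zp by (simp add: C_def)
      qed
      then show "norm (X (T * real (Suc i) / 2 ^ n) \<omega> - X (T * real i / 2 ^ n) \<omega>) \<le> C * (2 powr - \<beta>) ^ n"
        using q unfolding Z_def q_def[symmetric] by (simp add: abs_divide field_simps)
    qed
  qed
qed

lemma fbm_gaussian:
  assumes "fractional_brownian_motion M H T B" "finite S" "S \<subseteq> {0..T}"
  shows "gaussian_rv M (\<lambda>\<omega>. \<Sum>t\<in>S. a t * B t \<omega> $ l)"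
  using assms(1)[unfolded fractional_brownian_motion_def, THEN conjunct2, THEN conjunct2, THEN conjunct2,
      THEN spec, of l, THEN conjunct1] assms(2,3) by blast

lemma fbm_mean:
  assumes "fractional_brownian_motion M H T B" "t \<in> {0..T}"
  shows "prob_space.expectation M (\<lambda>\<omega>. B t \<omega> $ l) = 0"
  using assms(1)[unfolded fractional_brownian_motion_def, THEN conjunct2, THEN conjunct2, THEN conjunct2,
      THEN spec, of l, THEN conjunct2, THEN conjunct1] assms(2) by (rule bspec)

lemma fbm_covariance:
  assumes "fractional_brownian_motion M H T B" "s \<in> {0..T}" "t \<in> {0..T}"
  shows "prob_space.expectation M (\<lambda>\<omega>. B s \<omega> $ l * B t \<omega> $ l) =
    (s powr (2 * H) + t powr (2 * H) - \<bar>t - s\<bar> powr (2 * H)) / 2"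
  using assms(1)[unfolded fractional_brownian_motion_def, THEN conjunct2, THEN conjunct2, THEN conjunct2,
      THEN spec, of l, THEN conjunct2, THEN conjunct2, THEN bspec, OF assms(2)] assms(3) by (rule bspec)

context prob_space
begin

lemma gaussian_rv_square_integrable:
  assumes "gaussian_rv M X"
  shows "integrable M (\<lambda>\<omega>. (X \<omega>)\<^sup>2)"
proof -
  have X[measurable]: "X \<in> borel_measurable M" using assms by (simp add: gaussian_rv_def)
  consider \<mu> where "AE \<omega> in M. X \<omega> = \<mu>" |
    \<mu> \<sigma> where "0 < \<sigma>" "distributed M lborel X (normal_density \<mu> \<sigma>)"
    using assms unfolding gaussian_rv_def by blast
  then show ?thesis
  proof cases
    case 1
    then have "AE \<omega> in M. (X \<omega>)\<^sup>2 = \<mu>\<^sup>2" by eventually_elim simp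
    then show ?thesis by (subst integrable_cong_AE[where g = "\<lambda>_. \<mu>\<^sup>2"]) auto
  next
    case 2
    have sq: "integrable M (\<lambda>\<omega>. (X \<omega> - \<mu>)\<^sup>2)"
      using distributed_integrable[OF 2(2), of "\<lambda>x. (x - \<mu>)\<^sup>2"] integrable_normal_moment[OF 2(1), of \<mu> 2]
      by simp
    have lin: "integrable M (\<lambda>\<omega>. X \<omega> - \<mu>)" by (rule square_integrable_imp_integrable[OF _ sq]) measurable
    have "integrable M (\<lambda>\<omega>. (X \<omega> - \<mu>)\<^sup>2 + (2 * \<mu>) * (X \<omega> - \<mu>) + \<mu>\<^sup>2)"
      by (intro Bochner_Integration.integrable_add integrable_mult_right sq lin integrable_const)
    also have "(\<lambda>\<omega>. (X \<omega> - \<mu>)\<^sup>2 + (2 * \<mu>) * (X \<omega> - \<mu>) + \<mu>\<^sup>2) = (\<lambda>\<omega>. (X \<omega>)\<^sup>2)"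
      by (rule ext) (simp add: power2_eq_square algebra_simps)
    finally show ?thesis .
  qed
qed

text \<open>The degenerate case of \<^const>\<open>gaussian_rv\<close> is a constant, which vanishes as the
  mean does. So the formula for the even moments of a centred normal variable remains valid as an upper
  bound.\<close>

lemma gaussian_rv_even_moment:
  assumes X: "gaussian_rv M X" and mean: "expectation X = 0" and k: "0 < k"
  shows "(\<integral>\<^sup>+ \<omega>. ennreal (X \<omega> ^ (2 * k)) \<partial>M) \<le>
    ennreal (fact (2 * k) / (2 ^ k * fact k) * expectation (\<lambda>\<omega>. (X \<omega>)\<^sup>2) ^ k)"
proof -
  have [measurable]: "X \<in> borel_measurable M" using X by (simp add: gaussian_rv_def)
  consider \<mu> where "AE \<omega> in M. X \<omega> = \<mu>" |
    \<mu> \<sigma> where "0 < \<sigma>" "distributed M lborel X (normal_density \<mu> \<sigma>)"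
    using X unfolding gaussian_rv_def by blast
  then show ?thesis
  proof cases
    case 1
    then have "expectation X = expectation (\<lambda>_. \<mu>)" by (intro integral_cong_AE) auto
    then have "\<mu> = 0" using mean by (simp add: prob_space)
    then have "AE \<omega> in M. ennreal (X \<omega> ^ (2 * k)) = 0" using 1 k by auto
    then have "(\<integral>\<^sup>+ \<omega>. ennreal (X \<omega> ^ (2 * k)) \<partial>M) = (\<integral>\<^sup>+ \<omega>. 0 \<partial>M)" by (rule nn_integral_cong_AE)
    then show ?thesis by simp
  next
    case 2
    have \<mu>: "\<mu> = 0" using normal_distributed_expectation[OF 2] mean by simp
    have var: "expectation (\<lambda>\<omega>. (X \<omega>)\<^sup>2) = \<sigma>\<^sup>2" using normal_distributed_variance[OF 2] mean by simp
    have m: "has_bochner_integral lborel (\<lambda>x. normal_density 0 \<sigma> x * x ^ (2 * k)) (fact (2 * k) / ((2 / \<sigma>\<^sup>2) ^ k * fact k))"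
      using normal_moment_even[OF 2(1), of 0 k] by simp
    have "(\<integral>\<^sup>+ \<omega>. ennreal (X \<omega> ^ (2 * k)) \<partial>M) = (\<integral>\<^sup>+ x. ennreal (normal_density 0 \<sigma> x) * ennreal (x ^ (2 * k)) \<partial>lborel)"
      using distributed_nn_integral[OF 2(2), of "\<lambda>x. ennreal (x ^ (2 * k))"] \<mu> by simp
    also have "\<dots> = (\<integral>\<^sup>+ x. ennreal (normal_density 0 \<sigma> x * x ^ (2 * k)) \<partial>lborel)"
      using 2(1) by (intro nn_integral_cong) (simp add: ennreal_mult')
    also have "\<dots> = ennreal (fact (2 * k) / ((2 / \<sigma>\<^sup>2) ^ k * fact k))"
      using m by (subst nn_integral_eq_integral) (auto simp: has_bochner_integral_iff zero_le_even_power)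
    also have "fact (2 * k) / ((2 / \<sigma>\<^sup>2) ^ k * fact k) = fact (2 * k) / (2 ^ k * fact k) * (\<sigma>\<^sup>2) ^ k"
      by (simp add: power_divide)
    finally show ?thesis unfolding var by simp
  qed
qed

text \<open>The increment is a centred Gaussian variable with variance
  \<open>\<bar>t - s\<bar>\<^sup>2\<^sup>H\<close>, by the covariance of the process.\<close>

lemma fbm_increment_moment:
  assumes B: "fractional_brownian_motion M H T B" and st: "s \<in> {0..T}" "t \<in> {0..T}" and k: "0 < k"
  shows "(\<integral>\<^sup>+ \<omega>. ennreal ((B t \<omega> $ l - B s \<omega> $ l) ^ (2 * k)) \<partial>M) \<le>
    ennreal (fact (2 * k) / (2 ^ k * fact k) * \<bar>t - s\<bar> powr (2 * H * real k))"
proof (cases "s = t")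
  case True
  then show ?thesis using k by simp
next
  case False
  note gauss = fbm_gaussian[OF B] and mean = fbm_mean[OF B] and cov = fbm_covariance[OF B]
  have one: "gaussian_rv M (\<lambda>\<omega>. B r \<omega> $ l)" if "r \<in> {0..T}" for r
    using gauss[of "{r}" "\<lambda>_. 1" l] that by simp
  have meas[measurable]: "(\<lambda>\<omega>. B r \<omega> $ l) \<in> borel_measurable M" if "r \<in> {0..T}" for r
    using one[OF that] by (simp add: gaussian_rv_def)
  have sq: "integrable M (\<lambda>\<omega>. (B r \<omega> $ l)\<^sup>2)" if "r \<in> {0..T}" for r
    by (rule gaussian_rv_square_integrable[OF one[OF that]])
  have int: "integrable M (\<lambda>\<omega>. B r \<omega> $ l)" if "r \<in> {0..T}" for r
    by (rule square_integrable_imp_integrable[OF meas[OF that] sq[OF that]])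
  have prod: "integrable M (\<lambda>\<omega>. B s \<omega> $ l * B t \<omega> $ l)"
  proof (rule Bochner_Integration.integrable_bound[OF Bochner_Integration.integrable_add[OF sq[OF st(1)] sq[OF st(2)]]])
    show "(\<lambda>\<omega>. B s \<omega> $ l * B t \<omega> $ l) \<in> borel_measurable M"
      using meas[OF st(1)] meas[OF st(2)] by measurable
    have "norm (x * y) \<le> norm (x\<^sup>2 + y\<^sup>2)" for x y :: real
    proof -
      have "2 * (\<bar>x\<bar> * \<bar>y\<bar>) \<le> x\<^sup>2 + y\<^sup>2" using sum_squares_bound[of "\<bar>x\<bar>" "\<bar>y\<bar>"] by simp
      moreover have "0 \<le> \<bar>x\<bar> * \<bar>y\<bar>" by simp
      ultimately show ?thesis unfolding real_norm_def abs_mult by linarith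
    qed
    then show "AE \<omega> in M. norm (B s \<omega> $ l * B t \<omega> $ l) \<le> norm ((B s \<omega> $ l)\<^sup>2 + (B t \<omega> $ l)\<^sup>2)"
      by (intro AE_I2)
  qed
  have "gaussian_rv M (\<lambda>\<omega>. \<Sum>r\<in>{s, t}. (if r = t then 1 else -1) * B r \<omega> $ l)"
    using st by (intro gauss) auto
  then have G: "gaussian_rv M (\<lambda>\<omega>. B t \<omega> $ l - B s \<omega> $ l)"
    using False by simp
  have m0: "expectation (\<lambda>\<omega>. B t \<omega> $ l - B s \<omega> $ l) = 0"
    by (simp add: Bochner_Integration.integral_diff[OF int[OF st(2)] int[OF st(1)]] mean[OF st(1)] mean[OF st(2)])
  have "expectation (\<lambda>\<omega>. (B t \<omega> $ l - B s \<omega> $ l)\<^sup>2) =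
      expectation (\<lambda>\<omega>. (B t \<omega> $ l)\<^sup>2 + (B s \<omega> $ l)\<^sup>2 - 2 * (B s \<omega> $ l * B t \<omega> $ l))"
    by (intro Bochner_Integration.integral_cong) (auto simp: power2_eq_square algebra_simps)
  also have "\<dots> = expectation (\<lambda>\<omega>. (B t \<omega> $ l)\<^sup>2) + expectation (\<lambda>\<omega>. (B s \<omega> $ l)\<^sup>2) -
      2 * expectation (\<lambda>\<omega>. B s \<omega> $ l * B t \<omega> $ l)"
    by (simp add: sq[OF st(1)] sq[OF st(2)] prod)
  also have "\<dots> = \<bar>t - s\<bar> powr (2 * H)"
    using cov[OF st, of l] cov[OF st(1) st(1), of l] cov[OF st(2) st(2), of l]
    by (simp add: power2_eq_square)
  finally have var: "expectation (\<lambda>\<omega>. (B t \<omega> $ l - B s \<omega> $ l)\<^sup>2) = \<bar>t - s\<bar> powr (2 * H)" .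
  have "(\<bar>t - s\<bar> powr (2 * H)) ^ k = \<bar>t - s\<bar> powr (2 * H * real k)"
    using False by (simp add: powr_powr flip: powr_realpow)
  then show ?thesis
    using gaussian_rv_even_moment[OF G m0 k] unfolding var by simp
qed

text \<open>The \<open>2 k\<close>-th moments give Hoelder continuity of every order below
  \<open>H - 1/(2 k)\<close>. A sequence of orders increasing to \<open>H\<close> reduces the statement for
  all orders at once to countably many null sets.\<close>

lemma fbm_holder:
  fixes B :: "real \<Rightarrow> 'a \<Rightarrow> real^'m"
  assumes B: "fractional_brownian_motion M H T B" and T: "0 < T" and H: "0 < H"
  shows "AE \<omega> in M. \<forall>\<beta><H. \<forall>l. holder_on \<beta> T (\<lambda>t. B t \<omega> $ l)"
proof -
  have one: "AE \<omega> in M. holder_on \<beta> T (\<lambda>t. B t \<omega> $ l)" if \<beta>: "0 < \<beta>" "\<beta> < H" for \<beta> l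
  proof -
    obtain k :: nat where k: "1 < real k * (2 * (H - \<beta>))"
      using reals_Archimedean3[of "2 * (H - \<beta>)"] \<beta> by auto
    then have k0: "0 < k" by (cases k) auto
    show ?thesis
    proof (rule kolmogorov_holder[OF T \<beta>(1), where p = "2 * k" and r = "2 * H * real k - 1"
          and c = "fact (2 * k) / (2 ^ k * fact k)"])
      show "even (2 * k)" "0 < 2 * k" "0 \<le> fact (2 * k) / (2 ^ k * fact k :: real)" using k0 by auto
      show "\<beta> * real (2 * k) < 2 * H * real k - 1" using k by (simp add: algebra_simps)
      show "(\<lambda>\<omega>. B t \<omega> $ l) \<in> borel_measurable M" if "t \<in> {0..T}" for t
      proof -
        have "gaussian_rv M (\<lambda>\<omega>. \<Sum>r\<in>{t}. 1 * B r \<omega> $ l)"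
          using that by (intro fbm_gaussian[OF B]) auto
        then show ?thesis by (simp add: gaussian_rv_def)
      qed
      have "AE \<omega> in M. continuous_on {0..T} (\<lambda>t. B t \<omega>)"
        by (rule AE_mp[OF B[unfolded fractional_brownian_motion_def, THEN conjunct2, THEN conjunct1]]) simp
      then show "AE \<omega> in M. continuous_on {0..T} (\<lambda>t. B t \<omega> $ l)"
        by eventually_elim (intro continuous_on_component)
      show "(\<integral>\<^sup>+ \<omega>. ennreal ((B t \<omega> $ l - B s \<omega> $ l) ^ (2 * k)) \<partial>M) \<le>
          ennreal (fact (2 * k) / (2 ^ k * fact k) * \<bar>t - s\<bar> powr (1 + (2 * H * real k - 1)))"
        if "s \<in> {0..T}" "t \<in> {0..T}" for s t
        using fbm_increment_moment[OF B that k0, of l] by simp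
    qed
  qed
  \<comment> \<open>The shift by two keeps all orders positive.\<close>
  define b where "b n = H - H / real (n + 2)" for n :: nat
  have b: "0 < b n" "b n < H" for n using H by (auto simp: b_def field_simps intro!: add_pos_nonneg)
  have "AE \<omega> in M. \<forall>n l. holder_on (b n) T (\<lambda>t. B t \<omega> $ l)"
    unfolding AE_all_countable using one[OF b] by blast
  then show ?thesis
  proof eventually_elim
    case (elim \<omega>)
    show ?case
    proof (intro allI impI)
      fix \<beta> l assume "\<beta> < H"
      then obtain n :: nat where n: "H < real n * (H - \<beta>)"
        using reals_Archimedean3[of "H - \<beta>"] by auto
      also have "\<dots> \<le> real (n + 2) * (H - \<beta>)" using \<open>\<beta> < H\<close> by (intro mult_right_mono) auto
      finally have "\<beta> \<le> b n" by (simp add: b_def field_simps)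
      then show "holder_on \<beta> T (\<lambda>t. B t \<omega> $ l)" using elim holder_on_mono by blast
    qed
  qed
qed

end

section \<open>Coefficients with Lipschitz derivatives\<close>

text \<open>What the pathwise argument uses of a coefficient at a fixed time: the notion
  \<^const>\<open>C1_partials\<close>, with the continuity of the derivatives made quantitative by a single
  constant.\<close>

definition C1_lipschitz ::
    "real \<Rightarrow> ('x::real_normed_vector \<Rightarrow> 'u::real_normed_vector \<Rightarrow> 'a::real_normed_vector) \<Rightarrow>
     ('x \<Rightarrow> 'u \<Rightarrow> 'x \<Rightarrow>\<^sub>L 'a) \<Rightarrow> ('x \<Rightarrow> 'u \<Rightarrow> 'u \<Rightarrow>\<^sub>L 'a) \<Rightarrow> bool" where
  "C1_lipschitz L f fx fu \<longleftrightarrow>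
     (\<forall>x u. ((\<lambda>(x, u). f x u) has_derivative
        (\<lambda>(h, k). blinfun_apply (fx x u) h + blinfun_apply (fu x u) k)) (at (x, u))) \<and>
     (\<forall>x u. norm (fx x u) \<le> L \<and> norm (fu x u) \<le> L) \<and>
     (\<forall>x u y v. norm (fx x u - fx y v) \<le> L * (norm (x - y) + norm (u - v)) \<and>
        norm (fu x u - fu y v) \<le> L * (norm (x - y) + norm (u - v)))"

lemma norm_diff_le_of_derivative_bound:
  fixes \<phi> :: "real \<Rightarrow> 'a::real_normed_vector"
  assumes deriv: "\<And>\<theta>. 0 \<le> \<theta> \<Longrightarrow> \<theta> \<le> 1 \<Longrightarrow> (\<phi> has_vector_derivative \<phi>' \<theta>) (at \<theta>)"
    and bound: "\<And>\<theta>. 0 \<le> \<theta> \<Longrightarrow> \<theta> \<le> 1 \<Longrightarrow> norm (\<phi>' \<theta>) \<le> C"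
  shows "norm (\<phi> 1 - \<phi> 0) \<le> C"
proof -
  have "norm (\<phi> 1 - \<phi> 0) \<le> C * norm (1 - 0 :: real)"
  proof (rule differentiable_bound[where S = "{0..1}"])
    show "(\<phi> has_derivative (\<lambda>h. h *\<^sub>R \<phi>' \<theta>)) (at \<theta> within {0..1})" if "\<theta> \<in> {0..1}" for \<theta>
      using deriv[of \<theta>] that by (auto simp: has_vector_derivative_def intro: has_derivative_at_withinI)
    show "onorm (\<lambda>h. h *\<^sub>R \<phi>' \<theta>) \<le> C" if "\<theta> \<in> {0..1}" for \<theta>
    proof (rule onorm_le)
      fix h :: real
      have "\<bar>h\<bar> * norm (\<phi>' \<theta>) \<le> \<bar>h\<bar> * C" using bound[of \<theta>] that by (intro mult_left_mono) auto
      then show "norm (h *\<^sub>R \<phi>' \<theta>) \<le> C * norm h" by (simp add: mult.commute)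
    qed
  qed auto
  then show ?thesis by simp
qed

lemma has_vector_derivative_along_line:
  assumes f: "\<And>x u. ((\<lambda>(x, u). f x u) has_derivative
      (\<lambda>(h, k). blinfun_apply (fx x u) h + blinfun_apply (fu x u) k)) (at (x, u))"
  shows "((\<lambda>\<theta>. f (x + \<theta> *\<^sub>R h) (u + \<theta> *\<^sub>R k)) has_vector_derivative
      (blinfun_apply (fx (x + \<theta> *\<^sub>R h) (u + \<theta> *\<^sub>R k)) h +
       blinfun_apply (fu (x + \<theta> *\<^sub>R h) (u + \<theta> *\<^sub>R k)) k)) (at \<theta>)"
proof -
  have "((\<lambda>\<theta>. (x + \<theta> *\<^sub>R h, u + \<theta> *\<^sub>R k)) has_derivative (\<lambda>r. (r *\<^sub>R h, r *\<^sub>R k))) (at \<theta>)"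
    by (auto intro!: derivative_eq_intros)
  from has_derivative_compose[OF this f[of "x + \<theta> *\<^sub>R h" "u + \<theta> *\<^sub>R k"]]
  show ?thesis
    by (simp add: has_vector_derivative_def blinfun.scaleR_right scaleR_add_right)
qed

lemma lipschitz_of_partials_bound:
  assumes f: "\<And>x u. ((\<lambda>(x, u). f x u) has_derivative
      (\<lambda>(h, k). blinfun_apply (fx x u) h + blinfun_apply (fu x u) k)) (at (x, u))"
    and bound: "\<And>x u. norm (fx x u) \<le> L" "\<And>x u. norm (fu x u) \<le> L"
  shows "norm (f x u - f y v) \<le> L * (norm (x - y) + norm (u - v))"
proof -
  let ?\<phi> = "\<lambda>\<theta>. f (y + \<theta> *\<^sub>R (x - y)) (v + \<theta> *\<^sub>R (u - v))"
  have "norm (?\<phi> 1 - ?\<phi> 0) \<le> L * (norm (x - y) + norm (u - v))"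
  proof (rule norm_diff_le_of_derivative_bound[OF has_vector_derivative_along_line[OF f]])
    fix \<theta>
    let ?X = "y + \<theta> *\<^sub>R (x - y)" and ?U = "v + \<theta> *\<^sub>R (u - v)"
    have "norm (blinfun_apply (fx ?X ?U) (x - y)) \<le> L * norm (x - y)"
      "norm (blinfun_apply (fu ?X ?U) (u - v)) \<le> L * norm (u - v)"
      using bound by (meson mult_right_mono norm_blinfun norm_ge_zero order_trans)+
    then show "norm (blinfun_apply (fx ?X ?U) (x - y) + blinfun_apply (fu ?X ?U) (u - v))
        \<le> L * (norm (x - y) + norm (u - v))"
      by (intro norm_triangle_le) (simp add: distrib_left)
  qed
  then show ?thesis by simp
qed

lemma C1_lipschitzD:
  assumes "C1_lipschitz L f fx fu"
  shows "((\<lambda>(x, u). f x u) has_derivative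
        (\<lambda>(h, k). blinfun_apply (fx x u) h + blinfun_apply (fu x u) k)) (at (x, u))"
    and "norm (fx x u) \<le> L" and "norm (fu x u) \<le> L"
    and "norm (fx x u - fx y v) \<le> L * (norm (x - y) + norm (u - v))"
    and "norm (fu x u - fu y v) \<le> L * (norm (x - y) + norm (u - v))"
    and "norm (f x u - f y v) \<le> L * (norm (x - y) + norm (u - v))"
  using assms unfolding C1_lipschitz_def by (auto intro!: lipschitz_of_partials_bound[where fx = fx and fu = fu])

lemma C1_lipschitz_mono:
  fixes fx :: "'x::real_normed_vector \<Rightarrow> 'u::real_normed_vector \<Rightarrow> 'x \<Rightarrow>\<^sub>L 'a::real_normed_vector"
  assumes f: "C1_lipschitz L f fx fu" and L: "L \<le> L'"
  shows "C1_lipschitz L' f fx fu"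
  unfolding C1_lipschitz_def
proof (intro conjI allI)
  fix x y :: 'x and u v :: 'u
  have "L * (norm (x - y) + norm (u - v)) \<le> L' * (norm (x - y) + norm (u - v))"
    using L by (intro mult_right_mono) auto
  then show "norm (fx x u - fx y v) \<le> L' * (norm (x - y) + norm (u - v))"
    "norm (fu x u - fu y v) \<le> L' * (norm (x - y) + norm (u - v))"
    using C1_lipschitzD(4,5)[OF f, of x u y v] by linarith+
  show "norm (fx x u) \<le> L'" "norm (fu x u) \<le> L'"
    using C1_lipschitzD(2,3)[OF f, of x u] L by linarith+
qed (rule C1_lipschitzD(1)[OF f])

lemma blinfun_apply_diff_bound:
  assumes "norm (A - A') \<le> C"
  shows "norm (blinfun_apply A h - blinfun_apply A' h) \<le> C * norm h"
  using norm_blinfun[of "A - A'" h] mult_right_mono[OF assms norm_ge_zero[of h]]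
  by (simp add: blinfun.diff_left)

lemma blinfun_apply_bound:
  assumes "norm A \<le> C"
  shows "norm (blinfun_apply A h) \<le> C * norm h"
  using norm_blinfun[of A h] mult_right_mono[OF assms norm_ge_zero[of h]] by simp

text \<open>Subtract the linear part at \<open>(x, u)\<close> along the segment. The derivative of the rest is
  a difference of derivatives of \<open>f\<close> at points at distance at most
  \<open>|h| + |k|\<close>.\<close>

lemma C1_lipschitz_taylor:
  assumes C1: "C1_lipschitz L f fx fu" and L: "L \<ge> 0"
  shows "norm (f (x + h) (u + k) - f x u - blinfun_apply (fx x u) h - blinfun_apply (fu x u) k)
    \<le> L * (norm h + norm k)\<^sup>2"
proof -
  note D = C1_lipschitzD[OF C1]
  let ?d = "blinfun_apply (fx x u) h + blinfun_apply (fu x u) k"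
  let ?\<phi> = "\<lambda>\<theta>. f (x + \<theta> *\<^sub>R h) (u + \<theta> *\<^sub>R k) - \<theta> *\<^sub>R ?d"
  have "norm (?\<phi> 1 - ?\<phi> 0) \<le> L * (norm h + norm k)\<^sup>2"
  proof (rule norm_diff_le_of_derivative_bound)
    fix \<theta> :: real assume \<theta>: "0 \<le> \<theta>" "\<theta> \<le> 1"
    let ?X = "x + \<theta> *\<^sub>R h" and ?U = "u + \<theta> *\<^sub>R k"
    let ?d' = "blinfun_apply (fx ?X ?U) h + blinfun_apply (fu ?X ?U) k - ?d"
    show "(?\<phi> has_vector_derivative ?d') (at \<theta>)"
      by (intro has_vector_derivative_diff has_vector_derivative_along_line[OF D(1)])
        (auto intro!: derivative_eq_intros)
    have le: "L * (norm (?X - x) + norm (?U - u)) \<le> L * (norm h + norm k)"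
    proof (intro mult_left_mono add_mono L)
      show "norm (?X - x) \<le> norm h" "norm (?U - u) \<le> norm k"
        using \<theta> by (simp_all add: mult_left_le_one_le)
    qed
    have "norm (fx ?X ?U - fx x u) \<le> L * (norm h + norm k)"
      "norm (fu ?X ?U - fu x u) \<le> L * (norm h + norm k)"
      by (rule order_trans[OF D(4) le] order_trans[OF D(5) le])+
    then have "norm (blinfun_apply (fx ?X ?U) h - blinfun_apply (fx x u) h) \<le> L * (norm h + norm k) * norm h"
      "norm (blinfun_apply (fu ?X ?U) k - blinfun_apply (fu x u) k) \<le> L * (norm h + norm k) * norm k"
      by (auto intro: blinfun_apply_diff_bound)
    moreover have "?d' = (blinfun_apply (fx ?X ?U) h - blinfun_apply (fx x u) h) +
        (blinfun_apply (fu ?X ?U) k - blinfun_apply (fu x u) k)" by simp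
    ultimately have "norm ?d' \<le> L * (norm h + norm k) * norm h + L * (norm h + norm k) * norm k"
      by (metis add_mono norm_triangle_le)
    also have "\<dots> = L * (norm h + norm k)\<^sup>2" by (simp add: power2_eq_square algebra_simps)
    finally show "norm ?d' \<le> L * (norm h + norm k)\<^sup>2" .
  qed
  then show ?thesis by (simp add: algebra_simps)
qed

lemma norm_segment_le:
  fixes a b :: "'a::real_normed_vector"
  assumes "0 \<le> \<theta>" "\<theta> \<le> 1"
  shows "norm (b + \<theta> *\<^sub>R (a - b)) \<le> norm a + norm b"
proof -
  have "b + \<theta> *\<^sub>R (a - b) = \<theta> *\<^sub>R a + (1 - \<theta>) *\<^sub>R b" by (simp add: algebra_simps)
  also have "norm \<dots> \<le> \<theta> * norm a + (1 - \<theta>) * norm b"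
    using assms by (intro order_trans[OF norm_triangle_ineq]) simp
  also have "\<dots> \<le> 1 * norm a + 1 * norm b"
    using assms by (intro add_mono mult_right_mono) auto
  finally show ?thesis by simp
qed

text \<open>Mean value argument for the difference of \<open>f\<close> along the segment from
  \<open>(x2, u2)\<close> to \<open>(x1, u1)\<close> and \<open>g\<close> along the segment from
  \<open>(y2, v2)\<close> to \<open>(y1, v1)\<close>. Its derivative splits into \<open>f'\<close> applied to
  the difference of the directions and \<open>f' - g'\<close> applied to the second direction. The functions
  \<open>f\<close> and \<open>g\<close> are to be a coefficient at two different times.\<close>

lemma C1_lipschitz_four_point:
  assumes f: "C1_lipschitz L f fx fu" and g: "C1_lipschitz L g gx gu" and L: "L \<ge> 0"
    and E: "\<And>x u. norm (fx x u - gx x u) \<le> E" "\<And>x u. norm (fu x u - gu x u) \<le> E"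
  shows "norm ((f x1 u1 - f x2 u2) - (g y1 v1 - g y2 v2)) \<le>
    L * (norm ((x1 - x2) - (y1 - y2)) + norm ((u1 - u2) - (v1 - v2))) +
    (E + L * (norm (x1 - y1) + norm (x2 - y2) + norm (u1 - v1) + norm (u2 - v2))) *
      (norm (y1 - y2) + norm (v1 - v2))"
proof -
  note F = C1_lipschitzD[OF f] and G = C1_lipschitzD[OF g]
  let ?\<phi> = "\<lambda>\<theta>. f (x2 + \<theta> *\<^sub>R (x1 - x2)) (u2 + \<theta> *\<^sub>R (u1 - u2)) - g (y2 + \<theta> *\<^sub>R (y1 - y2)) (v2 + \<theta> *\<^sub>R (v1 - v2))"
  let ?N = "E + L * (norm (x1 - y1) + norm (x2 - y2) + norm (u1 - v1) + norm (u2 - v2))"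
  have "norm (?\<phi> 1 - ?\<phi> 0) \<le> L * (norm ((x1 - x2) - (y1 - y2)) + norm ((u1 - u2) - (v1 - v2))) +
      ?N * (norm (y1 - y2) + norm (v1 - v2))"
  proof (rule norm_diff_le_of_derivative_bound)
    fix \<theta> :: real assume \<theta>: "0 \<le> \<theta>" "\<theta> \<le> 1"
    define X where "X = x2 + \<theta> *\<^sub>R (x1 - x2)"
    define U where "U = u2 + \<theta> *\<^sub>R (u1 - u2)"
    define Y where "Y = y2 + \<theta> *\<^sub>R (y1 - y2)"
    define V where "V = v2 + \<theta> *\<^sub>R (v1 - v2)"
    let ?d = "(blinfun_apply (fx X U) (x1 - x2) + blinfun_apply (fu X U) (u1 - u2)) -
        (blinfun_apply (gx Y V) (y1 - y2) + blinfun_apply (gu Y V) (v1 - v2))"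
    show "(?\<phi> has_vector_derivative ?d) (at \<theta>)"
      unfolding X_def U_def Y_def V_def
      by (intro has_vector_derivative_diff has_vector_derivative_along_line[OF F(1)]
          has_vector_derivative_along_line[OF G(1)])
    have XY: "X - Y = (x2 - y2) + \<theta> *\<^sub>R ((x1 - y1) - (x2 - y2))"
      and UV: "U - V = (u2 - v2) + \<theta> *\<^sub>R ((u1 - v1) - (u2 - v2))"
      by (simp_all add: X_def Y_def U_def V_def algebra_simps)
    have "norm (X - Y) \<le> norm (x1 - y1) + norm (x2 - y2)" "norm (U - V) \<le> norm (u1 - v1) + norm (u2 - v2)"
      unfolding XY UV by (rule norm_segment_le[OF \<theta>])+
    then have le: "L * (norm (X - Y) + norm (U - V)) + E \<le> ?N"
      using L by (simp add: mult_left_mono)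
    have "norm (fx X U - gx Y V) \<le> norm (fx X U - fx Y V) + norm (fx Y V - gx Y V)"
      by (metis diff_add_cancel add_diff_eq norm_triangle_ineq)
    then have Nx: "norm (fx X U - gx Y V) \<le> ?N"
      using F(4)[of X U Y V] E(1)[of Y V] le by linarith
    have "norm (fu X U - gu Y V) \<le> norm (fu X U - fu Y V) + norm (fu Y V - gu Y V)"
      by (metis diff_add_cancel add_diff_eq norm_triangle_ineq)
    then have Nu: "norm (fu X U - gu Y V) \<le> ?N"
      using F(5)[of X U Y V] E(2)[of Y V] le by linarith
    have "?d = (blinfun_apply (fx X U) ((x1 - x2) - (y1 - y2)) + blinfun_apply (fu X U) ((u1 - u2) - (v1 - v2))) +
        ((blinfun_apply (fx X U) (y1 - y2) - blinfun_apply (gx Y V) (y1 - y2)) +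
         (blinfun_apply (fu X U) (v1 - v2) - blinfun_apply (gu Y V) (v1 - v2)))"
      by (simp add: blinfun.diff_right)
    also have "norm \<dots> \<le> (L * norm ((x1 - x2) - (y1 - y2)) + L * norm ((u1 - u2) - (v1 - v2))) +
        (?N * norm (y1 - y2) + ?N * norm (v1 - v2))"
      by (intro norm_triangle_mono blinfun_apply_bound blinfun_apply_diff_bound Nx Nu F(2) F(3))
    finally show "norm ?d \<le> L * (norm ((x1 - x2) - (y1 - y2)) + norm ((u1 - u2) - (v1 - v2))) +
      ?N * (norm (y1 - y2) + norm (v1 - v2))" by (simp only: distrib_left)
  qed
  then show ?thesis by (simp add: algebra_simps)
qed

lemma norm_has_vector_derivative_le:
  fixes \<psi> :: "real \<Rightarrow> 'a::real_normed_vector"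
  assumes \<psi>: "(\<psi> has_vector_derivative d) (at 0)"
    and bound: "\<And>h. norm (\<psi> h - \<psi> 0) \<le> C * \<bar>h\<bar>"
  shows "norm d \<le> C"
proof -
  have "((\<lambda>h. norm (\<psi> (0 + h) - \<psi> 0 - h *\<^sub>R d) / norm h) \<longlongrightarrow> 0) (at 0)"
    using \<psi> unfolding has_vector_derivative_def has_derivative_at by blast
  then have lim: "((\<lambda>h. C + norm (\<psi> (0 + h) - \<psi> 0 - h *\<^sub>R d) / norm h) \<longlongrightarrow> C + 0) (at 0)"
    by (intro tendsto_add tendsto_const)
  have "norm d \<le> C + norm (\<psi> (0 + h) - \<psi> 0 - h *\<^sub>R d) / norm h" if "h \<noteq> 0" for h
  proof -
    have "\<bar>h\<bar> * norm d = norm (h *\<^sub>R d)" by simp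
    also have "\<dots> \<le> norm (\<psi> h - \<psi> 0) + norm (\<psi> h - \<psi> 0 - h *\<^sub>R d)"
      by (metis add.commute norm_minus_commute norm_triangle_sub)
    also have "\<dots> \<le> C * \<bar>h\<bar> + norm (\<psi> h - \<psi> 0 - h *\<^sub>R d)" using bound by simp
    finally show ?thesis using that by (simp add: field_simps)
  qed
  then have "\<forall>\<^sub>F h in at 0. norm d \<le> C + norm (\<psi> (0 + h) - \<psi> 0 - h *\<^sub>R d) / norm h"
    by (simp add: eventually_at_filter)
  from tendsto_lowerbound[OF lim this] show ?thesis by simp
qed

text \<open>This replaces the symmetry of second derivatives, which would give \<open>fux\<close> the bound of
  \<open>fxu\<close>. For fixed \<open>k\<close>, the mixed second difference of \<open>f\<close> with steps
  \<open>x - y\<close> and \<open>h k\<close> is at most \<open>L |x - y| |h k|\<close>, by the mean value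
  theorem in \<open>x\<close>. Dividing by \<open>h\<close> and letting \<open>h\<close> tend to zero turns it
  into the increment of \<open>fu\<close> in direction \<open>k\<close>.\<close>

lemma partial_lipschitz_by_symmetry:
  assumes f: "\<And>x u. ((\<lambda>(x, u). f x u) has_derivative
      (\<lambda>(h, k). blinfun_apply (fx x u) h + blinfun_apply (fu x u) k)) (at (x, u))"
    and fx: "\<And>x u v. norm (fx x u - fx x v) \<le> L * norm (u - v)" and L: "L \<ge> 0"
  shows "norm (fu x u - fu y u) \<le> L * norm (x - y)"
proof (rule norm_blinfun_bound)
  show "0 \<le> L * norm (x - y)" using L by simp
  fix k
  let ?\<psi> = "\<lambda>h. f (x + h *\<^sub>R 0) (u + h *\<^sub>R k) - f (y + h *\<^sub>R 0) (u + h *\<^sub>R k)"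
  show "norm (blinfun_apply (fu x u - fu y u) k) \<le> L * norm (x - y) * norm k"
  proof (rule norm_has_vector_derivative_le)
    show "(?\<psi> has_vector_derivative blinfun_apply (fu x u - fu y u) k) (at 0)"
      using has_vector_derivative_diff[OF has_vector_derivative_along_line[OF f, of x 0 u k 0]
          has_vector_derivative_along_line[OF f, of y 0 u k 0]]
      by (simp add: blinfun.diff_left)
    fix h :: real
    let ?\<phi> = "\<lambda>\<theta>. f (y + \<theta> *\<^sub>R (x - y)) (u + h *\<^sub>R k + \<theta> *\<^sub>R 0) - f (y + \<theta> *\<^sub>R (x - y)) (u + \<theta> *\<^sub>R 0)"
    have "norm (?\<phi> 1 - ?\<phi> 0) \<le> L * norm (h *\<^sub>R k) * norm (x - y)"
    proof (rule norm_diff_le_of_derivative_bound[OF has_vector_derivative_diff[OF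
            has_vector_derivative_along_line[OF f] has_vector_derivative_along_line[OF f]]])
      fix \<theta>
      have "norm (fx (y + \<theta> *\<^sub>R (x - y)) (u + h *\<^sub>R k) - fx (y + \<theta> *\<^sub>R (x - y)) u) \<le> L * norm (h *\<^sub>R k)"
        using fx[of "y + \<theta> *\<^sub>R (x - y)" "u + h *\<^sub>R k" u] by simp
      from blinfun_apply_diff_bound[OF this, of "x - y"]
      show "norm (blinfun_apply (fx (y + \<theta> *\<^sub>R (x - y)) (u + h *\<^sub>R k + \<theta> *\<^sub>R 0)) (x - y) +
          blinfun_apply (fu (y + \<theta> *\<^sub>R (x - y)) (u + h *\<^sub>R k + \<theta> *\<^sub>R 0)) 0 -
         (blinfun_apply (fx (y + \<theta> *\<^sub>R (x - y)) (u + \<theta> *\<^sub>R 0)) (x - y) +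
          blinfun_apply (fu (y + \<theta> *\<^sub>R (x - y)) (u + \<theta> *\<^sub>R 0)) 0)) \<le> L * norm (h *\<^sub>R k) * norm (x - y)"
        by simp
    qed
    then show "norm (?\<psi> h - ?\<psi> 0) \<le> L * norm (x - y) * norm k * \<bar>h\<bar>"
      by (simp add: algebra_simps)
  qed
qed

lemma norm_column_le:
  fixes A :: "real^'m^'n"
  shows "norm (column j A) \<le> norm A"
  unfolding norm_vec_def[of "column j A"] norm_vec_def[of A]
  by (rule L2_set_mono) (use component_le_norm_cart in \<open>auto simp: column_def\<close>)

lemma column_diff: "column j (A - B) = column j A - column j (B :: real^'m^'n)"
  by (simp add: column_def vec_eq_iff)

lemma column_scaleR: "column j (c *\<^sub>R A) = c *\<^sub>R column j (A :: real^'m^'n)"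
  by (simp add: column_def vec_eq_iff)

lemma holder_bound_apply:
  fixes A :: "real \<Rightarrow> 'a::real_normed_vector \<Rightarrow>\<^sub>L 'b::real_normed_vector"
  assumes A: "holder_bound T a C A" "\<And>t. 0 \<le> t \<Longrightarrow> t \<le> T \<Longrightarrow> norm (A t) \<le> K"
    and x: "holder_bound T a D x" "\<And>t. 0 \<le> t \<Longrightarrow> t \<le> T \<Longrightarrow> norm (x t) \<le> S"
    and nn: "0 \<le> C" "0 \<le> K"
  shows "holder_bound T a (K * D + C * S) (\<lambda>t. blinfun_apply (A t) (x t))"
proof (rule holder_boundI)
  fix s t assume st: "0 \<le> s" "s \<le> t" "t \<le> T"
  have "norm (blinfun_apply (A t) (x t) - blinfun_apply (A s) (x s)) =
      norm (blinfun_apply (A t) (x t - x s) + (blinfun_apply (A t) (x s) - blinfun_apply (A s) (x s)))"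
    by (simp add: blinfun.diff_right)
  also have "\<dots> \<le> K * norm (x t - x s) + (C * (t - s) powr a) * norm (x s)"
    using st by (intro norm_triangle_mono blinfun_apply_bound blinfun_apply_diff_bound A(2) holder_boundD[OF A(1)]) auto
  also have "\<dots> \<le> K * (D * (t - s) powr a) + (C * (t - s) powr a) * S"
    using st nn by (intro add_mono mult_left_mono x(2) holder_boundD[OF x(1)]) auto
  finally show "norm (blinfun_apply (A t) (x t) - blinfun_apply (A s) (x s)) \<le> (K * D + C * S) * (t - s) powr a"
    by (simp add: algebra_simps)
qed

lemma C1_partialsD:
  assumes "C1_partials f fx fu"
  shows "((\<lambda>(x, u). f x u) has_derivative
    (\<lambda>(h, k). blinfun_apply (fx x u) h + blinfun_apply (fu x u) k)) (at (x, u))"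
  using assms by (simp add: C1_partials_def)

lemma continuous_on_at_origin_bounded:
  fixes f :: "real \<Rightarrow> 'a::real_normed_vector \<Rightarrow> 'b::real_normed_vector \<Rightarrow> 'c::real_normed_vector"
  assumes "continuous_on ({0..T} \<times> UNIV \<times> UNIV) (\<lambda>(t, x, u). f t x u)"
  shows "\<exists>C\<ge>0. \<forall>t\<in>{0..T}. norm (f t 0 0) \<le> C"
proof -
  have "continuous_on {0..T} ((\<lambda>(t, x, u). f t x u) \<circ> (\<lambda>t. (t, 0, 0)))"
  proof (rule continuous_on_compose)
    show "continuous_on {0..T} (\<lambda>t. (t, 0 :: 'a, 0 :: 'b))" by (intro continuous_intros)
    show "continuous_on ((\<lambda>t. (t, 0, 0)) ` {0..T}) (\<lambda>(t, x, u). f t x u)"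
      by (rule continuous_on_subset[OF assms]) auto
  qed
  then have "continuous_on {0..T} (\<lambda>t. norm (f t 0 0))" by (intro continuous_on_norm) (simp add: o_def)
  then have "bounded ((\<lambda>t. norm (f t 0 0)) ` {0..T})"
    by (intro compact_imp_bounded compact_continuous_image) auto
  then obtain C where C: "C > 0" "\<forall>y\<in>(\<lambda>t. norm (f t 0 0)) ` {0..T}. norm y \<le> C" by (auto simp: bounded_pos)
  then show ?thesis by (intro exI[of _ C]) auto
qed

lemma drift_assumptions_imp_C1_lipschitz:
  fixes b :: "real \<Rightarrow> real^'n \<Rightarrow> real^'d \<Rightarrow> real^'n"
  assumes T: "0 < T" and b: "drift_assumptions T b bx bu"
  shows "\<exists>L\<ge>0. \<forall>t\<in>{0..T}. C1_lipschitz L (b t) (bx t) (bu t) \<and> norm (b t 0 0) \<le> L"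
proof -
  obtain L where L: "\<And>t x u. t \<in> {0..T} \<Longrightarrow> norm (bx t x u) + norm (bu t x u) \<le> L"
    "\<And>t x u y v. t \<in> {0..T} \<Longrightarrow> norm (bx t x u - bx t y v) + norm (bu t x u - bu t y v) \<le> L * (norm (x - y) + norm (u - v))"
    using b unfolding drift_assumptions_def by blast
  have C1: "C1_lipschitz L (b t) (bx t) (bu t)" if t: "t \<in> {0..T}" for t
  proof -
    have "C1_partials (b t) (bx t) (bu t)" using b t unfolding drift_assumptions_def by blast
    from C1_partialsD[OF this] show ?thesis
      unfolding C1_lipschitz_def
    proof (intro conjI allI)
      fix x y :: "real^'n" and u v :: "real^'d"
      show "norm (bx t x u) \<le> L" "norm (bu t x u) \<le> L"
        using L(1)[OF t, of x u] norm_ge_zero[of "bx t x u"] norm_ge_zero[of "bu t x u"] by linarith+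
      show "norm (bx t x u - bx t y v) \<le> L * (norm (x - y) + norm (u - v))"
        "norm (bu t x u - bu t y v) \<le> L * (norm (x - y) + norm (u - v))"
        using L(2)[OF t, of x u y v] norm_ge_zero[of "bx t x u - bx t y v"] norm_ge_zero[of "bu t x u - bu t y v"]
        by linarith+
    qed
  qed
  obtain C where C: "C \<ge> 0" "\<And>t. t \<in> {0..T} \<Longrightarrow> norm (b t 0 0) \<le> C"
    using continuous_on_at_origin_bounded[OF b[unfolded drift_assumptions_def, THEN conjunct1]] by blast
  show ?thesis
  proof (intro exI[of _ "max L C"] conjI ballI)
    show "0 \<le> max L C" using C by simp
    fix t assume t: "t \<in> {0..T}"
    show "C1_lipschitz (max L C) (b t) (bx t) (bu t)" by (rule C1_lipschitz_mono[OF C1[OF t]]) simp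
    show "norm (b t 0 0) \<le> max L C" using C(2)[OF t] by simp
  qed
qed

text \<open>The derivative of \<open>\<sigma>u\<close> in \<open>x\<close> occurs in the assumptions without a
  bound. The Lipschitz continuity of \<open>\<sigma>u\<close> in \<open>x\<close> is obtained from that of
  \<open>\<sigma>x\<close> in \<open>u\<close> by \<open>partial_lipschitz_by_symmetry\<close>.\<close>

lemma diffusion_assumptions_imp_C1_lipschitz:
  fixes \<sigma> :: "real \<Rightarrow> real^'n \<Rightarrow> real^'d \<Rightarrow> real^'m^'n"
  assumes T: "0 < T" and \<sigma>: "diffusion_assumptions T H \<sigma> \<sigma>x \<sigma>u \<sigma>xx \<sigma>xu \<sigma>uu"
  shows "\<exists>\<gamma> L. 1 - H < \<gamma> \<and> 0 \<le> L \<and>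
    (\<forall>t\<in>{0..T}. C1_lipschitz L (\<sigma> t) (\<sigma>x t) (\<sigma>u t) \<and> norm (\<sigma> t 0 0) \<le> L) \<and>
    (\<forall>s\<in>{0..T}. \<forall>t\<in>{0..T}. \<forall>x u. norm (\<sigma> t x u - \<sigma> s x u) \<le> L * \<bar>t - s\<bar> powr \<gamma> \<and>
       norm (\<sigma>x t x u - \<sigma>x s x u) \<le> L * \<bar>t - s\<bar> powr \<gamma> \<and> norm (\<sigma>u t x u - \<sigma>u s x u) \<le> L * \<bar>t - s\<bar> powr \<gamma>)"
proof -
  have partials: "C1_partials (\<sigma> t) (\<sigma>x t) (\<sigma>u t)" "C1_partials (\<sigma>x t) (\<sigma>xx t) (\<sigma>xu t)"
    "\<exists>\<sigma>ux. C1_partials (\<sigma>u t) \<sigma>ux (\<sigma>uu t)" if "t \<in> {0..T}" for t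
    using \<sigma> that unfolding diffusion_assumptions_def by blast+
  obtain \<gamma> L where \<gamma>: "1 - H < \<gamma>"
    and first: "\<And>t x u. t \<in> {0..T} \<Longrightarrow> norm (\<sigma>x t x u) + norm (\<sigma>u t x u) \<le> L"
    and second: "\<And>t x u. t \<in> {0..T} \<Longrightarrow> norm (\<sigma>xx t x u) + norm (\<sigma>uu t x u) + norm (\<sigma>xu t x u) \<le> L"
    and time: "\<And>t s x u. t \<in> {0..T} \<Longrightarrow> s \<in> {0..T} \<Longrightarrow>
           norm (\<sigma> t x u - \<sigma> s x u) + norm (\<sigma>x t x u - \<sigma>x s x u) +
           norm (\<sigma>u t x u - \<sigma>u s x u) + norm (\<sigma>xx t x u - \<sigma>xx s x u) +
           norm (\<sigma>xu t x u - \<sigma>xu s x u) + norm (\<sigma>uu t x u - \<sigma>uu s x u) \<le> L * \<bar>t - s\<bar> powr \<gamma>"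
    using \<sigma> unfolding diffusion_assumptions_def by (elim conjE exE) (rule that; blast)
  have bounds: "norm (\<sigma>x t x u) \<le> L" "norm (\<sigma>u t x u) \<le> L" "norm (\<sigma>xx t x u) \<le> L" "norm (\<sigma>xu t x u) \<le> L"
    "norm (\<sigma>uu t x u) \<le> L" if "t \<in> {0..T}" for t x u
    using first[OF that, of x u] second[OF that, of x u] norm_ge_zero[of "\<sigma>x t x u"] norm_ge_zero[of "\<sigma>u t x u"]
      norm_ge_zero[of "\<sigma>xx t x u"] norm_ge_zero[of "\<sigma>xu t x u"] norm_ge_zero[of "\<sigma>uu t x u"] by linarith+
  have "0 \<le> norm (\<sigma>x 0 0 0)" by simp
  also have "\<dots> \<le> L" using bounds(1) T by simp
  finally have L: "0 \<le> L" .
  have C1: "C1_lipschitz L (\<sigma> t) (\<sigma>x t) (\<sigma>u t)" if t: "t \<in> {0..T}" for t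
    unfolding C1_lipschitz_def
  proof (intro conjI allI)
    note f = C1_partialsD[OF partials(1)[OF t]]
    show "((\<lambda>(x, u). \<sigma> t x u) has_derivative
        (\<lambda>(h, k). blinfun_apply (\<sigma>x t x u) h + blinfun_apply (\<sigma>u t x u) k)) (at (x, u))" for x u
      by (rule f)
    fix x y :: "real^'n" and u v :: "real^'d"
    show "norm (\<sigma>x t x u) \<le> L" "norm (\<sigma>u t x u) \<le> L" using bounds[OF t] by auto
    have x_lip: "norm (\<sigma>x t x u - \<sigma>x t y v) \<le> L * (norm (x - y) + norm (u - v))" for x y u v
      by (rule lipschitz_of_partials_bound[OF C1_partialsD[OF partials(2)[OF t]] bounds(3)[OF t] bounds(4)[OF t]])
    then show "norm (\<sigma>x t x u - \<sigma>x t y v) \<le> L * (norm (x - y) + norm (u - v))" .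
    have "norm (\<sigma>x t x u - \<sigma>x t x v) \<le> L * norm (u - v)" for x u v using x_lip[of x u x v] by simp
    then have 1: "norm (\<sigma>u t x u - \<sigma>u t y u) \<le> L * norm (x - y)"
      by (rule partial_lipschitz_by_symmetry[OF f _ L])
    obtain \<sigma>ux where ux: "C1_partials (\<sigma>u t) \<sigma>ux (\<sigma>uu t)" using partials(3)[OF t] by blast
    have 2: "norm (\<sigma>u t y u - \<sigma>u t y v) \<le> L * norm (u - v)"
    proof -
      let ?\<phi> = "\<lambda>\<theta>. \<sigma>u t (y + \<theta> *\<^sub>R 0) (v + \<theta> *\<^sub>R (u - v))"
      have "norm (?\<phi> 1 - ?\<phi> 0) \<le> L * norm (u - v)"
        by (rule norm_diff_le_of_derivative_bound[OF has_vector_derivative_along_line[OF C1_partialsD[OF ux]]])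
          (simp add: blinfun_apply_bound[OF bounds(5)[OF t]])
      then show ?thesis by simp
    qed
    have "norm (\<sigma>u t x u - \<sigma>u t y v) \<le> norm (\<sigma>u t x u - \<sigma>u t y u) + norm (\<sigma>u t y u - \<sigma>u t y v)"
      by (rule norm_diff_triangle_via)
    then show "norm (\<sigma>u t x u - \<sigma>u t y v) \<le> L * (norm (x - y) + norm (u - v))"
      using 1 2 by (simp add: distrib_left)
  qed
  obtain C where C: "C \<ge> 0" "\<And>t. t \<in> {0..T} \<Longrightarrow> norm (\<sigma> t 0 0) \<le> C"
    using continuous_on_at_origin_bounded[OF \<sigma>[unfolded diffusion_assumptions_def, THEN conjunct1]] by blast
  show ?thesis
  proof (rule exI[of _ \<gamma>], rule exI[of _ "max L C"], intro conjI ballI allI \<gamma>)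
    show "0 \<le> max L C" using C by simp
    show "C1_lipschitz (max L C) (\<sigma> t) (\<sigma>x t) (\<sigma>u t)" if "t \<in> {0..T}" for t
      by (rule C1_lipschitz_mono[OF C1[OF that]]) simp
    show "norm (\<sigma> t 0 0) \<le> max L C" if "t \<in> {0..T}" for t using C(2)[OF that] by simp
    fix s t x u assume st: "s \<in> {0..T}" "t \<in> {0..T}"
    have "L * \<bar>t - s\<bar> powr \<gamma> \<le> max L C * \<bar>t - s\<bar> powr \<gamma>" by (intro mult_right_mono) auto
    then show "norm (\<sigma> t x u - \<sigma> s x u) \<le> max L C * \<bar>t - s\<bar> powr \<gamma>"
      "norm (\<sigma>x t x u - \<sigma>x s x u) \<le> max L C * \<bar>t - s\<bar> powr \<gamma>"
      "norm (\<sigma>u t x u - \<sigma>u s x u) \<le> max L C * \<bar>t - s\<bar> powr \<gamma>"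
      using time[OF st(2,1), of x u] norm_ge_zero[of "\<sigma> t x u - \<sigma> s x u"] norm_ge_zero[of "\<sigma>x t x u - \<sigma>x s x u"]
        norm_ge_zero[of "\<sigma>u t x u - \<sigma>u s x u"] norm_ge_zero[of "\<sigma>xx t x u - \<sigma>xx s x u"]
        norm_ge_zero[of "\<sigma>xu t x u - \<sigma>xu s x u"] norm_ge_zero[of "\<sigma>uu t x u - \<sigma>uu s x u"] by linarith+
  qed
qed

section \<open>The controlled equation along one driving path\<close>

lemma solves_path_equationD:
  assumes "solves_path_equation H T B x0 f g x"
  shows "\<exists>\<beta>>1 - H. holder_on \<beta> T x"
    and "young_equation T (\<lambda>j t. B t $ j) x0 f (\<lambda>j t. column j (g t)) x"
proof -
  show "\<exists>\<beta>>1 - H. holder_on \<beta> T x" using assms by (simp add: solves_path_equation_def)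
  show "young_equation T (\<lambda>j t. B t $ j) x0 f (\<lambda>j t. column j (g t)) x"
    unfolding young_equation_def
  proof
    fix t assume t: "t \<in> {0..T}"
    have f: "f integrable_on {0..t}"
      and g: "\<And>j. RS_integrable (\<lambda>s. column j (g s)) (\<lambda>s. B s $ j) 0 t"
      and x: "x t = x0 + integral {0..t} f + (\<Sum>j\<in>UNIV. RS_integral (\<lambda>s. column j (g s)) (\<lambda>s. B s $ j) 0 t)"
      using assms t unfolding solves_path_equation_def by blast+
    have "has_RS_integral (\<lambda>s. column j (g s)) (\<lambda>s. B s $ j)
        (RS_integral (\<lambda>s. column j (g s)) (\<lambda>s. B s $ j) 0 t) 0 t" for j
      using g[of j] unfolding RS_integrable_def RS_integral_def by (rule someI_ex)
    then show "\<exists>J I. (f has_integral J) {0..t} \<and>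
        (\<forall>j. has_RS_integral (\<lambda>t. column j (g t)) (\<lambda>t. B t $ j) (I j) 0 t) \<and>
        x t = x0 + J + (\<Sum>j\<in>UNIV. I j)"
      using f x by (intro exI[of _ "integral {0..t} f"] exI[of _ "\<lambda>j. RS_integral (\<lambda>s. column j (g s)) (\<lambda>s. B s $ j) 0 t"])
        (simp add: integrable_integral)
  qed
qed

text \<open>The data of the controlled equation along one path \<open>w\<close>, with a common constant
  \<open>L\<close> for all bounds on the coefficients.\<close>

locale controlled_system =
  fixes T H \<gamma> L :: real and w :: "real \<Rightarrow> real^'m"
    and b :: "real \<Rightarrow> real^'n \<Rightarrow> real^'d \<Rightarrow> real^'n"
    and bx :: "real \<Rightarrow> real^'n \<Rightarrow> real^'d \<Rightarrow> (real^'n) \<Rightarrow>\<^sub>L (real^'n)"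
    and bu :: "real \<Rightarrow> real^'n \<Rightarrow> real^'d \<Rightarrow> (real^'d) \<Rightarrow>\<^sub>L (real^'n)"
    and \<sigma> :: "real \<Rightarrow> real^'n \<Rightarrow> real^'d \<Rightarrow> real^'m^'n"
    and \<sigma>x :: "real \<Rightarrow> real^'n \<Rightarrow> real^'d \<Rightarrow> (real^'n) \<Rightarrow>\<^sub>L (real^'m^'n)"
    and \<sigma>u :: "real \<Rightarrow> real^'n \<Rightarrow> real^'d \<Rightarrow> (real^'d) \<Rightarrow>\<^sub>L (real^'m^'n)"
  assumes T: "0 < T" and H: "1 / 2 < H" "H < 1" and \<gamma>: "1 - H < \<gamma>" and L: "0 \<le> L"
    and w: "\<And>\<beta> j. \<beta> < H \<Longrightarrow> holder_on \<beta> T (\<lambda>t. w t $ j)"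
    and drift: "\<And>t. 0 \<le> t \<Longrightarrow> t \<le> T \<Longrightarrow> C1_lipschitz L (b t) (bx t) (bu t)"
    and drift0: "\<And>t. 0 \<le> t \<Longrightarrow> t \<le> T \<Longrightarrow> norm (b t 0 0) \<le> L"
    and diffusion: "\<And>t. 0 \<le> t \<Longrightarrow> t \<le> T \<Longrightarrow> C1_lipschitz L (\<sigma> t) (\<sigma>x t) (\<sigma>u t)"
    and diffusion0: "\<And>t. 0 \<le> t \<Longrightarrow> t \<le> T \<Longrightarrow> norm (\<sigma> t 0 0) \<le> L"
    and time: "\<And>s t x u. 0 \<le> s \<Longrightarrow> s \<le> t \<Longrightarrow> t \<le> T \<Longrightarrow> norm (\<sigma> t x u - \<sigma> s x u) \<le> L * (t - s) powr \<gamma>"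
      "\<And>s t x u. 0 \<le> s \<Longrightarrow> s \<le> t \<Longrightarrow> t \<le> T \<Longrightarrow> norm (\<sigma>x t x u - \<sigma>x s x u) \<le> L * (t - s) powr \<gamma>"
      "\<And>s t x u. 0 \<le> s \<Longrightarrow> s \<le> t \<Longrightarrow> t \<le> T \<Longrightarrow> norm (\<sigma>u t x u - \<sigma>u s x u) \<le> L * (t - s) powr \<gamma>"
begin

text \<open>The Gronwall lemma with the exponents resolved. The order \<open>\<beta>\<close> of the driving
  path is chosen between \<open>1 - \<alpha>\<close> and \<open>H\<close>; as \<open>\<alpha> < 1/2\<close>,
  it exceeds \<open>\<alpha>\<close>. Solutions need only be Hoelder of some order above \<open>1 - H\<close>,
  which may depend on the solution, and the bootstrap raises it to \<open>\<alpha>\<close>.\<close>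

lemma young_a_priori:
  assumes \<alpha>: "1 - H < \<alpha>" "\<alpha> < 1 / 2" and K: "K \<ge> 0"
  shows "\<exists>C\<ge>0. \<forall>A z0 f g. \<forall>z :: real \<Rightarrow> real^'n. A \<ge> 0 \<longrightarrow>
    young_equation T (\<lambda>j t. w t $ j) z0 f g z \<longrightarrow> linear_growth T \<alpha> A K f g z \<longrightarrow>
    (\<exists>\<kappa>>1 - H. holder_on \<kappa> T z) \<longrightarrow>
    (\<forall>t. 0 \<le> t \<longrightarrow> t \<le> T \<longrightarrow> norm (z t) \<le> C * (A + norm z0)) \<and> holder_bound T \<alpha> (C * (A + norm z0)) z"
proof -
  define \<beta> where "\<beta> = (1 - \<alpha> + H) / 2"
  have \<beta>: "\<beta> < H" "\<alpha> \<le> \<beta>" "\<beta> \<le> 1" "\<alpha> + \<beta> > 1" and \<alpha>0: "0 < \<alpha>"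
    using \<alpha> H by (auto simp: \<beta>_def field_simps)
  have w\<beta>: "\<And>j. holder_on \<beta> T (\<lambda>t. w t $ j)" using w \<beta> by blast
  obtain C where C: "C \<ge> 0" and *: "\<forall>A\<ge>0. \<forall>z0 f g. \<forall>z :: real \<Rightarrow> real^'n.
      young_equation T (\<lambda>j t. w t $ j) z0 f g z \<longrightarrow> linear_growth T \<alpha> A K f g z \<longrightarrow> holder_on \<alpha> T z \<longrightarrow>
      (\<forall>t\<in>{0..T}. norm (z t) \<le> C * (A + norm z0)) \<and> holder_bound T \<alpha> (C * (A + norm z0)) z"
    using young_gronwall[where w = "\<lambda>j t. w t $ j" and 'a = "real^'n", OF T w\<beta> \<alpha>0 \<beta>(2-4) K] by (elim exE conjE) (rule that)
  show ?thesis
  proof (intro exI[of _ C] conjI C allI impI)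
    fix A z0 f g and z :: "real \<Rightarrow> real^'n"
    assume A: "A \<ge> 0" and eq: "young_equation T (\<lambda>j t. w t $ j) z0 f g z"
      and lin: "linear_growth T \<alpha> A K f g z" and "\<exists>\<kappa>>1 - H. holder_on \<kappa> T z"
    then obtain \<kappa> where \<kappa>: "\<kappa> > 1 - H" "holder_on \<kappa> T z" by blast
    \<comment> \<open>Close enough to \<open>H\<close> for Young's condition with the order
        \<open>min \<kappa> \<alpha>\<close> of the integrands.\<close>
    define \<beta>' where "\<beta>' = max \<beta> ((1 - min \<kappa> \<alpha> + H) / 2)"
    have "\<beta>' < H" using \<beta> \<kappa> \<alpha> by (auto simp: \<beta>'_def field_simps)
    moreover have "\<alpha> \<le> \<beta>'" using \<beta> by (simp add: \<beta>'_def)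
    moreover have "min \<kappa> \<alpha> + \<beta>' > 1"
    proof -
      have "min \<kappa> \<alpha> > 1 - H" using \<kappa> \<alpha> by simp
      moreover have "\<beta>' \<ge> (1 - min \<kappa> \<alpha> + H) / 2" by (simp add: \<beta>'_def)
      ultimately show ?thesis by argo
    qed
    ultimately have z: "holder_on \<alpha> T z"
      using young_bootstrap[OF eq lin \<kappa>(2) _ w[of \<beta>'] \<alpha>0 _ _ _ A K] \<kappa>(1) \<alpha> H by simp
    show "holder_bound T \<alpha> (C * (A + norm z0)) z" using *[rule_format, OF A eq lin z] by simp
    fix t assume "0 \<le> t" "t \<le> T"
    then show "norm (z t) \<le> C * (A + norm z0)" using *[rule_format, OF A eq lin z] by simp
  qed
qed

definition solution :: "real^'n \<Rightarrow> (real \<Rightarrow> real^'d) \<Rightarrow> (real \<Rightarrow> real^'n) \<Rightarrow> bool" where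
  "solution x0 u x \<longleftrightarrow> solves_controlled_equation H T w b \<sigma> x0 u x"

lemma solution_young:
  assumes "solution x0 u x"
  shows "\<exists>\<kappa>>1 - H. holder_on \<kappa> T x"
    and "young_equation T (\<lambda>j t. w t $ j) x0 (\<lambda>t. b t (x t) (u t)) (\<lambda>j t. column j (\<sigma> t (x t) (u t))) x"
  using assms unfolding solution_def solves_controlled_equation_def by (rule solves_path_equationD)+

lemma powr_time:
  assumes "\<alpha> \<le> \<gamma>" "0 \<le> s" "s \<le> t" "t \<le> T"
  shows "(t - s) powr \<gamma> \<le> T powr (\<gamma> - \<alpha>) * (t - s) powr \<alpha>"
  using assms by (intro powr_le_on_interval) auto

text \<open>The bound is uniform over all controls with the same supremum and Hoelder bounds, in particular
  over \<open>u\<^sup>\<epsilon>\<close> for \<open>\<bar>\<epsilon>\<bar> \<le> 1\<close>.\<close>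

lemma solution_bound:
  assumes \<alpha>: "1 - H < \<alpha>" "\<alpha> < 1 / 2" "\<alpha> \<le> \<gamma>" and SN: "0 \<le> S" "0 \<le> N"
  shows "\<exists>R\<ge>0. \<forall>u x. (\<forall>t. 0 \<le> t \<longrightarrow> t \<le> T \<longrightarrow> norm (u t) \<le> S) \<longrightarrow> holder_bound T \<alpha> N u \<longrightarrow>
    solution x0 u x \<longrightarrow> holder_bound T \<alpha> R x"
proof -
  obtain C where C: "C \<ge> 0" and est: "\<forall>A z0 f g. \<forall>z :: real \<Rightarrow> real^'n. A \<ge> 0 \<longrightarrow>
    young_equation T (\<lambda>j t. w t $ j) z0 f g z \<longrightarrow> linear_growth T \<alpha> A L f g z \<longrightarrow>
    (\<exists>\<kappa>>1 - H. holder_on \<kappa> T z) \<longrightarrow>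
    (\<forall>t. 0 \<le> t \<longrightarrow> t \<le> T \<longrightarrow> norm (z t) \<le> C * (A + norm z0)) \<and> holder_bound T \<alpha> (C * (A + norm z0)) z"
    using young_a_priori[OF \<alpha>(1,2) L] by (elim exE conjE) (rule that)
  \<comment> \<open>The terms account for the coefficients at the origin, the size of the control, its
      increments, and the dependence of the coefficients on time.\<close>
  define A where "A = L + L * S + L * N + L * T powr (\<gamma> - \<alpha>)"
  have A: "0 \<le> A" using L SN by (simp add: A_def)
  show ?thesis
  proof (intro exI[of _ "C * (A + norm x0)"] conjI allI impI)
    show "0 \<le> C * (A + norm x0)" using C A by simp
    fix u x assume u: "\<forall>t. 0 \<le> t \<longrightarrow> t \<le> T \<longrightarrow> norm (u t) \<le> S" "holder_bound T \<alpha> N u" and x: "solution x0 u x"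
    have growth: "norm c + L * (norm (x t) + norm (u t)) \<le> A + L * norm (x t)" if "0 \<le> t" "t \<le> T" "norm c \<le> L" for t and c :: "'c::real_normed_vector"
    proof -
      have "L * norm (u t) \<le> L * S" using u(1) that L by (intro mult_left_mono) auto
      moreover have "0 \<le> L * N" "0 \<le> L * T powr (\<gamma> - \<alpha>)" using L SN by auto
      ultimately show ?thesis using that(3) unfolding A_def distrib_left by linarith
    qed
    have "linear_growth T \<alpha> A L (\<lambda>t. b t (x t) (u t)) (\<lambda>j t. column j (\<sigma> t (x t) (u t))) x"
    proof (rule linear_growthI)
      fix t assume t: "0 \<le> t" "t \<le> T"
      have "norm (b t (x t) (u t)) \<le> norm (b t 0 0) + L * (norm (x t) + norm (u t))"
        using C1_lipschitzD(6)[OF drift[OF t], of "x t" "u t" 0 0] norm_triangle_sub[of "b t (x t) (u t)" "b t 0 0"] by simp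
      also have "\<dots> \<le> A + L * norm (x t)" by (rule growth[OF t drift0[OF t]])
      finally show "norm (b t (x t) (u t)) \<le> A + L * norm (x t)" .
      have "norm (\<sigma> t (x t) (u t)) \<le> norm (\<sigma> t 0 0) + L * (norm (x t) + norm (u t))"
        using C1_lipschitzD(6)[OF diffusion[OF t], of "x t" "u t" 0 0] norm_triangle_sub[of "\<sigma> t (x t) (u t)" "\<sigma> t 0 0"] by simp
      also have "\<dots> \<le> A + L * norm (x t)" by (rule growth[OF t diffusion0[OF t]])
      finally show "norm (column j (\<sigma> t (x t) (u t))) \<le> A + L * norm (x t)" for j
        using norm_column_le order_trans by blast
    next
      fix s t j assume st: "0 \<le> s" "s \<le> t" "t \<le> T"
      have "norm (\<sigma> t (x t) (u t) - \<sigma> s (x s) (u s)) \<le>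
          norm (\<sigma> t (x t) (u t) - \<sigma> t (x s) (u s)) + norm (\<sigma> t (x s) (u s) - \<sigma> s (x s) (u s))"
        by (rule norm_diff_triangle_via)
      also have "\<dots> \<le> L * (norm (x t - x s) + norm (u t - u s)) + L * (t - s) powr \<gamma>"
        using st by (intro add_mono time(1) C1_lipschitzD(6)[OF diffusion]) auto
      also have "\<dots> \<le> L * (norm (x t - x s) + N * (t - s) powr \<alpha>) + L * (T powr (\<gamma> - \<alpha>) * (t - s) powr \<alpha>)"
        using L holder_boundD[OF u(2) st] powr_time[OF \<alpha>(3) st] by (intro add_mono mult_left_mono) auto
      also have "\<dots> = L * norm (x t - x s) + (L * N + L * T powr (\<gamma> - \<alpha>)) * (t - s) powr \<alpha>"
        by (simp add: algebra_simps)
      also have "\<dots> \<le> L * norm (x t - x s) + (A + L * norm (x s)) * (t - s) powr \<alpha>"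
      proof (intro add_left_mono mult_right_mono)
        have "0 \<le> L * S" "0 \<le> L * norm (x s)" using L SN by auto
        then show "L * N + L * T powr (\<gamma> - \<alpha>) \<le> A + L * norm (x s)" using L unfolding A_def by linarith
      qed simp
      finally show "norm (column j (\<sigma> t (x t) (u t)) - column j (\<sigma> s (x s) (u s))) \<le>
          L * norm (x t - x s) + (A + L * norm (x s)) * (t - s) powr \<alpha>"
        unfolding column_diff[symmetric] using norm_column_le order_trans by blast
    qed
    then show "holder_bound T \<alpha> (C * (A + norm x0)) x"
      using est[rule_format, OF A solution_young(2)[OF x] _ solution_young(1)[OF x]] by simp
  qed
qed

lemma coefficient_holder:
  assumes \<alpha>: "\<alpha> \<le> \<gamma>" and x: "holder_bound T \<alpha> R x" and u: "holder_bound T \<alpha> N u"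
  shows "holder_bound T \<alpha> (L * (T powr (\<gamma> - \<alpha>) + R + N)) (\<lambda>t. \<sigma>x t (x t) (u t))"
    and "holder_bound T \<alpha> (L * (T powr (\<gamma> - \<alpha>) + R + N)) (\<lambda>t. \<sigma>u t (x t) (u t))"
proof -
  have le: "L * (norm (x t - x s) + norm (u t - u s)) + L * (t - s) powr \<gamma> \<le> L * (T powr (\<gamma> - \<alpha>) + R + N) * (t - s) powr \<alpha>"
    if st: "0 \<le> s" "s \<le> t" "t \<le> T" for s t
  proof -
    have "L * (norm (x t - x s) + norm (u t - u s)) + L * (t - s) powr \<gamma> \<le>
        L * (R * (t - s) powr \<alpha> + N * (t - s) powr \<alpha>) + L * (T powr (\<gamma> - \<alpha>) * (t - s) powr \<alpha>)"
      using L by (intro add_mono mult_left_mono holder_boundD[OF x st] holder_boundD[OF u st] powr_time[OF \<alpha> st]) auto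
    then show ?thesis by (simp add: algebra_simps)
  qed
  show "holder_bound T \<alpha> (L * (T powr (\<gamma> - \<alpha>) + R + N)) (\<lambda>t. \<sigma>x t (x t) (u t))"
  proof (rule holder_boundI)
    fix s t assume st: "0 \<le> s" "s \<le> t" "t \<le> T"
    have "norm (\<sigma>x t (x t) (u t) - \<sigma>x s (x s) (u s)) \<le>
        norm (\<sigma>x t (x t) (u t) - \<sigma>x t (x s) (u s)) + norm (\<sigma>x t (x s) (u s) - \<sigma>x s (x s) (u s))"
      by (rule norm_diff_triangle_via)
    also have "\<dots> \<le> L * (norm (x t - x s) + norm (u t - u s)) + L * (t - s) powr \<gamma>"
      using st by (intro add_mono time(2) C1_lipschitzD(4)[OF diffusion]) auto
    also note le[OF st]
    finally show "norm (\<sigma>x t (x t) (u t) - \<sigma>x s (x s) (u s)) \<le> L * (T powr (\<gamma> - \<alpha>) + R + N) * (t - s) powr \<alpha>" .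
  qed
  show "holder_bound T \<alpha> (L * (T powr (\<gamma> - \<alpha>) + R + N)) (\<lambda>t. \<sigma>u t (x t) (u t))"
  proof (rule holder_boundI)
    fix s t assume st: "0 \<le> s" "s \<le> t" "t \<le> T"
    have "norm (\<sigma>u t (x t) (u t) - \<sigma>u s (x s) (u s)) \<le>
        norm (\<sigma>u t (x t) (u t) - \<sigma>u t (x s) (u s)) + norm (\<sigma>u t (x s) (u s) - \<sigma>u s (x s) (u s))"
      by (rule norm_diff_triangle_via)
    also have "\<dots> \<le> L * (norm (x t - x s) + norm (u t - u s)) + L * (t - s) powr \<gamma>"
      using st by (intro add_mono time(3) C1_lipschitzD(5)[OF diffusion]) auto
    also note le[OF st]
    finally show "norm (\<sigma>u t (x t) (u t) - \<sigma>u s (x s) (u s)) \<le> L * (T powr (\<gamma> - \<alpha>) + R + N) * (t - s) powr \<alpha>" .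
  qed
qed

text \<open>The four point estimate at the times \<open>t\<close> and \<open>s\<close>, with all increments of
  paths and controls expressed by \<open>(t - s)\<^sup>\<alpha>\<close>. The result has the form required by
  \<^const>\<open>linear_growth\<close> for \<open>z = x1 - x2\<close>, with inhomogeneity proportional to the
  size \<open>e\<close> of \<open>u1 - u2\<close>.\<close>

lemma diffusion_difference_increment:
  assumes \<alpha>: "\<alpha> \<le> \<gamma>" and st: "0 \<le> s" "s \<le> t" "t \<le> T"
    and x: "holder_bound T \<alpha> R x1" "holder_bound T \<alpha> R x2"
    and u: "holder_bound T \<alpha> N u1" "holder_bound T \<alpha> N u2"
    and e: "norm (u1 s - u2 s) \<le> e" "holder_bound T \<alpha> e (\<lambda>t. u1 t - u2 t)"
    and nn: "0 \<le> R" "0 \<le> N"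
  defines "K \<equiv> L * (1 + T powr (\<gamma> - \<alpha>) + 2 * R + 2 * N)"
  shows "norm ((\<sigma> t (x1 t) (u1 t) - \<sigma> t (x2 t) (u2 t)) - (\<sigma> s (x1 s) (u1 s) - \<sigma> s (x2 s) (u2 s))) \<le>
    K * norm ((x1 t - x2 t) - (x1 s - x2 s)) + (2 * K * e + K * norm (x1 s - x2 s)) * (t - s) powr \<alpha>"
proof -
  define p where "p = (t - s) powr \<alpha>"
  define dz where "dz = norm ((x1 t - x2 t) - (x1 s - x2 s))"
  define zs where "zs = norm (x1 s - x2 s)"
  define k where "k = 1 + T powr (\<gamma> - \<alpha>) + 2 * R + 2 * N"
  have K: "K = L * k" by (simp add: K_def k_def)
  have e0: "0 \<le> e" using e(1) norm_ge_zero order_trans by blast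
  have nn': "0 \<le> p" "0 \<le> dz" "0 \<le> zs" "1 \<le> k" using nn by (simp_all add: p_def dz_def zs_def k_def)
  have t': "0 \<le> t" "s \<le> T" using st by auto
  have g: "(t - s) powr \<gamma> \<le> T powr (\<gamma> - \<alpha>) * p" unfolding p_def by (rule powr_time[OF \<alpha> st])
  have inc: "norm (x1 t - x1 s) \<le> R * p" "norm (x2 t - x2 s) \<le> R * p"
    "norm (u1 t - u1 s) \<le> N * p" "norm (u2 t - u2 s) \<le> N * p"
    "norm ((u1 t - u2 t) - (u1 s - u2 s)) \<le> e * p"
    unfolding p_def using holder_boundD[OF x(1) st] holder_boundD[OF x(2) st] holder_boundD[OF u(1) st]
      holder_boundD[OF u(2) st] holder_boundD[OF e(2) st] by auto
  have "norm ((\<sigma> t (x1 t) (u1 t) - \<sigma> t (x2 t) (u2 t)) - (\<sigma> s (x1 s) (u1 s) - \<sigma> s (x2 s) (u2 s))) \<le>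
      L * (dz + norm ((u1 t - u2 t) - (u1 s - u2 s))) +
      (L * (t - s) powr \<gamma> + L * (norm (x1 t - x1 s) + norm (x2 t - x2 s) + norm (u1 t - u1 s) + norm (u2 t - u2 s))) *
        (zs + norm (u1 s - u2 s))"
    unfolding dz_def zs_def
    by (rule C1_lipschitz_four_point[OF diffusion[OF t'(1) st(3)] diffusion[OF st(1) t'(2)] L])
      (intro time st)+
  also have "\<dots> \<le> L * (dz + e * p) + (L * (T powr (\<gamma> - \<alpha>) * p) + L * (R * p + R * p + N * p + N * p)) * (zs + e)"
    using L nn nn' by (intro add_mono mult_mono mult_left_mono order_refl inc g e add_nonneg_nonneg mult_nonneg_nonneg) auto
  also have "\<dots> = L * dz + L * (e * p) + L * (k - 1) * (p * (zs + e))"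
    by (simp add: k_def algebra_simps)
  also have "\<dots> \<le> L * k * dz + L * k * (e * p) + L * k * (p * (zs + e))"
    using L nn' e0 by (intro add_mono mult_right_mono) (auto simp: mult_le_cancel_left1 intro: mult_left_mono)
  also have "\<dots> = K * dz + (2 * K * e + K * zs) * p" by (simp add: K algebra_simps)
  finally show ?thesis unfolding dz_def zs_def p_def .
qed

text \<open>Solutions depend on the control in a Lipschitz way, in Hoelder norm, as long as the solutions and
  controls stay in a bounded set of Hoelder paths.\<close>

lemma solution_difference_bound:
  assumes \<alpha>: "1 - H < \<alpha>" "\<alpha> < 1 / 2" "\<alpha> \<le> \<gamma>" and nn: "0 \<le> R" "0 \<le> N"
  shows "\<exists>C\<ge>0. \<forall>x1 x2 u1 u2 e. solution x0 u1 x1 \<longrightarrow> solution x0 u2 x2 \<longrightarrow>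
    holder_bound T \<alpha> R x1 \<longrightarrow> holder_bound T \<alpha> R x2 \<longrightarrow> holder_bound T \<alpha> N u1 \<longrightarrow> holder_bound T \<alpha> N u2 \<longrightarrow>
    (\<forall>t. 0 \<le> t \<longrightarrow> t \<le> T \<longrightarrow> norm (u1 t - u2 t) \<le> e) \<longrightarrow> holder_bound T \<alpha> e (\<lambda>t. u1 t - u2 t) \<longrightarrow>
    (\<forall>t. 0 \<le> t \<longrightarrow> t \<le> T \<longrightarrow> norm (x1 t - x2 t) \<le> C * e) \<and> holder_bound T \<alpha> (C * e) (\<lambda>t. x1 t - x2 t)"
proof -
  define K where "K = L * (1 + T powr (\<gamma> - \<alpha>) + 2 * R + 2 * N)"
  have K: "K \<ge> 0" "L \<le> K" using L nn by (auto simp: K_def mult_le_cancel_left1)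
  obtain C where C: "C \<ge> 0" and est: "\<forall>A z0 f g. \<forall>z :: real \<Rightarrow> real^'n. A \<ge> 0 \<longrightarrow>
    young_equation T (\<lambda>j t. w t $ j) z0 f g z \<longrightarrow> linear_growth T \<alpha> A K f g z \<longrightarrow>
    (\<exists>\<kappa>>1 - H. holder_on \<kappa> T z) \<longrightarrow>
    (\<forall>t. 0 \<le> t \<longrightarrow> t \<le> T \<longrightarrow> norm (z t) \<le> C * (A + norm z0)) \<and> holder_bound T \<alpha> (C * (A + norm z0)) z"
    using young_a_priori[OF \<alpha>(1,2) K(1)] by (elim exE conjE) (rule that)
  have main: "(\<forall>t. 0 \<le> t \<longrightarrow> t \<le> T \<longrightarrow> norm (x1 t - x2 t) \<le> C * (2 * K * e + norm (x0 - x0))) \<and>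
      holder_bound T \<alpha> (C * (2 * K * e + norm (x0 - x0))) (\<lambda>t. x1 t - x2 t)"
    if sol: "solution x0 u1 x1" "solution x0 u2 x2"
      and x: "holder_bound T \<alpha> R x1" "holder_bound T \<alpha> R x2"
      and u: "holder_bound T \<alpha> N u1" "holder_bound T \<alpha> N u2"
      and e: "\<forall>t. 0 \<le> t \<longrightarrow> t \<le> T \<longrightarrow> norm (u1 t - u2 t) \<le> e" "holder_bound T \<alpha> e (\<lambda>t. u1 t - u2 t)"
    for x1 x2 u1 u2 e
  proof -
    have "0 \<le> norm (u1 0 - u2 0)" by simp
    also have "\<dots> \<le> e" using e(1) T by simp
    finally have e0: "0 \<le> e" .
    have lip: "L * (norm (x1 t - x2 t) + norm (u1 t - u2 t)) \<le> 2 * K * e + K * norm (x1 t - x2 t)" if "0 \<le> t" "t \<le> T" for t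
    proof -
      have "L * (norm (x1 t - x2 t) + norm (u1 t - u2 t)) \<le> K * (norm (x1 t - x2 t) + e)"
        using e(1) that K by (intro mult_mono add_left_mono) auto
      also have "\<dots> \<le> 2 * K * e + K * norm (x1 t - x2 t)"
        using mult_nonneg_nonneg[OF K(1) e0] by (simp add: algebra_simps)
      finally show ?thesis .
    qed
    have "linear_growth T \<alpha> (2 * K * e) K (\<lambda>t. b t (x1 t) (u1 t) - b t (x2 t) (u2 t))
        (\<lambda>j t. column j (\<sigma> t (x1 t) (u1 t)) - column j (\<sigma> t (x2 t) (u2 t))) (\<lambda>t. x1 t - x2 t)"
    proof (rule linear_growthI)
      fix t assume t: "0 \<le> t" "t \<le> T"
      show "norm (b t (x1 t) (u1 t) - b t (x2 t) (u2 t)) \<le> 2 * K * e + K * norm (x1 t - x2 t)"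
        by (rule order_trans[OF C1_lipschitzD(6)[OF drift[OF t]] lip[OF t]])
      show "norm (column j (\<sigma> t (x1 t) (u1 t)) - column j (\<sigma> t (x2 t) (u2 t))) \<le> 2 * K * e + K * norm (x1 t - x2 t)" for j
        unfolding column_diff[symmetric]
        by (rule order_trans[OF norm_column_le order_trans[OF C1_lipschitzD(6)[OF diffusion[OF t]] lip[OF t]]])
    next
      fix s t j assume st: "0 \<le> s" "s \<le> t" "t \<le> T"
      show "norm ((column j (\<sigma> t (x1 t) (u1 t)) - column j (\<sigma> t (x2 t) (u2 t))) -
          (column j (\<sigma> s (x1 s) (u1 s)) - column j (\<sigma> s (x2 s) (u2 s)))) \<le>
        K * norm ((x1 t - x2 t) - (x1 s - x2 s)) + (2 * K * e + K * norm (x1 s - x2 s)) * (t - s) powr \<alpha>"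
        unfolding column_diff[symmetric] K_def using e(1) st
        by (intro order_trans[OF norm_column_le diffusion_difference_increment[OF \<alpha>(3) st x u _ e(2) nn]]) auto
    qed
    moreover have "\<exists>\<kappa>>1 - H. holder_on \<kappa> T (\<lambda>t. x1 t - x2 t)"
      using holder_bound_diff[OF x] \<alpha>(1) unfolding holder_on_def holder_bound_def by blast
    moreover have "0 \<le> 2 * K * e" using K e0 by simp
    ultimately show ?thesis
      using est[rule_format, OF _ young_equation_diff[OF solution_young(2)[OF sol(1)] solution_young(2)[OF sol(2)]]]
      by blast
  qed
  show ?thesis
  proof (intro exI[of _ "C * (2 * K)"] conjI)
    show "0 \<le> C * (2 * K)" using C K by simp
  qed (use main in \<open>simp_all add: mult_ac\<close>)
qed

text \<open>The quantitative form of both limits. The orders \<open>\<alpha> < \<alpha>'\<close> differ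
  because the remainder of the linearization is estimated by interpolation: it is \<open>O(\<epsilon>)\<close>
  in the supremum norm and bounded in \<open>\<alpha>'\<close>-Hoelder norm.\<close>

lemma solution_linearization:
  assumes \<alpha>: "1 - H < \<alpha>" "\<alpha> < \<alpha>'" "\<alpha>' < 1 / 2" "\<alpha>' \<le> \<gamma>" and E: "0 \<le> E"
    and us: "\<And>t. 0 \<le> t \<Longrightarrow> t \<le> T \<Longrightarrow> norm (us t) \<le> E" "holder_bound T \<alpha>' E us"
    and ub: "\<And>t. 0 \<le> t \<Longrightarrow> t \<le> T \<Longrightarrow> norm (ub t) \<le> E" "holder_bound T \<alpha>' E ub"
    and xs: "solution x0 us xs"
    and xe: "\<And>\<epsilon>. solution x0 (\<lambda>t. us t + \<epsilon> *\<^sub>R ub t) (xe \<epsilon>)"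
    and y: "solves_path_equation H T w 0
        (\<lambda>s. blinfun_apply (bx s (xs s) (us s)) (y s) + blinfun_apply (bu s (xs s) (us s)) (ub s))
        (\<lambda>s. blinfun_apply (\<sigma>x s (xs s) (us s)) (y s) + blinfun_apply (\<sigma>u s (xs s) (us s)) (ub s)) y"
  shows "\<exists>C1 C2. \<forall>\<epsilon> t. \<epsilon> \<noteq> 0 \<longrightarrow> \<bar>\<epsilon>\<bar> \<le> 1 \<longrightarrow> 0 \<le> t \<longrightarrow> t \<le> T \<longrightarrow>
    norm (xe \<epsilon> t - xs t) \<le> C1 * \<bar>\<epsilon>\<bar> \<and>
    norm ((1 / \<epsilon>) *\<^sub>R (xe \<epsilon> t - xs t) - y t) \<le> C2 * \<bar>\<epsilon>\<bar> powr (1 - \<alpha> / \<alpha>')"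
proof -
  have \<alpha>1: "1 - H < \<alpha>'" "0 < \<alpha>" "\<alpha> < 1 / 2" using \<alpha> H by auto
  have ue_sup: "norm (us t + \<epsilon> *\<^sub>R ub t) \<le> 2 * E" if "\<bar>\<epsilon>\<bar> \<le> 1" "0 \<le> t" "t \<le> T" for \<epsilon> t
  proof -
    have "\<bar>\<epsilon>\<bar> * norm (ub t) \<le> 1 * E" using that ub(1)[of t] E by (intro mult_mono) auto
    then show ?thesis using norm_triangle_ineq[of "us t" "\<epsilon> *\<^sub>R ub t"] us(1)[OF that(2,3)] by simp
  qed
  have ue_holder: "holder_bound T \<alpha>' (2 * E) (\<lambda>t. us t + \<epsilon> *\<^sub>R ub t)" if "\<bar>\<epsilon>\<bar> \<le> 1" for \<epsilon>
  proof -
    have "holder_bound T \<alpha>' (E + \<bar>- \<epsilon>\<bar> * E) (\<lambda>t. us t - (- \<epsilon>) *\<^sub>R ub t)"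
      by (intro holder_bound_diff holder_bound_scaleR us ub)
    moreover have "E + \<bar>- \<epsilon>\<bar> * E \<le> 2 * E" using mult_right_mono[OF that E] by simp
    ultimately have "holder_bound T \<alpha>' (2 * E) (\<lambda>t. us t - (- \<epsilon>) *\<^sub>R ub t)" by (rule holder_bound_weaken)
    then show ?thesis by simp
  qed
  have us_holder: "holder_bound T \<alpha>' (2 * E) us" and us_sup: "\<And>t. 0 \<le> t \<Longrightarrow> t \<le> T \<Longrightarrow> norm (us t) \<le> 2 * E"
    using ue_holder[of 0] ue_sup[of 0] by simp_all
  have E2: "0 \<le> 2 * E" using E by simp
  obtain R where R: "0 \<le> R" and Rest: "\<forall>u x. (\<forall>t. 0 \<le> t \<longrightarrow> t \<le> T \<longrightarrow> norm (u t) \<le> 2 * E) \<longrightarrow>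
      holder_bound T \<alpha>' (2 * E) u \<longrightarrow> solution x0 u x \<longrightarrow> holder_bound T \<alpha>' R x"
    using solution_bound[where ?x0.0 = x0, OF \<alpha>1(1) \<alpha>(3,4) E2 E2] by (elim exE conjE) (rule that)
  have xs_holder: "holder_bound T \<alpha>' R xs"
    using Rest us_sup us_holder xs by blast
  have xe_holder: "holder_bound T \<alpha>' R (xe \<epsilon>)" if "\<bar>\<epsilon>\<bar> \<le> 1" for \<epsilon>
    using Rest[rule_format, OF _ ue_holder[OF that] xe[of \<epsilon>]] ue_sup[OF that] by blast
  obtain C where C: "0 \<le> C" and Cest: "\<forall>x1 x2 u1 u2 e. solution x0 u1 x1 \<longrightarrow> solution x0 u2 x2 \<longrightarrow>
    holder_bound T \<alpha>' R x1 \<longrightarrow> holder_bound T \<alpha>' R x2 \<longrightarrow> holder_bound T \<alpha>' (2 * E) u1 \<longrightarrow> holder_bound T \<alpha>' (2 * E) u2 \<longrightarrow>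
    (\<forall>t. 0 \<le> t \<longrightarrow> t \<le> T \<longrightarrow> norm (u1 t - u2 t) \<le> e) \<longrightarrow> holder_bound T \<alpha>' e (\<lambda>t. u1 t - u2 t) \<longrightarrow>
    (\<forall>t. 0 \<le> t \<longrightarrow> t \<le> T \<longrightarrow> norm (x1 t - x2 t) \<le> C * e) \<and> holder_bound T \<alpha>' (C * e) (\<lambda>t. x1 t - x2 t)"
    using solution_difference_bound[where ?x0.0 = x0, OF \<alpha>1(1) \<alpha>(3,4) R E2] by (elim exE conjE) (rule that)
  have du_sup: "norm (us t + \<epsilon> *\<^sub>R ub t - us t) \<le> \<bar>\<epsilon>\<bar> * E" if "0 \<le> t" "t \<le> T" for \<epsilon> t
    using ub(1)[OF that] by (simp add: mult_left_mono)
  have du_holder: "holder_bound T \<alpha>' (\<bar>\<epsilon>\<bar> * E) (\<lambda>t. us t + \<epsilon> *\<^sub>R ub t - us t)" for \<epsilon>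
    using holder_bound_scaleR[OF ub(2), of \<epsilon>] by simp
  have diff: "(\<forall>t. 0 \<le> t \<longrightarrow> t \<le> T \<longrightarrow> norm (xe \<epsilon> t - xs t) \<le> C * (\<bar>\<epsilon>\<bar> * E)) \<and>
      holder_bound T \<alpha>' (C * (\<bar>\<epsilon>\<bar> * E)) (\<lambda>t. xe \<epsilon> t - xs t)" if "\<bar>\<epsilon>\<bar> \<le> 1" for \<epsilon>
    using du_sup by (intro Cest[rule_format, OF xe[of \<epsilon>] xs xe_holder[OF that] xs_holder ue_holder[OF that] us_holder _ du_holder]) auto
  \<comment> \<open>The following constants are independent of \<open>\<epsilon>\<close>. The remainder of the
      linearization, divided by \<open>\<epsilon>\<close>, is at most \<open>Q \<bar>\<epsilon>\<bar>\<close>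
      and has the \<open>\<alpha>'\<close>-Hoelder constant \<open>N\<close>. The constant \<open>K\<close>
      belongs to the difference of \<open>\<sigma>\<close> along two solutions, \<open>S\<close> to the
      derivatives of \<open>\<sigma>\<close> along \<open>x\<^sup>*\<close>. The inhomogeneity in the equation
      for \<open>z\<close> is \<open>B \<bar>\<epsilon>\<bar>\<^sup>p\<close>, and its growth constant is
      \<open>K'\<close>.\<close>
  define Q where "Q = L * ((C + 1) * E)\<^sup>2"
  have Q: "0 \<le> Q" using L by (simp add: Q_def)
  define K where "K = L * (1 + T powr (\<gamma> - \<alpha>') + 2 * R + 2 * (2 * E))"
  have K: "0 \<le> K" using L R E by (simp add: K_def)
  define S where "S = L * (T powr (\<gamma> - \<alpha>') + R + 2 * E)"
  have S: "0 \<le> S" using L R E by (simp add: S_def)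
  note cs = coefficient_holder[OF \<alpha>(4) xs_holder us_holder, folded S_def]
  define N where "N = (2 * K * C * E + 2 * K * E) + (L * (C * E) + S * (C * E)) + (L * E + S * E)"
  have N: "0 \<le> N" using L K S C E by (simp add: N_def)
  define p where "p = 1 - \<alpha> / \<alpha>'"
  have p: "0 < p" "p \<le> 1" using \<alpha> \<alpha>1 by (auto simp: p_def field_simps)
  define B where "B = Q + (2 * Q) powr p * N powr (\<alpha> / \<alpha>')"
  have B: "0 \<le> B" using Q by (simp add: B_def)
  define K' where "K' = L + S * T powr (\<alpha>' - \<alpha>)"
  have K': "0 \<le> K'" "L \<le> K'" using L S by (auto simp: K'_def)
  obtain D where D: "D \<ge> 0" and Dest: "\<forall>A z0 f g. \<forall>z :: real \<Rightarrow> real^'n. A \<ge> 0 \<longrightarrow>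
    young_equation T (\<lambda>j t. w t $ j) z0 f g z \<longrightarrow> linear_growth T \<alpha> A K' f g z \<longrightarrow>
    (\<exists>\<kappa>>1 - H. holder_on \<kappa> T z) \<longrightarrow>
    (\<forall>t. 0 \<le> t \<longrightarrow> t \<le> T \<longrightarrow> norm (z t) \<le> D * (A + norm z0)) \<and> holder_bound T \<alpha> (D * (A + norm z0)) z"
    using young_a_priori[OF \<alpha>(1) \<alpha>1(3) K'(1)] by (elim exE conjE) (rule that)
  have main: "norm ((1 / \<epsilon>) *\<^sub>R (xe \<epsilon> t - xs t) - y t) \<le> D * B * \<bar>\<epsilon>\<bar> powr p"
    if \<epsilon>: "\<epsilon> \<noteq> 0" "\<bar>\<epsilon>\<bar> \<le> 1" and t0: "0 \<le> t" "t \<le> T" for \<epsilon> t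
  proof -
    define h where "h t = xe \<epsilon> t - xs t" for t
    define z where "z t = (1 / \<epsilon>) *\<^sub>R h t - y t" for t
    define ue where "ue t = us t + \<epsilon> *\<^sub>R ub t" for t
    have h: "\<And>t. 0 \<le> t \<Longrightarrow> t \<le> T \<Longrightarrow> norm (h t) \<le> C * (\<bar>\<epsilon>\<bar> * E)" "holder_bound T \<alpha>' (C * (\<bar>\<epsilon>\<bar> * E)) h"
      using diff[OF \<epsilon>(2)] by (simp_all add: h_def[abs_def])
    have h\<epsilon>: "\<And>t. 0 \<le> t \<Longrightarrow> t \<le> T \<Longrightarrow> norm ((1 / \<epsilon>) *\<^sub>R h t) \<le> C * E"
      "holder_bound T \<alpha>' (C * E) (\<lambda>t. (1 / \<epsilon>) *\<^sub>R h t)"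
      using h(1) holder_bound_scaleR[OF h(2), of "1 / \<epsilon>"] \<epsilon> by (simp_all add: field_simps)
    have square: "L * (norm (h t) + norm (\<epsilon> *\<^sub>R ub t))\<^sup>2 / \<bar>\<epsilon>\<bar> \<le> Q * \<bar>\<epsilon>\<bar>" if "0 \<le> t" "t \<le> T" for t
    proof -
      have "norm (h t) + norm (\<epsilon> *\<^sub>R ub t) \<le> C * (\<bar>\<epsilon>\<bar> * E) + \<bar>\<epsilon>\<bar> * E"
        using h(1)[OF that] mult_left_mono[OF ub(1)[OF that], of "\<bar>\<epsilon>\<bar>"] by simp
      also have "\<dots> = (C + 1) * E * \<bar>\<epsilon>\<bar>" by (simp add: algebra_simps)
      finally have "(norm (h t) + norm (\<epsilon> *\<^sub>R ub t))\<^sup>2 \<le> ((C + 1) * E * \<bar>\<epsilon>\<bar>)\<^sup>2" by (intro power_mono) auto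
      then have "L * (norm (h t) + norm (\<epsilon> *\<^sub>R ub t))\<^sup>2 / \<bar>\<epsilon>\<bar> \<le> L * ((C + 1) * E * \<bar>\<epsilon>\<bar>)\<^sup>2 / \<bar>\<epsilon>\<bar>"
        using L by (intro divide_right_mono mult_left_mono) auto
      also have "\<dots> = Q * \<bar>\<epsilon>\<bar>" using \<epsilon> by (simp add: Q_def power2_eq_square)
      finally show ?thesis .
    qed
    have remainder: "norm ((1 / \<epsilon>) *\<^sub>R (f (xe \<epsilon> t) (ue t) - f (xs t) (us t)) -
        blinfun_apply (fx (xs t) (us t)) ((1 / \<epsilon>) *\<^sub>R h t) - blinfun_apply (fu (xs t) (us t)) (ub t)) \<le> Q * \<bar>\<epsilon>\<bar>"
      if f: "C1_lipschitz L f fx fu" and t: "0 \<le> t" "t \<le> T"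
      for t fx fu and f :: "real^'n \<Rightarrow> real^'d \<Rightarrow> 'c::real_normed_vector"
    proof -
      have eq: "(1 / \<epsilon>) *\<^sub>R (f (xe \<epsilon> t) (ue t) - f (xs t) (us t)) -
          blinfun_apply (fx (xs t) (us t)) ((1 / \<epsilon>) *\<^sub>R h t) - blinfun_apply (fu (xs t) (us t)) (ub t) =
        (1 / \<epsilon>) *\<^sub>R (f (xs t + h t) (us t + \<epsilon> *\<^sub>R ub t) - f (xs t) (us t) -
          blinfun_apply (fx (xs t) (us t)) (h t) - blinfun_apply (fu (xs t) (us t)) (\<epsilon> *\<^sub>R ub t))"
      proof -
        have "xe \<epsilon> t = xs t + h t" by (simp add: h_def)
        then show ?thesis using \<epsilon>(1) by (simp add: ue_def scaleR_diff_right blinfun.scaleR_right)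
      qed
      have "norm (f (xs t + h t) (us t + \<epsilon> *\<^sub>R ub t) - f (xs t) (us t) -
          blinfun_apply (fx (xs t) (us t)) (h t) - blinfun_apply (fu (xs t) (us t)) (\<epsilon> *\<^sub>R ub t)) / \<bar>\<epsilon>\<bar>
        \<le> L * (norm (h t) + norm (\<epsilon> *\<^sub>R ub t))\<^sup>2 / \<bar>\<epsilon>\<bar>"
        by (intro divide_right_mono C1_lipschitz_taylor[OF f L]) simp
      then show ?thesis unfolding eq using square[OF t] by simp
    qed
    \<comment> \<open>The remainder of the linearization of \<open>\<sigma>\<close>, divided by
        \<open>\<epsilon>\<close>.\<close>
    define \<rho> where "\<rho> t = (1 / \<epsilon>) *\<^sub>R (\<sigma> t (xe \<epsilon> t) (ue t) - \<sigma> t (xs t) (us t)) -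
        blinfun_apply (\<sigma>x t (xs t) (us t)) ((1 / \<epsilon>) *\<^sub>R h t) - blinfun_apply (\<sigma>u t (xs t) (us t)) (ub t)" for t
    have \<rho>_sup: "norm (\<rho> t) \<le> Q * \<bar>\<epsilon>\<bar>" if "0 \<le> t" "t \<le> T" for t
      unfolding \<rho>_def by (rule remainder[OF diffusion[OF that] that])
    have "holder_bound T \<alpha>' (2 * K * C * E + 2 * K * E) (\<lambda>t. (1 / \<epsilon>) *\<^sub>R (\<sigma> t (xe \<epsilon> t) (ue t) - \<sigma> t (xs t) (us t)))"
    proof (rule holder_boundI)
      fix s t assume st: "0 \<le> s" "s \<le> t" "t \<le> T"
      have "norm ((\<sigma> t (xe \<epsilon> t) (ue t) - \<sigma> t (xs t) (us t)) - (\<sigma> s (xe \<epsilon> s) (ue s) - \<sigma> s (xs s) (us s))) \<le>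
          K * norm ((xe \<epsilon> t - xs t) - (xe \<epsilon> s - xs s)) + (2 * K * (\<bar>\<epsilon>\<bar> * E) + K * norm (xe \<epsilon> s - xs s)) * (t - s) powr \<alpha>'"
        unfolding K_def ue_def using st R E
        by (intro diffusion_difference_increment[OF \<alpha>(4) st xe_holder[OF \<epsilon>(2)] xs_holder ue_holder[OF \<epsilon>(2)] us_holder
            _ du_holder] du_sup) auto
      also have "\<dots> \<le> K * (C * (\<bar>\<epsilon>\<bar> * E) * (t - s) powr \<alpha>') +
          (2 * K * (\<bar>\<epsilon>\<bar> * E) + K * (C * (\<bar>\<epsilon>\<bar> * E))) * (t - s) powr \<alpha>'"
        using st K holder_boundD[OF h(2) st] h(1)[of s]
        by (intro add_mono mult_left_mono mult_right_mono add_left_mono) (auto simp: h_def)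
      also have "\<dots> = \<bar>\<epsilon>\<bar> * ((2 * K * C * E + 2 * K * E) * (t - s) powr \<alpha>')" by (simp add: algebra_simps)
      finally show "norm ((1 / \<epsilon>) *\<^sub>R (\<sigma> t (xe \<epsilon> t) (ue t) - \<sigma> t (xs t) (us t)) -
          (1 / \<epsilon>) *\<^sub>R (\<sigma> s (xe \<epsilon> s) (ue s) - \<sigma> s (xs s) (us s))) \<le> (2 * K * C * E + 2 * K * E) * (t - s) powr \<alpha>'"
        using \<epsilon>(1) unfolding scaleR_diff_right[symmetric] by (simp add: divide_le_eq mult.commute)
    qed
    moreover have "holder_bound T \<alpha>' (L * (C * E) + S * (C * E)) (\<lambda>t. blinfun_apply (\<sigma>x t (xs t) (us t)) ((1 / \<epsilon>) *\<^sub>R h t))"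
      by (rule holder_bound_apply[OF cs(1) C1_lipschitzD(2)[OF diffusion] h\<epsilon>(2,1) S L])
    moreover have "holder_bound T \<alpha>' (L * E + S * E) (\<lambda>t. blinfun_apply (\<sigma>u t (xs t) (us t)) (ub t))"
      by (rule holder_bound_apply[OF cs(2) C1_lipschitzD(3)[OF diffusion] ub(2,1) S L])
    ultimately have \<rho>_holder': "holder_bound T \<alpha>' N \<rho>"
      unfolding N_def \<rho>_def by (intro holder_bound_diff)
    have \<rho>_holder: "holder_bound T \<alpha> ((2 * (Q * \<bar>\<epsilon>\<bar>)) powr p * N powr (\<alpha> / \<alpha>')) \<rho>"
      unfolding p_def by (rule holder_interpolation[OF \<rho>_holder' \<rho>_sup \<alpha>1(2) \<alpha>(2) N])
    \<comment> \<open>With \<open>\<bar>\<epsilon>\<bar> \<le> 1\<close> and \<open>p \<le> 1\<close>, the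
        supremum bound is dominated by the interpolated one.\<close>
    have \<epsilon>p: "\<bar>\<epsilon>\<bar> \<le> \<bar>\<epsilon>\<bar> powr p"
      using powr_mono'[of p 1 "\<bar>\<epsilon>\<bar>"] p \<epsilon> by simp
    have small1: "Q * \<bar>\<epsilon>\<bar> \<le> B * \<bar>\<epsilon>\<bar> powr p"
      using Q \<epsilon>p by (intro mult_mono) (auto simp: B_def)
    have small2: "(2 * (Q * \<bar>\<epsilon>\<bar>)) powr p * N powr (\<alpha> / \<alpha>') \<le> B * \<bar>\<epsilon>\<bar> powr p"
    proof -
      have "(2 * (Q * \<bar>\<epsilon>\<bar>)) powr p = (2 * Q) powr p * \<bar>\<epsilon>\<bar> powr p"
        using powr_mult[of "2 * Q" "\<bar>\<epsilon>\<bar>" p] by (simp add: mult.assoc)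
      then have "(2 * (Q * \<bar>\<epsilon>\<bar>)) powr p * N powr (\<alpha> / \<alpha>') = ((2 * Q) powr p * N powr (\<alpha> / \<alpha>')) * \<bar>\<epsilon>\<bar> powr p" by simp
      also have "\<dots> \<le> B * \<bar>\<epsilon>\<bar> powr p" using Q by (intro mult_right_mono) (auto simp: B_def)
      finally show ?thesis .
    qed
    define f where "f t = (1 / \<epsilon>) *\<^sub>R (b t (xe \<epsilon> t) (ue t) - b t (xs t) (us t)) -
        (blinfun_apply (bx t (xs t) (us t)) (y t) + blinfun_apply (bu t (xs t) (us t)) (ub t))" for t
    define g where "g t = (1 / \<epsilon>) *\<^sub>R (\<sigma> t (xe \<epsilon> t) (ue t) - \<sigma> t (xs t) (us t)) -
        (blinfun_apply (\<sigma>x t (xs t) (us t)) (y t) + blinfun_apply (\<sigma>u t (xs t) (us t)) (ub t))" for t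
    have g_eq: "g t = blinfun_apply (\<sigma>x t (xs t) (us t)) (z t) + \<rho> t" for t
      by (simp add: g_def \<rho>_def z_def blinfun.diff_right)
    have lin_eq: "young_equation T (\<lambda>j t. w t $ j) ((1 / \<epsilon>) *\<^sub>R (x0 - x0) - 0) f (\<lambda>j t. column j (g t)) z"
      using young_equation_diff[OF young_equation_scaleR[OF young_equation_diff[OF solution_young(2)[OF xe[of \<epsilon>]]
          solution_young(2)[OF xs]], of "1 / \<epsilon>"] solves_path_equationD(2)[OF y]]
      unfolding f_def g_def z_def h_def ue_def column_diff column_scaleR .
    have growth: "linear_growth T \<alpha> (B * \<bar>\<epsilon>\<bar> powr p) K' f (\<lambda>j t. column j (g t)) z"
    proof (rule linear_growthI)
      fix t assume t: "0 \<le> t" "t \<le> T"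
      have "f t = blinfun_apply (bx t (xs t) (us t)) (z t) +
          ((1 / \<epsilon>) *\<^sub>R (b t (xe \<epsilon> t) (ue t) - b t (xs t) (us t)) -
          blinfun_apply (bx t (xs t) (us t)) ((1 / \<epsilon>) *\<^sub>R h t) - blinfun_apply (bu t (xs t) (us t)) (ub t))"
        by (simp add: f_def z_def blinfun.diff_right)
      also have "norm \<dots> \<le> L * norm (z t) + Q * \<bar>\<epsilon>\<bar>"
        by (intro norm_triangle_mono blinfun_apply_bound C1_lipschitzD(2)[OF drift[OF t]] remainder[OF drift[OF t] t])
      also have "\<dots> \<le> B * \<bar>\<epsilon>\<bar> powr p + K' * norm (z t)"
        using small1 mult_right_mono[OF K'(2), of "norm (z t)"] by simp
      finally show "norm (f t) \<le> B * \<bar>\<epsilon>\<bar> powr p + K' * norm (z t)" .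
      have "norm (g t) \<le> L * norm (z t) + Q * \<bar>\<epsilon>\<bar>"
        unfolding g_eq
        by (intro norm_triangle_mono blinfun_apply_bound C1_lipschitzD(2)[OF diffusion[OF t]] \<rho>_sup[OF t])
      also have "\<dots> \<le> B * \<bar>\<epsilon>\<bar> powr p + K' * norm (z t)"
        using small1 mult_right_mono[OF K'(2), of "norm (z t)"] by simp
      finally show "norm (column j (g t)) \<le> B * \<bar>\<epsilon>\<bar> powr p + K' * norm (z t)" for j
        by (rule order_trans[OF norm_column_le])
    next
      fix s t j assume st: "0 \<le> s" "s \<le> t" "t \<le> T"
      have t: "0 \<le> t" using st by simp
      have "g t - g s = blinfun_apply (\<sigma>x t (xs t) (us t)) (z t - z s) +
          (blinfun_apply (\<sigma>x t (xs t) (us t)) (z s) - blinfun_apply (\<sigma>x s (xs s) (us s)) (z s)) + (\<rho> t - \<rho> s)"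
        by (simp add: g_eq blinfun.diff_right)
      also have "norm \<dots> \<le> L * norm (z t - z s) + (S * (t - s) powr \<alpha>') * norm (z s) +
          (2 * (Q * \<bar>\<epsilon>\<bar>)) powr p * N powr (\<alpha> / \<alpha>') * (t - s) powr \<alpha>"
        by (intro norm_triangle_mono blinfun_apply_bound blinfun_apply_diff_bound C1_lipschitzD(2)[OF diffusion[OF t st(3)]]
            holder_boundD[OF cs(1) st] holder_boundD[OF \<rho>_holder st])
      also have "\<dots> \<le> L * norm (z t - z s) + (S * (T powr (\<alpha>' - \<alpha>) * (t - s) powr \<alpha>)) * norm (z s) +
          B * \<bar>\<epsilon>\<bar> powr p * (t - s) powr \<alpha>"
        using S st \<alpha>(2) by (intro add_mono mult_left_mono mult_right_mono powr_le_on_interval small2) auto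
      also have "\<dots> = L * norm (z t - z s) + (B * \<bar>\<epsilon>\<bar> powr p + (S * T powr (\<alpha>' - \<alpha>)) * norm (z s)) * (t - s) powr \<alpha>"
        by (simp add: algebra_simps)
      also have "\<dots> \<le> K' * norm (z t - z s) + (B * \<bar>\<epsilon>\<bar> powr p + K' * norm (z s)) * (t - s) powr \<alpha>"
        using K' L by (intro add_mono mult_right_mono add_left_mono) (auto simp: K'_def)
      finally show "norm (column j (g t) - column j (g s)) \<le>
          K' * norm (z t - z s) + (B * \<bar>\<epsilon>\<bar> powr p + K' * norm (z s)) * (t - s) powr \<alpha>"
        unfolding column_diff[symmetric] by (rule order_trans[OF norm_column_le])
    qed
    have "\<exists>\<kappa>>1 - H. holder_on \<kappa> T z"
    proof -
      obtain \<kappa> where \<kappa>: "\<kappa> > 1 - H" "holder_on \<kappa> T y" using solves_path_equationD(1)[OF y] by blast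
      have "holder_on (min \<kappa> \<alpha>') T y" by (rule holder_on_mono[OF \<kappa>(2)]) simp
      moreover have "holder_on \<alpha>' T (\<lambda>t. (1 / \<epsilon>) *\<^sub>R h t)"
        using h\<epsilon>(2) unfolding holder_on_def holder_bound_def by blast
      then have "holder_on (min \<kappa> \<alpha>') T (\<lambda>t. (1 / \<epsilon>) *\<^sub>R h t)" by (rule holder_on_mono) simp
      ultimately have "holder_on (min \<kappa> \<alpha>') T z"
        unfolding z_def[abs_def] by (intro holder_on_diff)
      then show ?thesis using \<kappa>(1) \<alpha>1(1) by (intro exI[of _ "min \<kappa> \<alpha>'"]) simp
    qed
    moreover have "0 \<le> B * \<bar>\<epsilon>\<bar> powr p" using B by simp
    ultimately have "(\<forall>t. 0 \<le> t \<longrightarrow> t \<le> T \<longrightarrow>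
          norm (z t) \<le> D * (B * \<bar>\<epsilon>\<bar> powr p + norm ((1 / \<epsilon>) *\<^sub>R (x0 - x0) - 0))) \<and>
        holder_bound T \<alpha> (D * (B * \<bar>\<epsilon>\<bar> powr p + norm ((1 / \<epsilon>) *\<^sub>R (x0 - x0) - 0))) z"
      by (intro Dest[rule_format, OF _ lin_eq growth])
    then have "norm (z t) \<le> D * (B * \<bar>\<epsilon>\<bar> powr p + norm ((1 / \<epsilon>) *\<^sub>R (x0 - x0) - 0))"
      using t0 by blast
    then show ?thesis by (simp add: z_def h_def mult.assoc)
  qed
  show ?thesis
  proof (intro exI allI impI conjI)
    fix \<epsilon> t :: real assume a: "\<epsilon> \<noteq> 0" "\<bar>\<epsilon>\<bar> \<le> 1" "0 \<le> t" "t \<le> T"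
    show "norm (xe \<epsilon> t - xs t) \<le> C * E * \<bar>\<epsilon>\<bar>" using diff[OF a(2)] a(3,4) by (simp add: mult_ac)
    show "norm ((1 / \<epsilon>) *\<^sub>R (xe \<epsilon> t - xs t) - y t) \<le> D * B * \<bar>\<epsilon>\<bar> powr (1 - \<alpha> / \<alpha>')"
      using main[OF a] by (simp add: p_def)
  qed
qed

end

lemma sup_norm_tendsto_zero:
  fixes F :: "real \<Rightarrow> real \<Rightarrow> 'a::real_normed_vector"
  assumes T: "0 \<le> T" and p: "0 < p"
    and F: "\<And>\<epsilon> t. \<epsilon> \<noteq> 0 \<Longrightarrow> \<bar>\<epsilon>\<bar> \<le> 1 \<Longrightarrow> 0 \<le> t \<Longrightarrow> t \<le> T \<Longrightarrow> norm (F \<epsilon> t) \<le> C * \<bar>\<epsilon>\<bar> powr p"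
  shows "((\<lambda>\<epsilon>. SUP t\<in>{0..T}. norm (F \<epsilon> t)) \<longlongrightarrow> 0) (at 0)"
proof (rule tendsto_sandwich)
  have bounds: "0 \<le> (SUP t\<in>{0..T}. norm (F \<epsilon> t)) \<and> (SUP t\<in>{0..T}. norm (F \<epsilon> t)) \<le> C * \<bar>\<epsilon>\<bar> powr p"
    if \<epsilon>: "\<epsilon> \<noteq> 0" "\<bar>\<epsilon>\<bar> < 1" for \<epsilon>
  proof
    have le: "norm (F \<epsilon> t) \<le> C * \<bar>\<epsilon>\<bar> powr p" if "t \<in> {0..T}" for t using F[of \<epsilon> t] \<epsilon> that by simp
    then show "(SUP t\<in>{0..T}. norm (F \<epsilon> t)) \<le> C * \<bar>\<epsilon>\<bar> powr p" using T by (intro cSUP_least) auto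
    have "0 \<le> norm (F \<epsilon> 0)" by simp
    also have "\<dots> \<le> (SUP t\<in>{0..T}. norm (F \<epsilon> t))"
      using T le by (intro cSUP_upper) (auto intro!: bdd_aboveI2[where M = "C * \<bar>\<epsilon>\<bar> powr p"])
    finally show "0 \<le> (SUP t\<in>{0..T}. norm (F \<epsilon> t))" .
  qed
  have near: "\<forall>\<^sub>F \<epsilon>::real in at 0. \<epsilon> \<noteq> 0 \<and> \<bar>\<epsilon>\<bar> < 1"
    by (auto simp: eventually_at intro!: exI[of _ 1])
  show "\<forall>\<^sub>F \<epsilon> in at 0. 0 \<le> (SUP t\<in>{0..T}. norm (F \<epsilon> t))"
    using near by eventually_elim (use bounds in auto)
  show "\<forall>\<^sub>F \<epsilon> in at 0. (SUP t\<in>{0..T}. norm (F \<epsilon> t)) \<le> C * \<bar>\<epsilon>\<bar> powr p"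
    using near by eventually_elim (use bounds in auto)
  have "((\<lambda>\<epsilon>::real. \<bar>\<epsilon>\<bar> powr p) \<longlongrightarrow> 0) (at 0)"
    by (rule tendsto_zero_powrI[where b = p]) (use p in \<open>auto intro!: tendsto_rabs_zero\<close>)
  then show "((\<lambda>\<epsilon>. C * \<bar>\<epsilon>\<bar> powr p) \<longlongrightarrow> 0) (at 0)" by (rule tendsto_mult_right_zero)
qed simp

lemma pathwise_linearization:
  fixes w :: "real \<Rightarrow> real^'m"
    and b :: "real \<Rightarrow> real^'n \<Rightarrow> real^'d \<Rightarrow> real^'n"
    and \<sigma> :: "real \<Rightarrow> real^'n \<Rightarrow> real^'d \<Rightarrow> real^'m^'n"
    and us ub :: "real \<Rightarrow> real^'d"
  assumes T: "0 < T" and H: "1 / 2 < H" "H < 1"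
    and w: "\<And>\<beta> l. \<beta> < H \<Longrightarrow> holder_on \<beta> T (\<lambda>t. w t $ l)"
    and drift: "drift_assumptions T b bx bu"
    and diffusion: "diffusion_assumptions T H \<sigma> \<sigma>x \<sigma>u \<sigma>xx \<sigma>xu \<sigma>uu"
    and \<mu>: "1 - H < \<mu>" and us: "holder_on \<mu> T us" and ub: "holder_on \<mu> T ub"
    and xs: "solves_controlled_equation H T w b \<sigma> x0 us xs"
    and xe: "\<And>\<epsilon>. solves_controlled_equation H T w b \<sigma> x0 (\<lambda>t. us t + \<epsilon> *\<^sub>R ub t) (xe \<epsilon>)"
    and y: "solves_path_equation H T w 0
        (\<lambda>s. blinfun_apply (bx s (xs s) (us s)) (y s) + blinfun_apply (bu s (xs s) (us s)) (ub s))
        (\<lambda>s. blinfun_apply (\<sigma>x s (xs s) (us s)) (y s) + blinfun_apply (\<sigma>u s (xs s) (us s)) (ub s)) y"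
  shows "((\<lambda>\<epsilon>. SUP t\<in>{0..T}. norm (xe \<epsilon> t - xs t)) \<longlongrightarrow> 0) (at 0) \<and>
    ((\<lambda>\<epsilon>. SUP t\<in>{0..T}. norm ((1 / \<epsilon>) *\<^sub>R (xe \<epsilon> t - xs t) - y t)) \<longlongrightarrow> 0) (at 0)"
proof -
  obtain L1 where L1: "L1 \<ge> 0" "\<forall>t\<in>{0..T}. C1_lipschitz L1 (b t) (bx t) (bu t) \<and> norm (b t 0 0) \<le> L1"
    using drift_assumptions_imp_C1_lipschitz[OF T drift] by blast
  obtain \<gamma> L2 where \<gamma>: "1 - H < \<gamma>" and L2: "0 \<le> L2"
    "\<forall>t\<in>{0..T}. C1_lipschitz L2 (\<sigma> t) (\<sigma>x t) (\<sigma>u t) \<and> norm (\<sigma> t 0 0) \<le> L2"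
    "\<forall>s\<in>{0..T}. \<forall>t\<in>{0..T}. \<forall>x u. norm (\<sigma> t x u - \<sigma> s x u) \<le> L2 * \<bar>t - s\<bar> powr \<gamma> \<and>
       norm (\<sigma>x t x u - \<sigma>x s x u) \<le> L2 * \<bar>t - s\<bar> powr \<gamma> \<and> norm (\<sigma>u t x u - \<sigma>u s x u) \<le> L2 * \<bar>t - s\<bar> powr \<gamma>"
    using diffusion_assumptions_imp_C1_lipschitz[OF T diffusion] by blast
  define L where "L = max L1 L2"
  have L: "L1 \<le> L" "L2 \<le> L" by (simp_all add: L_def)
  interpret controlled_system T H \<gamma> L w b bx bu \<sigma> \<sigma>x \<sigma>u
  proof
    show "0 < T" "1 / 2 < H" "H < 1" "1 - H < \<gamma>" by fact+
    show "0 \<le> L" using L L1 by simp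
    show "holder_on \<beta> T (\<lambda>t. w t $ j)" if "\<beta> < H" for \<beta> j using w that by blast
    fix t assume "0 \<le> t" "t \<le> T"
    then have t: "t \<in> {0..T}" by simp
    show "C1_lipschitz L (b t) (bx t) (bu t)" using L1(2) t L C1_lipschitz_mono by blast
    show "C1_lipschitz L (\<sigma> t) (\<sigma>x t) (\<sigma>u t)" using L2(2) t L C1_lipschitz_mono by blast
    show "norm (b t 0 0) \<le> L" using bspec[OF L1(2) t] L by linarith
    show "norm (\<sigma> t 0 0) \<le> L" using bspec[OF L2(2) t] L by linarith
  next
    fix s t :: real and x u assume st: "0 \<le> s" "s \<le> t" "t \<le> T"
    then have "s \<in> {0..T}" "t \<in> {0..T}" by auto
    then have *: "norm (\<sigma> t x u - \<sigma> s x u) \<le> L2 * \<bar>t - s\<bar> powr \<gamma>"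
      "norm (\<sigma>x t x u - \<sigma>x s x u) \<le> L2 * \<bar>t - s\<bar> powr \<gamma>" "norm (\<sigma>u t x u - \<sigma>u s x u) \<le> L2 * \<bar>t - s\<bar> powr \<gamma>"
      using L2(3) by blast+
    have "L2 * \<bar>t - s\<bar> powr \<gamma> \<le> L * (t - s) powr \<gamma>" using L st by (auto intro: mult_right_mono)
    then show "norm (\<sigma> t x u - \<sigma> s x u) \<le> L * (t - s) powr \<gamma>"
      "norm (\<sigma>x t x u - \<sigma>x s x u) \<le> L * (t - s) powr \<gamma>" "norm (\<sigma>u t x u - \<sigma>u s x u) \<le> L * (t - s) powr \<gamma>"
      using * by linarith+
  qed
  \<comment> \<open>Both Hoelder orders must lie strictly between \<open>1 - H\<close> and this
      number.\<close>
  define cap where "cap = min (1 / 2) (min \<gamma> \<mu>)"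
  have cap: "1 - H < cap" "cap \<le> 1 / 2" "cap \<le> \<gamma>" "cap \<le> \<mu>" using \<gamma> \<mu> H by (auto simp: cap_def)
  define \<alpha>' where "\<alpha>' = (1 - H + cap) / 2"
  define \<alpha> where "\<alpha> = (1 - H + \<alpha>') / 2"
  have \<alpha>: "1 - H < \<alpha>" "\<alpha> < \<alpha>'" "\<alpha>' < 1 / 2" "\<alpha>' \<le> \<gamma>" "\<alpha>' \<le> \<mu>"
    using cap by (auto simp: \<alpha>_def \<alpha>'_def field_simps)
  have \<alpha>0: "0 < \<alpha>'" using \<alpha> H by linarith
  obtain C1 where C1: "C1 \<ge> 0" "holder_bound T \<alpha>' C1 us"
    using holder_on_mono[OF us \<alpha>(5)] unfolding holder_on_iff_bound by blast
  obtain C2 where C2: "C2 \<ge> 0" "holder_bound T \<alpha>' C2 ub"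
    using holder_on_mono[OF ub \<alpha>(5)] unfolding holder_on_iff_bound by blast
  define S1 where "S1 = norm (us 0) + C1 * T powr \<alpha>'"
  define S2 where "S2 = norm (ub 0) + C2 * T powr \<alpha>'"
  \<comment> \<open>One constant for the supremum and the Hoelder bounds of both controls.\<close>
  define E where "E = max (max C1 C2) (max S1 S2)"
  have E: "0 \<le> E" "C1 \<le> E" "C2 \<le> E" "S1 \<le> E" "S2 \<le> E" using C1 by (auto simp: E_def)
  have us_sup: "norm (us t) \<le> E" if "0 \<le> t" "t \<le> T" for t
    using holder_bound_sup[OF C1(2,1) _ that] \<alpha>0 E by (simp add: S1_def)
  have ub_sup: "norm (ub t) \<le> E" if "0 \<le> t" "t \<le> T" for t
    using holder_bound_sup[OF C2(2,1) _ that] \<alpha>0 E by (simp add: S2_def)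
  have "\<exists>C1 C2. \<forall>\<epsilon> t. \<epsilon> \<noteq> 0 \<longrightarrow> \<bar>\<epsilon>\<bar> \<le> 1 \<longrightarrow> 0 \<le> t \<longrightarrow> t \<le> T \<longrightarrow>
    norm (xe \<epsilon> t - xs t) \<le> C1 * \<bar>\<epsilon>\<bar> \<and>
    norm ((1 / \<epsilon>) *\<^sub>R (xe \<epsilon> t - xs t) - y t) \<le> C2 * \<bar>\<epsilon>\<bar> powr (1 - \<alpha> / \<alpha>')"
    by (rule solution_linearization[where ?x0.0 = x0, OF \<alpha>(1-4) E(1) us_sup holder_bound_weaken[OF C1(2) E(2)]
          ub_sup holder_bound_weaken[OF C2(2) E(3)] _ _ y]) (simp_all add: solution_def xs xe)
  then obtain D1 D2 where D: "\<forall>\<epsilon> t. \<epsilon> \<noteq> 0 \<longrightarrow> \<bar>\<epsilon>\<bar> \<le> 1 \<longrightarrow> 0 \<le> t \<longrightarrow> t \<le> T \<longrightarrow>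
    norm (xe \<epsilon> t - xs t) \<le> D1 * \<bar>\<epsilon>\<bar> \<and>
    norm ((1 / \<epsilon>) *\<^sub>R (xe \<epsilon> t - xs t) - y t) \<le> D2 * \<bar>\<epsilon>\<bar> powr (1 - \<alpha> / \<alpha>')" by (elim exE) (rule that)
  have p: "0 < 1 - \<alpha> / \<alpha>'" using \<alpha> \<alpha>0 by (simp add: field_simps)
  show ?thesis
  proof (rule conjI)
    show "((\<lambda>\<epsilon>. SUP t\<in>{0..T}. norm (xe \<epsilon> t - xs t)) \<longlongrightarrow> 0) (at 0)"
      by (rule sup_norm_tendsto_zero[where C = D1 and p = 1]) (use D T in auto)
    show "((\<lambda>\<epsilon>. SUP t\<in>{0..T}. norm ((1 / \<epsilon>) *\<^sub>R (xe \<epsilon> t - xs t) - y t)) \<longlongrightarrow> 0) (at 0)"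
      by (rule sup_norm_tendsto_zero[OF _ p, where C = D2]) (use D T in auto)
  qed
qed

section \<open>The almost sure statement\<close>

theorem proposition4p1:
  fixes M :: "'w measure"
    and T H cH :: real
    and B W :: "real \<Rightarrow> 'w \<Rightarrow> real^'m"
    and \<xi> :: "nat \<Rightarrow> real \<Rightarrow> real"
    and \<eta> :: "nat \<Rightarrow> 'm \<Rightarrow> 'w \<Rightarrow> real"
    and G :: "real \<Rightarrow> 'w measure"
    and b :: "real \<Rightarrow> real^'n \<Rightarrow> real^'d \<Rightarrow> real^'n"
    and bx :: "real \<Rightarrow> real^'n \<Rightarrow> real^'d \<Rightarrow> (real^'n) \<Rightarrow>\<^sub>L (real^'n)"
    and bu :: "real \<Rightarrow> real^'n \<Rightarrow> real^'d \<Rightarrow> (real^'d) \<Rightarrow>\<^sub>L (real^'n)"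
    and \<sigma> :: "real \<Rightarrow> real^'n \<Rightarrow> real^'d \<Rightarrow> real^'m^'n"
    and \<sigma>x :: "real \<Rightarrow> real^'n \<Rightarrow> real^'d \<Rightarrow> (real^'n) \<Rightarrow>\<^sub>L (real^'m^'n)"
    and \<sigma>u :: "real \<Rightarrow> real^'n \<Rightarrow> real^'d \<Rightarrow> (real^'d) \<Rightarrow>\<^sub>L (real^'m^'n)"
    and \<sigma>xx :: "real \<Rightarrow> real^'n \<Rightarrow> real^'d \<Rightarrow> (real^'n) \<Rightarrow>\<^sub>L ((real^'n) \<Rightarrow>\<^sub>L (real^'m^'n))"
    and \<sigma>xu :: "real \<Rightarrow> real^'n \<Rightarrow> real^'d \<Rightarrow> (real^'d) \<Rightarrow>\<^sub>L ((real^'n) \<Rightarrow>\<^sub>L (real^'m^'n))"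
    and \<sigma>uu :: "real \<Rightarrow> real^'n \<Rightarrow> real^'d \<Rightarrow> (real^'d) \<Rightarrow>\<^sub>L ((real^'d) \<Rightarrow>\<^sub>L (real^'m^'n))"
    and x0 :: "real^'n"
    and us v :: "real \<Rightarrow> 'w \<Rightarrow> real^'d"
    and ubar :: "real \<Rightarrow> 'w \<Rightarrow> real^'d"
    and ueps :: "real \<Rightarrow> real \<Rightarrow> 'w \<Rightarrow> real^'d"
    and xs y :: "real \<Rightarrow> 'w \<Rightarrow> real^'n"
    and xeps :: "real \<Rightarrow> real \<Rightarrow> 'w \<Rightarrow> real^'n"
  assumes prob: "prob_space M"
    and T: "0 < T" and H: "1 / 2 < H" "H < 1"
    and B: "fractional_brownian_motion M H T B"
    and W: "underlying_brownian_motion M H T B W"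
    and basis: "smooth_orthonormal_basis T \<xi>"
    and cH: "basis_integrals M H T cH B W \<xi> \<eta>"
    and G: "right_continuous_subfiltration T (natural_sigma M B) G"
    and drift: "drift_assumptions T b bx bu"
    and diffusion: "diffusion_assumptions T H \<sigma> \<sigma>x \<sigma>u \<sigma>xx \<sigma>xu \<sigma>uu"
    and us: "admissible_control M H T B G (\<lambda>j. eta_transform H T cH (\<xi> j)) \<eta> us"
    and v: "admissible_control M H T B G (\<lambda>j. eta_transform H T cH (\<xi> j)) \<eta> v"
    and ubar: "\<And>t \<omega>. ubar t \<omega> = v t \<omega> - us t \<omega>"
    and ueps: "\<And>\<epsilon> t \<omega>. ueps \<epsilon> t \<omega> = us t \<omega> + \<epsilon> *\<^sub>R ubar t \<omega>"
    and xeps: "AE \<omega> in M. \<forall>\<epsilon>. solves_controlled_equation H T (\<lambda>t. B t \<omega>) b \<sigma> x0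
        (\<lambda>t. ueps \<epsilon> t \<omega>) (\<lambda>t. xeps \<epsilon> t \<omega>)"
    and xs: "AE \<omega> in M. solves_controlled_equation H T (\<lambda>t. B t \<omega>) b \<sigma> x0
        (\<lambda>t. us t \<omega>) (\<lambda>t. xs t \<omega>)"
    and y: "AE \<omega> in M. solves_path_equation H T (\<lambda>t. B t \<omega>) 0
        (\<lambda>s. blinfun_apply (bx s (xs s \<omega>) (us s \<omega>)) (y s \<omega>) +
             blinfun_apply (bu s (xs s \<omega>) (us s \<omega>)) (ubar s \<omega>))
        (\<lambda>s. blinfun_apply (\<sigma>x s (xs s \<omega>) (us s \<omega>)) (y s \<omega>) +
             blinfun_apply (\<sigma>u s (xs s \<omega>) (us s \<omega>)) (ubar s \<omega>))
        (\<lambda>t. y t \<omega>)"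
  shows "AE \<omega> in M.
      ((\<lambda>\<epsilon>. SUP t\<in>{0..T}. norm (xeps \<epsilon> t \<omega> - xs t \<omega>)) \<longlongrightarrow> 0) (at 0) \<and>
      ((\<lambda>\<epsilon>. SUP t\<in>{0..T}. norm ((1 / \<epsilon>) *\<^sub>R (xeps \<epsilon> t \<omega> - xs t \<omega>) - y t \<omega>)) \<longlongrightarrow> 0) (at 0)"
proof -
  interpret prob_space M by (rule prob)
  obtain \<mu>1 where \<mu>1: "1 - H < \<mu>1" and us_holder: "AE \<omega> in M. holder_on \<mu>1 T (\<lambda>t. us t \<omega>)"
    using us unfolding admissible_control_def by blast
  obtain \<mu>2 where \<mu>2: "1 - H < \<mu>2" and v_holder: "AE \<omega> in M. holder_on \<mu>2 T (\<lambda>t. v t \<omega>)"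
    using v unfolding admissible_control_def by blast
  define \<mu> where "\<mu> = min \<mu>1 \<mu>2"
  have \<mu>: "1 - H < \<mu>" using \<mu>1 \<mu>2 by (simp add: \<mu>_def)
  have "AE \<omega> in M. \<forall>\<beta><H. \<forall>l. holder_on \<beta> T (\<lambda>t. B t \<omega> $ l)"
    using H by (intro fbm_holder[OF B T]) simp
  then show ?thesis
    using us_holder v_holder xeps xs y
  proof eventually_elim
    case (elim \<omega>)
    have us': "holder_on \<mu> T (\<lambda>t. us t \<omega>)" by (rule holder_on_mono[OF elim(2)]) (simp add: \<mu>_def)
    have v': "holder_on \<mu> T (\<lambda>t. v t \<omega>)" by (rule holder_on_mono[OF elim(3)]) (simp add: \<mu>_def)
    have ubar': "holder_on \<mu> T (\<lambda>t. ubar t \<omega>)"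
      unfolding ubar by (rule holder_on_diff[OF v' us'])
    have xe: "solves_controlled_equation H T (\<lambda>t. B t \<omega>) b \<sigma> x0
        (\<lambda>t. us t \<omega> + \<epsilon> *\<^sub>R ubar t \<omega>) (\<lambda>t. xeps \<epsilon> t \<omega>)" for \<epsilon>
      using spec[OF elim(4), of \<epsilon>] unfolding ueps .
    show ?case
    proof (rule pathwise_linearization[OF T H _ drift diffusion \<mu> us' ubar' elim(5) xe elim(6)])
      show "holder_on \<beta> T (\<lambda>t. B t \<omega> $ l)" if "\<beta> < H" for \<beta> l
        using elim(1) that by blast
    qed
  qed
qed

end
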